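(* For every $n\in\mathbb{N}$, $\Phi_n^4=I$ on $L^2(\mathbb{R})$.
   Context: $c_n(\eta)=\sum_{l\ge0}\frac{(-1)^l n}{(2n)^{2l+\frac{1}{2n}}\Gamma(l+\frac{1}{2n})l!}\eta^{2nl}$; $\mathcal{H}$ is the Hilbert transform ($\mathcal{H}f(x)=\frac1\pi\,\mathrm{p.v.}\int\frac{f(t)}{x-t}dt$ on $L^2(\mathbb{R})$, extended to tempered distributions); $s_n=-\mathcal{H}c_n$, $\varphi_n=c_n+is_n$. Let $\phi=\mathbf{1}_{[0,1]}$, $\phi_{j,k}(t)=\phi(2^jt-k)$, $V_j$ the finite linear span of $\{\phi_{j,k}\}_{k\in\mathbb{Z}}$, $V_j^+$ its even elements. On $D_j=V_j^+\oplus\mathcal{H}(V_j^+)$, $\Phi_n g(\omega)=\int\varphi_n(\omega t)g(t)\,dt$ (for even $g$: $\int c_n(\omega t)g(t)dt$; for odd $g\in\mathcal{H}(V_j^+)$: $i\int s_n(\omega t)g(t)dt$ understood distributionally, equal to $i\operatorname{sgn}(\omega)\int c_n(\omega t)(\mathcal{H}g)(t)dt$). $\Phi_n$ denotes the unique bounded extension to $L^2(\mathbb{R})$ of this map from the dense set $\bigcup_j D_j$. *)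

theory Defs
  imports "HOL-Analysis.Analysis"
begin

definition cn :: "nat \<Rightarrow> real \<Rightarrow> real" where
  "cn n \<eta> = (\<Sum>l. ((-1) ^ l * real n /
      ((2 * real n) powr (2 * real l + 1 / (2 * real n)) * Gamma (real l + 1 / (2 * real n)) * fact l))
      * \<eta> ^ (2 * n * l))"

definition hilbert :: "(real \<Rightarrow> complex) \<Rightarrow> real \<Rightarrow> complex" where
  "hilbert f x = Lim (at_right 0)
     (\<lambda>\<epsilon>::real. complex_of_real (1 / pi) *
        (LINT t|lborel. indicator {t. \<epsilon> < \<bar>x - t\<bar>} t * (f t / complex_of_real (x - t))))"

definition haar_phi :: "real \<Rightarrow> real" where
  "haar_phi t = indicator {0..1} t"

definition Vj :: "int \<Rightarrow> (real \<Rightarrow> complex) set" where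
  "Vj j = {g. \<exists>K a. finite K \<and>
      g = (\<lambda>t. \<Sum>k\<in>K. (a k :: complex) * complex_of_real (haar_phi (2 powr (real_of_int j) * t - real_of_int k)))}"

definition Vj_plus :: "int \<Rightarrow> (real \<Rightarrow> complex) set" where
  "Vj_plus j = {g \<in> Vj j. \<forall>t. g (- t) = g t}"

definition L2 :: "(real \<Rightarrow> complex) set" where
  "L2 = {f. f \<in> borel_measurable lborel \<and> integrable lborel (\<lambda>x. (norm (f x))\<^sup>2)}"

definition ae_eq :: "(real \<Rightarrow> complex) \<Rightarrow> (real \<Rightarrow> complex) \<Rightarrow> bool" where
  "ae_eq f g \<longleftrightarrow> (AE x in lborel. f x = g x)"

definition L2norm :: "(real \<Rightarrow> complex) \<Rightarrow> real" where
  "L2norm f = sqrt (LINT x|lborel. (norm (f x))\<^sup>2)"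

text \<open>Phi_n on D_j = V_j^+ (+) H(V_j^+): for g = h1 + H h2 with h1, h2 in V_j^+,
  the even part contributes int c_n(omega t) h1(t) dt and the odd part g_o = H h2
  contributes i sgn(omega) int c_n(omega t) (H g_o)(t) dt.\<close>
definition Phi_D :: "nat \<Rightarrow> (real \<Rightarrow> complex) \<Rightarrow> (real \<Rightarrow> complex) \<Rightarrow> real \<Rightarrow> complex" where
  "Phi_D n h1 h2 \<omega> =
     (LINT t|lborel. complex_of_real (cn n (\<omega> * t)) * h1 t)
     + \<i> * complex_of_real (sgn \<omega>) *
       (LINT t|lborel. complex_of_real (cn n (\<omega> * t)) * hilbert (hilbert h2) t)"

definition is_Phi_ext :: "nat \<Rightarrow> ((real \<Rightarrow> complex) \<Rightarrow> (real \<Rightarrow> complex)) \<Rightarrow> bool" where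
  "is_Phi_ext n T \<longleftrightarrow>
     (\<forall>f\<in>L2. T f \<in> L2)
   \<and> (\<forall>f\<in>L2. \<forall>g\<in>L2. ae_eq f g \<longrightarrow> ae_eq (T f) (T g))
   \<and> (\<forall>f\<in>L2. \<forall>g\<in>L2. ae_eq (T (\<lambda>x. f x + g x)) (\<lambda>x. T f x + T g x))
   \<and> (\<forall>f\<in>L2. \<forall>c::complex. ae_eq (T (\<lambda>x. c * f x)) (\<lambda>x. c * T f x))
   \<and> (\<exists>C. \<forall>f\<in>L2. L2norm (T f) \<le> C * L2norm f)
   \<and> (\<forall>j h1 h2. h1 \<in> Vj_plus j \<longrightarrow> h2 \<in> Vj_plus j \<longrightarrow>
        ae_eq (T (\<lambda>t. h1 t + hilbert h2 t)) (Phi_D n h1 h2))"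

end

theory Submission
  imports Defs "HOL-Real_Asymp.Real_Asymp"
begin

text \<open>On even functions \<open>\<Phi>\<^sub>n\<close> maps \<open>G s = (\<lambda>t. exp (- s * t ^ (2 * n)))\<close> to
  \<open>(2 * n * s) powr (- 1 / (2 * n))\<close> times \<open>G (1 / (4 * n\<^sup>2 * s))\<close>; this is what the Gamma factors in \<open>c\<^sub>n\<close>
  are for. The \<open>G s\<close> are total among the even functions, and comparing Gram matrices shows that \<open>\<Phi>\<^sub>n\<close> is an
  isometric involution there. Let \<open>e a\<close> be the indicator function of \<open>{-a..a}\<close>. By scaling, the inner product of
  \<open>sgn \<cdot> \<H> (e a)\<close> and \<open>\<Phi>\<^sub>n (e b)\<close> depends only on \<open>a * b\<close>, hence is symmetric in \<open>a\<close> and \<open>b\<close>;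
  this gives \<open>\<Phi>\<^sub>n \<circ> sgn \<circ> \<H> = - \<H> \<circ> sgn \<circ> \<Phi>\<^sub>n\<close> on even functions. Together with \<open>\<H> \<circ> \<H> = - 1\<close> it
  follows that \<open>\<Phi>\<^sub>n \<circ> \<Phi>\<^sub>n\<close> is \<open>1\<close> on even and \<open>- 1\<close> on odd functions.\<close>

section \<open>Isometries of Hilbert spaces\<close>

text \<open>No Fourier transform enters. Both the involution and \<open>Hilbert_op\<close> are
  produced by \<open>isometry_extension\<close> from explicit total families, Gaussians in one case
  and intervals in the other, and are matched with the given integral formulas only afterwards. The
  obstacle on the side of \<open>cn\<close> is that it is known only as a power series with
  alternating signs, so no decay of it is available. Its integrals are therefore tested against
  \<open>gauss n s\<close>, whose decay beats the majorant \<open>cn_abs\<close>. On the side of the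
  Hilbert transform, \<open>hilbert\<close> is a pointwise limit, needed only for step functions and
  for their transforms, which are sums of logarithms. Two integrals carry this part: that of
  \<open>(log_ratio t)\<^sup>2\<close> gives the isometry, and that of
  \<open>log_ratio t / t\<close> gives \<open>hilbert (hilbert h) = - h\<close> off the jumps. Both
  rest on the sum of the inverse odd squares, which is where \<open>pi\<close> comes from. The type
  \<open>l2\<close> has a real inner product, so complex linearity is tracked separately through
  \<open>cmul\<close>.\<close>

lemma closed_subspace_orthogonal_vector:
  fixes S :: "'a::{real_inner,complete_space} set"
  assumes S: "subspace S" "closed S" and x: "x \<notin> S"
  obtains z where "z \<noteq> 0" "\<And>s. s \<in> S \<Longrightarrow> inner z s = 0"
proof -
  define d where "d = infdist x S"
  have ne: "S \<noteq> {}" using S(1) subspace_0 by blast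
  have d_le: "d \<le> norm (x - s)" if "s \<in> S" for s
    using infdist_le[OF that, of x] by (simp add: d_def dist_norm)
  have d0: "d \<ge> 0" by (simp add: d_def infdist_nonneg)
  have "\<exists>s\<in>S. norm (x - s) < d + inverse (real (Suc k))" for k
  proof (rule ccontr)
    assume "\<not> ?thesis"
    then have "\<And>s. s \<in> S \<Longrightarrow> d + inverse (real (Suc k)) \<le> dist x s"
      by (auto simp: dist_norm not_less)
    then have "d + inverse (real (Suc k)) \<le> infdist x S"
      using ne by (simp add: infdist_def cINF_greatest)
    then show False by (simp add: d_def)
  qed
  then obtain s where s: "\<And>k. s k \<in> S" "\<And>k. norm (x - s k) < d + inverse (real (Suc k))"
    by metis
  \<comment> \<open>Parallelogram law for \<open>x - s k\<close> and \<open>x - s l\<close>: the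
    midpoint of \<open>s k\<close> and \<open>s l\<close> lies in \<open>S\<close>, so its distance
    from \<open>x\<close> is at least \<open>d\<close>. This forces a minimizing sequence to be
    Cauchy.\<close>
  have par: "(norm (s k - s l))\<^sup>2 \<le> 2 * ((norm (x - s k))\<^sup>2 - d\<^sup>2) + 2 * ((norm (x - s l))\<^sup>2 - d\<^sup>2)" for k l
  proof -
    have "(1/2) *\<^sub>R (s k + s l) \<in> S"
      using S(1) s(1) by (simp add: subspace_add subspace_scale)
    from d_le[OF this] have "d\<^sup>2 \<le> (norm (x - (1/2) *\<^sub>R (s k + s l)))\<^sup>2"
      using d0 by (intro power_mono)
    then show ?thesis
      unfolding power2_norm_eq_inner
      by (simp add: inner_diff_left inner_diff_right inner_add_left inner_add_right inner_commute algebra_simps)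
  qed
  have lim: "(\<lambda>k. norm (x - s k)) \<longlonglongrightarrow> d"
  proof (rule tendsto_sandwich[of "\<lambda>_. d" _ _ "\<lambda>k. d + inverse (real (Suc k))"])
    show "(\<lambda>k. d + inverse (real (Suc k))) \<longlonglongrightarrow> d"
      using tendsto_add[OF tendsto_const LIMSEQ_inverse_real_of_nat, of d] by simp
    show "\<forall>\<^sub>F k in sequentially. norm (x - s k) \<le> d + inverse (real (Suc k))"
      using s(2) by (intro always_eventually) (simp add: less_imp_le del: of_nat_Suc)
  qed (use d_le s in \<open>auto intro!: always_eventually\<close>)
  then have lim2: "(\<lambda>k. (norm (x - s k))\<^sup>2 - d\<^sup>2) \<longlonglongrightarrow> 0"
    using tendsto_diff[OF tendsto_power[OF lim, of 2] tendsto_const, of "d\<^sup>2"] by simp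
  have "Cauchy s"
    unfolding Cauchy_def
  proof (intro allI impI)
    fix e :: real assume e: "e > 0"
    have "\<forall>\<^sub>F k in sequentially. (norm (x - s k))\<^sup>2 - d\<^sup>2 < e\<^sup>2 / 4"
      using order_tendstoD(2)[OF lim2, of "e\<^sup>2/4"] e by simp
    then obtain N where N: "\<And>k. k \<ge> N \<Longrightarrow> (norm (x - s k))\<^sup>2 - d\<^sup>2 < e\<^sup>2 / 4"
      by (auto simp: eventually_sequentially)
    have "dist (s k) (s l) < e" if "k \<ge> N" "l \<ge> N" for k l
    proof -
      have "(norm (s k - s l))\<^sup>2 < e\<^sup>2"
        using par[of k l] N[OF that(1)] N[OF that(2)] by simp
      then show ?thesis
        using e by (simp add: dist_norm power2_less_imp_less)
    qed
    then show "\<exists>M. \<forall>m\<ge>M. \<forall>n\<ge>M. dist (s m) (s n) < e" by blast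
  qed
  then obtain p where p: "s \<longlonglongrightarrow> p"
    using Cauchy_convergent convergent_def by blast
  have pS: "p \<in> S" using closed_sequentially[OF S(2) s(1) p] .
  have nd: "norm (x - p) = d"
    using LIMSEQ_unique[OF tendsto_norm[OF tendsto_diff[OF tendsto_const p]] lim] .
  show ?thesis
  proof (rule that[of "x - p"])
    show "x - p \<noteq> 0" using x pS by auto
    fix w assume w: "w \<in> S"
    show "inner (x - p) w = 0"
    proof (cases "w = 0")
      case False
      \<comment> \<open>This multiple of \<open>w\<close> is the point of its line closest to
        \<open>x - p\<close>; minimality of \<open>p\<close> then leaves no room for a nonzero inner
        product.\<close>
      define c where "c = inner (x - p) w / inner w w"
      have ww: "inner w w > 0" using False by simp
      have "p + c *\<^sub>R w \<in> S" using S(1) pS w by (simp add: subspace_add subspace_scale)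
      from d_le[OF this] have "d\<^sup>2 \<le> (norm ((x - p) - c *\<^sub>R w))\<^sup>2"
        using d0 by (intro power_mono) (simp_all add: algebra_simps)
      also have "\<dots> = d\<^sup>2 - 2 * c * inner (x - p) w + c\<^sup>2 * inner w w"
        unfolding nd[symmetric] power2_norm_eq_inner
        by (simp add: inner_diff_left inner_diff_right inner_commute algebra_simps power2_eq_square)
      also have "\<dots> = d\<^sup>2 - (inner (x - p) w)\<^sup>2 / inner w w"
        using ww by (simp add: c_def power2_eq_square field_simps)
      finally have "(inner (x - p) w)\<^sup>2 / inner w w \<le> 0" by simp
      then show ?thesis using ww by (simp add: divide_le_0_iff)
    qed simp
  qed
qed

lemma subspace_closure_normed:
  fixes S :: "'a::real_normed_vector set"
  assumes S: "subspace S"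
  shows "subspace (closure S)"
  unfolding subspace_def
proof (intro conjI ballI allI)
  show "0 \<in> closure S" using subspace_0[OF S] closure_subset by blast
next
  fix x y assume "x \<in> closure S" "y \<in> closure S"
  then obtain f g where "\<And>n. f n \<in> S" "f \<longlonglongrightarrow> x" "\<And>n. g n \<in> S" "g \<longlonglongrightarrow> y"
    unfolding closure_sequential by blast
  then show "x + y \<in> closure S"
    unfolding closure_sequential using subspace_add[OF S]
    by (intro exI[of _ "\<lambda>n. f n + g n"]) (auto intro: tendsto_add)
next
  fix r :: real and x assume "x \<in> closure S"
  then obtain f where "\<And>n. f n \<in> S" "f \<longlonglongrightarrow> x"
    unfolding closure_sequential by blast
  then show "r *\<^sub>R x \<in> closure S"
    unfolding closure_sequential using subspace_scale[OF S]
    by (intro exI[of _ "\<lambda>n. r *\<^sub>R f n"]) (auto intro: tendsto_scaleR tendsto_const)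
qed

text \<open>The inner product is real, so a family meant to be total over the complex numbers has to
  list its complex multiples; hence the factors \<open>cmul c\<close> in the families below.\<close>

definition total_family :: "'a::real_inner set \<Rightarrow> bool" where
  "total_family S \<longleftrightarrow> (\<forall>x. (\<forall>s\<in>S. inner x s = 0) \<longrightarrow> x = 0)"

lemma total_closure_span:
  fixes S :: "'a::{real_inner,complete_space} set"
  assumes "total_family S"
  shows "closure (span S) = UNIV"
proof (rule ccontr)
  assume "\<not> ?thesis"
  then obtain x where "x \<notin> closure (span S)" by blast
  then obtain z where z: "z \<noteq> 0" "\<And>s. s \<in> closure (span S) \<Longrightarrow> inner z s = 0"
    using closed_subspace_orthogonal_vector[of "closure (span S)" x]
    by (metis closed_closure subspace_closure_normed subspace_span)
  then have "\<forall>s\<in>S. inner z s = 0"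
    by (meson closure_subset span_base subsetD)
  with assms z(1) show False by (auto simp: total_family_def)
qed

text \<open>Reduces identities between bounded operators to generators: the set of agreement is
  closed and contains the span.\<close>

lemma total_eqI:
  fixes f g :: "'a::{real_inner,complete_space} \<Rightarrow> 'b::real_normed_vector"
  assumes "total_family S" and f: "bounded_linear f" and g: "bounded_linear g"
    and eq: "\<And>s. s \<in> S \<Longrightarrow> f s = g s"
  shows "f x = g x"
proof -
  interpret f: bounded_linear f by fact
  interpret g: bounded_linear g by fact
  have 1: "f y = g y" if "y \<in> span S" for y
    using linear_eq_on_span[OF f.linear g.linear eq that] .
  have "closed {y. f y = g y}"
    by (intro closed_Collect_eq linear_continuous_on f g)
  then have "closure (span S) \<subseteq> {y. f y = g y}"
    using 1 by (intro closure_minimal) auto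
  then show ?thesis using total_closure_span[OF assms(1)] by auto
qed

text \<open>The isometry is found through its graph: the closed linear span of the pairs \<open>(u i, v i)\<close>.\<close>

lemma isometry_extension:
  fixes u v :: "'i \<Rightarrow> 'a::{real_inner,complete_space}"
  assumes tot: "total_family (range u)"
    and gram: "\<And>i j. inner (u i) (u j) = inner (v i) (v j)"
  obtains T where "bounded_linear T" "\<And>i. T (u i) = v i" "\<And>x y. inner (T x) (T y) = inner x y"
proof -
  define G0 where "G0 = span (range (\<lambda>i. (u i, v i)))"
  define G where "G = closure G0"
  have sub0: "subspace G0" by (simp add: G0_def)
  have sub: "subspace G" by (simp add: G_def subspace_closure_normed sub0)
  \<comment> \<open>The Gram identity is extended to the span in one argument at a time, since for a
    fixed other argument it defines a subspace of pairs.\<close>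
  have 1: "inner (fst p) (u i) = inner (snd p) (v i)" if "p \<in> G0" for p i
  proof -
    have "subspace {p :: 'a \<times> 'a. inner (fst p) (u i) = inner (snd p) (v i)}"
      by (auto simp: subspace_def inner_add_left)
    then have "G0 \<subseteq> {p. inner (fst p) (u i) = inner (snd p) (v i)}"
      unfolding G0_def using gram by (intro span_minimal) auto
    then show ?thesis using that by auto
  qed
  have 2: "inner (fst p) (fst q) = inner (snd p) (snd q)" if "q \<in> G0" "p \<in> G0" for p q
  proof -
    have "subspace {q :: 'a \<times> 'a. inner (fst p) (fst q) = inner (snd p) (snd q)}"
      by (auto simp: subspace_def inner_add_right)
    then have "G0 \<subseteq> {q. inner (fst p) (fst q) = inner (snd p) (snd q)}"
      unfolding G0_def using 1[OF that(2)] by (intro span_minimal) (auto simp: G0_def)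
    then show ?thesis using that by auto
  qed
  have n0: "norm (fst p) = norm (snd p)" if "p \<in> G0" for p
    using 2[OF that that] by (simp add: norm_eq_sqrt_inner)
  have nG: "norm (fst p) = norm (snd p)" if "p \<in> G" for p
  proof -
    have "closed {p :: 'a \<times> 'a. norm (fst p) = norm (snd p)}"
      by (intro closed_Collect_eq continuous_intros)
    then have "G \<subseteq> {p. norm (fst p) = norm (snd p)}"
      unfolding G_def using n0 by (intro closure_minimal) auto
    then show ?thesis using that by auto
  qed
  have uniq: "y = y'" if "(x, y) \<in> G" "(x, y') \<in> G" for x y y'
    using nG[OF subspace_diff[OF sub that]] by simp
  have "\<exists>y. (x, y) \<in> G" for x
  proof -
    have "fst ` G0 = span (range u)"
      unfolding G0_def
      by (subst linear_span_image[symmetric]) (auto simp: image_image linear_fst)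
    moreover have "x \<in> closure (span (range u))"
      using total_closure_span[OF tot] by simp
    ultimately obtain s where s: "\<And>k. s k \<in> fst ` G0" "s \<longlonglongrightarrow> x"
      unfolding closure_sequential by metis
    then have "\<forall>k. \<exists>y. (s k, y) \<in> G0" by force
    then obtain y where y: "\<And>k. (s k, y k) \<in> G0" by metis
    \<comment> \<open>The isometry on \<open>G0\<close> turns convergence of the first components
      into the Cauchy property of the second ones; completeness then puts every \<open>x\<close>
      into the domain of the graph.\<close>
    have "dist (y k) (y l) = dist (s k) (s l)" for k l
      using n0[OF subspace_diff[OF sub0 y[of k] y[of l]]] by (simp add: dist_norm)
    then have "Cauchy y"
      using LIMSEQ_imp_Cauchy[OF s(2)] by (simp add: Cauchy_def)
    then obtain z where "y \<longlonglongrightarrow> z"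
      using Cauchy_convergent convergent_def by blast
    then have "(\<lambda>k. (s k, y k)) \<longlonglongrightarrow> (x, z)"
      using s(2) by (intro tendsto_Pair)
    then have "(x, z) \<in> G"
      using y unfolding G_def closure_sequential by (intro exI[of _ "\<lambda>k. (s k, y k)"]) blast
    then show ?thesis ..
  qed
  then obtain T where T: "\<And>x. (x, T x) \<in> G" by metis
  have TI: "T x = y" if "(x, y) \<in> G" for x y using uniq[OF T that] .
  have add: "T (x + y) = T x + T y" for x y
    using subspace_add[OF sub T[of x] T[of y]] by (intro TI) simp
  have scale: "T (r *\<^sub>R x) = r *\<^sub>R T x" for r x
    using subspace_scale[OF sub T[of x], of r] by (intro TI) simp
  have nT: "norm (T x) = norm x" for x
    using nG[OF T[of x]] by simp
  show ?thesis
  proof (rule that[of T])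
    show bl: "bounded_linear T"
      by (rule bounded_linear_intro[of _ 1]) (auto simp: add scale nT)
    show "T (u i) = v i" for i
      by (rule TI) (auto simp: G_def G0_def intro!: subsetD[OF closure_subset] span_base)
    show "inner (T x) (T y) = inner x y" for x y
    proof -
      \<comment> \<open>Polarization: preservation of norms gives preservation of inner
        products.\<close>
      have "inner (T x + T y) (T x + T y) = inner (x + y) (x + y)"
        using nT[of "x + y"] by (simp add: add norm_eq_sqrt_inner)
      moreover have "inner (T x) (T x) = inner x x" "inner (T y) (T y) = inner y y"
        using nT by (simp_all add: norm_eq_sqrt_inner)
      ultimately show ?thesis
        by (simp add: inner_add_left inner_add_right inner_commute)
    qed
  qed
qed

section \<open>The space of square integrable functions\<close>

lemma L2_measurable [measurable_dest]: "f \<in> L2 \<Longrightarrow> f \<in> borel_measurable borel"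
  by (simp add: L2_def)

lemma L2_integrable_sq: "f \<in> L2 \<Longrightarrow> integrable lborel (\<lambda>x. (norm (f x))\<^sup>2)"
  by (simp add: L2_def)

lemma L2I_bound:
  assumes [measurable]: "f \<in> borel_measurable lborel"
    and "integrable lborel g" "\<And>x. (norm (f x))\<^sup>2 \<le> g x"
  shows "f \<in> L2"
proof -
  have "AE x in lborel. norm ((norm (f x))\<^sup>2) \<le> norm (g x)"
    using assms(3) by (intro AE_I2) (simp add: order_trans[OF _ abs_ge_self])
  then show ?thesis
    unfolding L2_def by (auto intro: Bochner_Integration.integrable_bound[OF assms(2)])
qed

lemma norm_add_sq_le:
  fixes a b :: "'a::real_normed_vector"
  shows "(norm (a + b))\<^sup>2 \<le> 2 * (norm a)\<^sup>2 + 2 * (norm b)\<^sup>2"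
proof -
  have "(norm (a + b))\<^sup>2 \<le> (norm a + norm b)\<^sup>2"
    by (intro power_mono norm_triangle_ineq) simp
  also have "\<dots> \<le> 2 * (norm a)\<^sup>2 + 2 * (norm b)\<^sup>2"
    using zero_le_power2[of "norm a - norm b"] unfolding power2_eq_square by (simp add: algebra_simps)
  finally show ?thesis .
qed

lemma L2_add:
  assumes "f \<in> L2" "g \<in> L2"
  shows "(\<lambda>x. f x + g x) \<in> L2"
proof (rule L2I_bound)
  show "(\<lambda>x. f x + g x) \<in> borel_measurable lborel" using assms by measurable
  show "integrable lborel (\<lambda>x. 2 * (norm (f x))\<^sup>2 + 2 * (norm (g x))\<^sup>2)"
    by (intro Bochner_Integration.integrable_add integrable_mult_right L2_integrable_sq assms)
qed (rule norm_add_sq_le)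

lemma L2_bounded_mult:
  assumes f: "f \<in> L2" and [measurable]: "m \<in> borel_measurable lborel" and b: "\<And>x. norm (m x) \<le> B"
  shows "(\<lambda>x. m x * f x) \<in> L2"
proof (rule L2I_bound)
  show "(\<lambda>x. m x * f x) \<in> borel_measurable lborel" using f by measurable
  show "integrable lborel (\<lambda>x. B\<^sup>2 * (norm (f x))\<^sup>2)"
    using f by (auto intro: L2_integrable_sq)
  show "(norm (m x * f x))\<^sup>2 \<le> B\<^sup>2 * (norm (f x))\<^sup>2" for x
    using b[of x] unfolding norm_mult power_mult_distrib
    by (intro mult_right_mono power_mono) auto
qed

lemma L2_cmult: "f \<in> L2 \<Longrightarrow> (\<lambda>x. c * f x) \<in> L2"
  by (rule L2_bounded_mult[of _ "\<lambda>_. c" "norm c"]) auto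

lemma L2_scaleR: "f \<in> L2 \<Longrightarrow> (\<lambda>x. r *\<^sub>R f x) \<in> L2" for f :: "real \<Rightarrow> complex"
  using L2_cmult[of f "of_real r"] by (simp add: scaleR_conv_of_real)

lemma L2_minus: "f \<in> L2 \<Longrightarrow> (\<lambda>x. - f x) \<in> L2"
  using L2_cmult[of f "-1"] by simp

lemma L2_diff: "f \<in> L2 \<Longrightarrow> g \<in> L2 \<Longrightarrow> (\<lambda>x. f x - g x) \<in> L2"
  using L2_add[OF _ L2_minus, of f g] by simp

lemma L2_zero: "(\<lambda>x. 0) \<in> L2"
  by (simp add: L2_def)

lemma L2_sum: "(\<And>i. i \<in> I \<Longrightarrow> f i \<in> L2) \<Longrightarrow> (\<lambda>x. \<Sum>i\<in>I. f i x) \<in> L2"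
  by (induction I rule: infinite_finite_induct) (auto intro: L2_zero L2_add)

lemma L2_reflect: 
  assumes "f \<in> L2"
  shows "(\<lambda>x. f (- x)) \<in> L2"
proof -
  have "integrable lborel (\<lambda>x. (norm (f (0 + (-1) *\<^sub>R x)))\<^sup>2)"
    using L2_integrable_sq[OF assms] lborel_integrable_real_affine_iff[of "-1" "\<lambda>x. (norm (f x))\<^sup>2" 0]
    by simp
  moreover have "(\<lambda>x. f (- x)) \<in> borel_measurable lborel"
    using measurable_compose[OF _ L2_measurable[OF assms], of uminus borel] by simp
  ultimately show ?thesis by (simp add: L2_def)
qed

lemma L2_AE_cong:
  assumes "f \<in> L2" "ae_eq f g" "g \<in> borel_measurable lborel"
  shows "g \<in> L2"
proof -
  have "AE x in lborel. (norm (f x))\<^sup>2 = (norm (g x))\<^sup>2"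
    using assms(2) by (auto simp: ae_eq_def)
  then show ?thesis
    using assms L2_measurable[OF assms(1)] unfolding L2_def
    by (auto intro: integrable_cong_AE_imp)
qed

lemma L2_mult_integrable:
  assumes "f \<in> L2" "g \<in> L2"
  shows "integrable lborel (\<lambda>x. f x * g x)"
proof (rule Bochner_Integration.integrable_bound)
  show "integrable lborel (\<lambda>x. (norm (f x))\<^sup>2 + (norm (g x))\<^sup>2)"
    using assms by (auto intro: L2_integrable_sq)
  show "(\<lambda>x. f x * g x) \<in> borel_measurable lborel" using assms by measurable
  have "norm (f x) * norm (g x) \<le> (norm (f x))\<^sup>2 + (norm (g x))\<^sup>2" for x
    using zero_le_power2[of "norm (f x) - norm (g x)"] mult_nonneg_nonneg[OF norm_ge_zero[of "f x"] norm_ge_zero[of "g x"]]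
    unfolding power2_diff by linarith
  then show "AE x in lborel. norm (f x * g x) \<le> norm ((norm (f x))\<^sup>2 + (norm (g x))\<^sup>2)"
    by (simp add: norm_mult)
qed

lemma L2_inner_integrable:
  assumes "f \<in> L2" "g \<in> L2"
  shows "integrable lborel (\<lambda>x. inner (f x) (g x))"
proof -
  have "(\<lambda>x. cnj (g x)) \<in> L2"
    using assms(2) L2_measurable[OF assms(2)] by (auto simp: L2_def intro: borel_measurable_continuous_on[OF continuous_on_cnj[OF continuous_on_id]])
  from integrable_Re[OF L2_mult_integrable[OF assms(1) this]] show ?thesis
    by (simp add: inner_complex_def)
qed

lemma ae_eq_L2_iff:
  assumes "f \<in> L2" "g \<in> L2"
  shows "ae_eq f g \<longleftrightarrow> (LINT x|lborel. (norm (f x - g x))\<^sup>2) = 0"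
  using integral_nonneg_eq_0_iff_AE[OF L2_integrable_sq[OF L2_diff[OF assms]]]
  by (simp add: ae_eq_def)

lemma ae_eq_refl: "ae_eq f f"
  by (simp add: ae_eq_def)

lemma ae_eq_sym: "ae_eq f g \<Longrightarrow> ae_eq g f"
  unfolding ae_eq_def by (rule AE_mp) auto

lemma ae_eq_trans: "ae_eq f g \<Longrightarrow> ae_eq g h \<Longrightarrow> ae_eq f h"
  unfolding ae_eq_def by (elim AE_mp) auto

text \<open>Convergence almost everywhere of a fast subsequence comes from
  \<open>2 d \<le> 2 ^ k d\<^sup>2 + 2 ^ -k\<close>, which avoids Minkowski's inequality.\<close>

lemma L2_complete:
  assumes F: "\<And>k. F k \<in> L2"
    and cauchy: "\<And>e. e > 0 \<Longrightarrow> \<exists>N. \<forall>k\<ge>N. \<forall>l\<ge>N. (LINT x|lborel. (norm (F k x - F l x))\<^sup>2) < e"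
  obtains f where "f \<in> L2" "(\<lambda>k. LINT x|lborel. (norm (F k x - f x))\<^sup>2) \<longlonglongrightarrow> 0"
proof -
  have [measurable]: "F k \<in> borel_measurable lborel" for k using F by measurable
  have nn: "(\<integral>\<^sup>+x. ennreal ((norm (F k x - F l x))\<^sup>2) \<partial>lborel) = ennreal (LINT x|lborel. (norm (F k x - F l x))\<^sup>2)" for k l
    by (intro nn_integral_eq_integral L2_integrable_sq L2_diff F) auto
  obtain N where N: "\<And>j k l. k \<ge> N j \<Longrightarrow> l \<ge> N j \<Longrightarrow> (LINT x|lborel. (norm (F k x - F l x))\<^sup>2) < (1/4)^j"
    using cauchy[of "(1/4)^_"] by (simp del: power_divide) metis
  \<comment> \<open>The sum makes \<open>r\<close> nondecreasing and at least \<open>N k\<close>;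
    the summand \<open>k\<close> makes it tend to infinity.\<close>
  define r where "r k = (\<Sum>i\<le>k. N i) + k" for k
  have rN: "N k \<le> r k" for k
    unfolding r_def by (meson atMost_iff finite_atMost le_refl member_le_sum trans_le_add1 zero_le)
  have rk: "k \<le> r k" for k by (simp add: r_def)
  have rS: "r k \<le> r (Suc k)" for k by (simp add: r_def)
  define d where "d k x = norm (F (r (Suc k)) x - F (r k) x)" for k x
  have [measurable]: "d k \<in> borel_measurable lborel" for k unfolding d_def by measurable
  have "(\<integral>\<^sup>+x. (\<Sum>k. ennreal (2^k * (d k x)\<^sup>2)) \<partial>lborel) = (\<Sum>k. \<integral>\<^sup>+x. ennreal (2^k * (d k x)\<^sup>2) \<partial>lborel)"
    by (intro nn_integral_suminf) measurable
  also have "\<dots> \<le> (\<Sum>k. ennreal ((1/2)^k))"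
  proof (intro suminf_le allI)
    fix k
    have "(\<integral>\<^sup>+x. ennreal (2^k * (d k x)\<^sup>2) \<partial>lborel) = ennreal (2^k) * ennreal (LINT x|lborel. (norm (F (r (Suc k)) x - F (r k) x))\<^sup>2)"
      unfolding nn[symmetric] d_def by (subst nn_integral_cmult[symmetric]) (auto simp: ennreal_mult)
    also have "\<dots> \<le> ennreal (2^k) * ennreal ((1/4)^k)"
      using N[of k "r (Suc k)" "r k"] rN[of k] rS[of k] by (intro mult_left_mono ennreal_leI) auto
    also have "\<dots> = ennreal ((1/2)^k)"
      by (simp add: ennreal_mult[symmetric] power_mult_distrib[symmetric])
    finally show "(\<integral>\<^sup>+x. ennreal (2^k * (d k x)\<^sup>2) \<partial>lborel) \<le> ennreal ((1/2)^k)" .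
  qed auto
  also have "\<dots> = ennreal (\<Sum>k. (1/2)^k)"
    by (intro suminf_ennreal2 summable_geometric) auto
  also have "\<dots> < \<infinity>" by simp
  finally have "AE x in lborel. (\<Sum>k. ennreal (2^k * (d k x)\<^sup>2)) \<noteq> \<infinity>"
    by (intro nn_integral_noteq_infinite) auto
  then have conv: "AE x in lborel. convergent (\<lambda>k. F (r k) x)"
  proof (rule AE_mp, intro AE_I2 impI)
    fix x assume "(\<Sum>k. ennreal (2^k * (d k x)\<^sup>2)) \<noteq> \<infinity>"
    then have s: "summable (\<lambda>k. 2^k * (d k x)\<^sup>2)"
      by (intro summable_suminf_not_top) auto
    have "summable (\<lambda>k. d k x)"
    proof (rule summable_comparison_test')
      show "summable (\<lambda>k. (2^k * (d k x)\<^sup>2 + (1/2)^k) / 2)"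
        by (intro summable_divide summable_add s summable_geometric) simp
      show "norm (d k x) \<le> (2^k * (d k x)\<^sup>2 + (1/2)^k) / 2" if "k \<ge> 0" for k
      proof -
        have "0 \<le> (2^k * d k x - 1)\<^sup>2 / 2^k" by simp
        also have "\<dots> = 2^k * (d k x)\<^sup>2 + (1/2)^k - 2 * d k x"
          by (simp add: field_simps power2_eq_square)
        finally show ?thesis by (simp add: d_def)
      qed
    qed
    then have "summable (\<lambda>k. F (r (Suc k)) x - F (r k) x)"
      unfolding d_def by (rule summable_norm_cancel)
    then have "convergent (\<lambda>n. \<Sum>k<n. F (r (Suc k)) x - F (r k) x)"
      by (simp add: summable_iff_convergent)
    then have "convergent (\<lambda>n. F (r n) x - F (r 0) x)"
      unfolding sum_lessThan_telescope[of "\<lambda>k. F (r k) x"] .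
    then have "convergent (\<lambda>n. (F (r n) x - F (r 0) x) + F (r 0) x)"
      by (intro convergent_add convergent_const)
    then show "convergent (\<lambda>k. F (r k) x)" by simp
  qed
  define f where "f x = lim (\<lambda>k. F (r k) x)" for x
  have [measurable]: "f \<in> borel_measurable lborel"
    unfolding f_def by measurable
  have lim: "AE x in lborel. (\<lambda>k. F (r k) x) \<longlonglongrightarrow> f x"
    using conv by (simp add: f_def convergent_LIMSEQ_iff)
  \<comment> \<open>Fatou's lemma along the subsequence transfers the Cauchy bound to the limit, for
    every index \<open>m\<close> and not only for those of the form \<open>r k\<close>.\<close>
  have fat: "(\<integral>\<^sup>+x. ennreal ((norm (F m x - f x))\<^sup>2) \<partial>lborel) \<le> ennreal e"
    if M: "\<And>k l. k \<ge> M \<Longrightarrow> l \<ge> M \<Longrightarrow> (LINT x|lborel. (norm (F k x - F l x))\<^sup>2) < e" and m: "m \<ge> M" for M m e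
  proof -
    have "(\<integral>\<^sup>+x. ennreal ((norm (F m x - f x))\<^sup>2) \<partial>lborel) = (\<integral>\<^sup>+x. liminf (\<lambda>k. ennreal ((norm (F m x - F (r k) x))\<^sup>2)) \<partial>lborel)"
    proof (rule nn_integral_cong_AE)
      show "AE x in lborel. ennreal ((norm (F m x - f x))\<^sup>2) = liminf (\<lambda>k. ennreal ((norm (F m x - F (r k) x))\<^sup>2))"
        using lim
      proof (rule AE_mp, intro AE_I2 impI)
        fix x assume "(\<lambda>k. F (r k) x) \<longlonglongrightarrow> f x"
        then have "(\<lambda>k. ennreal ((norm (F m x - F (r k) x))\<^sup>2)) \<longlonglongrightarrow> ennreal ((norm (F m x - f x))\<^sup>2)"
          by (intro tendsto_ennrealI tendsto_intros)
        from lim_imp_Liminf[OF _ this]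
        show "ennreal ((norm (F m x - f x))\<^sup>2) = liminf (\<lambda>k. ennreal ((norm (F m x - F (r k) x))\<^sup>2))" by simp
      qed
    qed
    also have "\<dots> \<le> liminf (\<lambda>k. \<integral>\<^sup>+x. ennreal ((norm (F m x - F (r k) x))\<^sup>2) \<partial>lborel)"
      by (intro nn_integral_liminf) measurable
    also have "\<dots> \<le> liminf (\<lambda>k::nat. ennreal e)"
    proof (intro Liminf_mono)
      show "\<forall>\<^sub>F k in sequentially. (\<integral>\<^sup>+x. ennreal ((norm (F m x - F (r k) x))\<^sup>2) \<partial>lborel) \<le> ennreal e"
        using eventually_ge_at_top[of M]
      proof eventually_elim
        case (elim k)
        then show ?case unfolding nn using M[of m "r k"] m rk[of k] by (intro ennreal_leI) simp
      qed
    qed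
    finally show ?thesis by (simp add: Liminf_const)
  qed
  have intd: "integrable lborel (\<lambda>x. (norm (F m x - f x))\<^sup>2)"
    if M: "\<And>k l. k \<ge> M \<Longrightarrow> l \<ge> M \<Longrightarrow> (LINT x|lborel. (norm (F k x - F l x))\<^sup>2) < e" and m: "m \<ge> M" for M m e
  proof -
    have "(\<integral>\<^sup>+x. ennreal ((norm (F m x - f x))\<^sup>2) \<partial>lborel) < \<infinity>"
      using fat[OF M m] by (rule order.strict_trans1) auto
    then show ?thesis by (intro integrableI_nonneg) auto
  qed
  show ?thesis
  proof (rule that)
    obtain M where "\<And>k l. k \<ge> M \<Longrightarrow> l \<ge> M \<Longrightarrow> (LINT x|lborel. (norm (F k x - F l x))\<^sup>2) < 1"
      using cauchy[of 1] by auto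
    then have "(\<lambda>x. F M x - f x) \<in> L2"
      using intd[of M 1 M] by (simp add: L2_def)
    from L2_diff[OF F this, of M] show "f \<in> L2" by simp
    show "(\<lambda>k. LINT x|lborel. (norm (F k x - f x))\<^sup>2) \<longlonglongrightarrow> 0"
    proof (rule tendsto_norm_zero_cancel, rule order_tendstoI)
      fix e :: real assume e: "0 < e"
      obtain M where M: "\<And>k l. k \<ge> M \<Longrightarrow> l \<ge> M \<Longrightarrow> (LINT x|lborel. (norm (F k x - F l x))\<^sup>2) < e/2"
        using cauchy[of "e/2"] e by auto
      show "\<forall>\<^sub>F k in sequentially. norm (LINT x|lborel. (norm (F k x - f x))\<^sup>2) < e"
        using eventually_ge_at_top[of M]
      proof eventually_elim
        case (elim k)
        have "ennreal (LINT x|lborel. (norm (F k x - f x))\<^sup>2) \<le> ennreal (e/2)"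
          using fat[OF M elim] nn_integral_eq_integral[OF intd[OF M elim]] by simp
        then have "(LINT x|lborel. (norm (F k x - f x))\<^sup>2) \<le> e/2" using e by simp
        then show ?case using e by simp
      qed
    qed (auto intro!: always_eventually less_le_trans[of _ 0])
  qed
qed

\<comment> \<open>\<open>L2\<close> is a set and not a type, so a partial quotient both restricts to
  it and identifies functions that agree almost everywhere. A type is needed for the classes
  \<open>real_inner\<close> and \<open>complete_space\<close>.\<close>
quotient_type l2 = "real \<Rightarrow> complex" / partial: "\<lambda>f g. f \<in> L2 \<and> g \<in> L2 \<and> ae_eq f g"
proof (rule part_equivpI)
  show "\<exists>f. f \<in> L2 \<and> f \<in> L2 \<and> ae_eq f f" using L2_zero ae_eq_refl by blast
  show "symp (\<lambda>f g. f \<in> L2 \<and> g \<in> L2 \<and> ae_eq f g)"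
    by (rule sympI) (auto intro: ae_eq_sym)
  show "transp (\<lambda>f g. f \<in> L2 \<and> g \<in> L2 \<and> ae_eq f g)"
    by (rule transpI) (auto intro: ae_eq_trans)
qed

definition cls :: "(real \<Rightarrow> complex) \<Rightarrow> l2" where "cls = abs_l2"

lemma cls_eq_iff: "f \<in> L2 \<Longrightarrow> g \<in> L2 \<Longrightarrow> cls f = cls g \<longleftrightarrow> ae_eq f g"
  using Quotient3_rel[OF Quotient3_l2, of f g] by (auto simp: cls_def ae_eq_refl)

lemma cls_eqI: "f \<in> L2 \<Longrightarrow> g \<in> L2 \<Longrightarrow> ae_eq f g \<Longrightarrow> cls f = cls g"
  by (simp add: cls_eq_iff)

lemma rep_l2_in_L2 [simp]: "rep_l2 x \<in> L2"
  using Quotient3_rep_reflp[OF Quotient3_l2, of x] by simp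

lemma cls_rep [simp]: "cls (rep_l2 x) = x"
  unfolding cls_def by (rule Quotient3_abs_rep[OF Quotient3_l2])

lemma cls_cases [case_names cls, cases type: l2]:
  obtains f where "f \<in> L2" "x = cls f"
  using that[of "rep_l2 x"] by simp

lemma ae_eq_rep_cls: "f \<in> L2 \<Longrightarrow> ae_eq (rep_l2 (cls f)) f"
  by (subst cls_eq_iff[symmetric]) auto

lemma AE_binop:
  assumes "ae_eq f f'" "ae_eq g g'"
  shows "ae_eq (\<lambda>x. h x (f x) (g x)) (\<lambda>x. h x (f' x) (g' x))"
  using assms unfolding ae_eq_def by eventually_elim simp

lemma AE_unop:
  assumes "ae_eq f f'"
  shows "ae_eq (\<lambda>x. h x (f x)) (\<lambda>x. h x (f' x))"
  using assms unfolding ae_eq_def by eventually_elim simp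

text \<open>Equality almost everywhere is read as vanishing of the integral of
  \<open>(norm (f x - g x))\<^sup>2\<close>, to which the change of variables applies.\<close>

lemma ae_eq_reflect:
  assumes "f \<in> L2" "g \<in> L2" "ae_eq f g"
  shows "ae_eq (\<lambda>x. f (- x)) (\<lambda>x. g (- x))"
proof -
  have "(\<integral>x. (norm (f x - g x))\<^sup>2 \<partial>lborel) = (\<integral>x. (norm (f (-x) - g (-x)))\<^sup>2 \<partial>lborel)"
    using lborel_integral_real_affine[of "-1" "\<lambda>x. (norm (f x - g x))\<^sup>2" 0] by simp
  then show ?thesis
    using assms by (simp add: ae_eq_L2_iff L2_reflect)
qed

text \<open>Acts on a chosen representative. Independence of the choice is established separately
  for each use, in \<open>cmul_cls\<close>, \<open>reflect_cls\<close> and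
  \<open>sgnmul_cls\<close>.\<close>

definition map_l2 :: "((real \<Rightarrow> complex) \<Rightarrow> real \<Rightarrow> complex) \<Rightarrow> l2 \<Rightarrow> l2" where
  "map_l2 F x = cls (F (rep_l2 x))"

definition cmul :: "complex \<Rightarrow> l2 \<Rightarrow> l2" where
  "cmul c = map_l2 (\<lambda>f x. c * f x)"

lemma cmul_cls: "f \<in> L2 \<Longrightarrow> cmul c (cls f) = cls (\<lambda>x. c * f x)"
  unfolding cmul_def map_l2_def by (intro cls_eqI L2_cmult rep_l2_in_L2 AE_unop[where h = "\<lambda>_. (*) c"] ae_eq_rep_cls)

definition reflect :: "l2 \<Rightarrow> l2" where
  "reflect = map_l2 (\<lambda>f x. f (- x))"

lemma reflect_cls: "f \<in> L2 \<Longrightarrow> reflect (cls f) = cls (\<lambda>x. f (- x))"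
  unfolding reflect_def map_l2_def
  by (intro cls_eqI L2_reflect rep_l2_in_L2 ae_eq_reflect ae_eq_rep_cls)

definition sgnmul :: "l2 \<Rightarrow> l2" where
  "sgnmul = map_l2 (\<lambda>f x. complex_of_real (sgn x) * f x)"

lemma L2_sgn: "f \<in> L2 \<Longrightarrow> (\<lambda>x. complex_of_real (sgn x) * f x) \<in> L2"
  by (rule L2_bounded_mult[of _ _ 1]) (auto simp: sgn_if)

lemma sgnmul_cls: "f \<in> L2 \<Longrightarrow> sgnmul (cls f) = cls (\<lambda>x. complex_of_real (sgn x) * f x)"
  unfolding sgnmul_def map_l2_def
  by (intro cls_eqI L2_sgn rep_l2_in_L2 AE_unop[where h = "\<lambda>x. (*) (complex_of_real (sgn x))"] ae_eq_rep_cls)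

instantiation l2 :: real_inner
begin

definition plus_l2 :: "l2 \<Rightarrow> l2 \<Rightarrow> l2" where
  "x + y = cls (\<lambda>t. rep_l2 x t + rep_l2 y t)"
definition minus_l2 :: "l2 \<Rightarrow> l2 \<Rightarrow> l2" where
  "x - y = cls (\<lambda>t. rep_l2 x t - rep_l2 y t)"
definition uminus_l2 :: "l2 \<Rightarrow> l2" where
  "- x = cls (\<lambda>t. - rep_l2 x t)"
definition zero_l2 :: l2 where
  "0 = cls (\<lambda>t. 0)"
definition scaleR_l2 :: "real \<Rightarrow> l2 \<Rightarrow> l2" where
  "r *\<^sub>R x = cls (\<lambda>t. r *\<^sub>R rep_l2 x t)"
text \<open>The real part of the Hermitian product, because \<open>inner\<close> on
  \<open>complex\<close> is real-valued.\<close>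

definition inner_l2 :: "l2 \<Rightarrow> l2 \<Rightarrow> real" where
  "inner x y = (LINT t|lborel. inner (rep_l2 x t) (rep_l2 y t))"
definition norm_l2_def: "norm (x :: l2) = sqrt (inner x x)"
definition sgn_l2_def: "sgn (x :: l2) = inverse (norm x) *\<^sub>R x"
definition dist_l2_def: "dist (x :: l2) y = norm (x - y)"
definition uniformity_l2_def: "(uniformity :: (l2 \<times> l2) filter) = (INF e\<in>{0 <..}. principal {(x, y). dist x y < e})"
definition open_l2_def: "open (U :: l2 set) = (\<forall>x\<in>U. \<forall>\<^sub>F (x', y) in uniformity. x' = x \<longrightarrow> y \<in> U)"

lemma cls_add: "f \<in> L2 \<Longrightarrow> g \<in> L2 \<Longrightarrow> cls f + cls g = cls (\<lambda>t. f t + g t)"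
  unfolding plus_l2_def by (intro cls_eqI L2_add rep_l2_in_L2 AE_binop[where h = "\<lambda>_. (+)"] ae_eq_rep_cls)

lemma cls_diff: "f \<in> L2 \<Longrightarrow> g \<in> L2 \<Longrightarrow> cls f - cls g = cls (\<lambda>t. f t - g t)"
  unfolding minus_l2_def by (intro cls_eqI L2_diff rep_l2_in_L2 AE_binop[where h = "\<lambda>_. (-)"] ae_eq_rep_cls)

lemma cls_minus: "f \<in> L2 \<Longrightarrow> - cls f = cls (\<lambda>t. - f t)"
  unfolding uminus_l2_def by (intro cls_eqI L2_minus rep_l2_in_L2 AE_unop[where h = "\<lambda>_. uminus"] ae_eq_rep_cls)

lemma cls_scaleR: "f \<in> L2 \<Longrightarrow> r *\<^sub>R cls f = cls (\<lambda>t. r *\<^sub>R f t)"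
  unfolding scaleR_l2_def by (intro cls_eqI L2_scaleR rep_l2_in_L2 AE_unop[where h = "\<lambda>_. (*\<^sub>R) r"] ae_eq_rep_cls)

lemma cls_inner:
  assumes "f \<in> L2" "g \<in> L2"
  shows "inner (cls f) (cls g) = (LINT t|lborel. inner (f t) (g t))"
  unfolding inner_l2_def
proof (rule integral_cong_AE)
  show "AE x in lborel. inner (rep_l2 (cls f) x) (rep_l2 (cls g) x) = inner (f x) (g x)"
    using ae_eq_rep_cls[OF assms(1)] ae_eq_rep_cls[OF assms(2)] unfolding ae_eq_def
    by eventually_elim simp
qed (intro borel_measurable_integrable L2_inner_integrable rep_l2_in_L2 assms)+

instance
proof
  fix x y z :: l2 and a b r :: real
  show "x + y + z = x + (y + z)"
    by (cases x; cases y; cases z) (simp add: cls_add L2_add add.assoc)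
  show "x + y = y + x"
    by (cases x; cases y) (simp add: cls_add add.commute)
  show "0 + x = x"
    by (cases x) (simp add: zero_l2_def cls_add L2_zero)
  show "- x + x = 0"
    by (cases x) (simp add: zero_l2_def cls_add cls_minus L2_minus)
  show "x - y = x + - y"
    by (cases x; cases y) (simp add: cls_add cls_diff cls_minus L2_minus)
  show "a *\<^sub>R (x + y) = a *\<^sub>R x + a *\<^sub>R y"
    by (cases x; cases y) (simp add: cls_add cls_scaleR L2_scaleR L2_add scaleR_add_right)
  show "(a + b) *\<^sub>R x = a *\<^sub>R x + b *\<^sub>R x"
    by (cases x) (simp add: cls_add cls_scaleR L2_scaleR L2_add scaleR_add_left)
  show "a *\<^sub>R b *\<^sub>R x = (a * b) *\<^sub>R x"
    by (cases x) (simp add: cls_scaleR L2_scaleR)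
  show "1 *\<^sub>R x = x"
    by (cases x) (simp add: cls_scaleR)
  show "dist x y = norm (x - y)" by (simp add: dist_l2_def)
  show "sgn x = inverse (norm x) *\<^sub>R x" by (simp add: sgn_l2_def)
  show "(uniformity :: (l2 \<times> l2) filter) = (INF e\<in>{0 <..}. principal {(x, y). dist x y < e})"
    by (rule uniformity_l2_def)
  show "open U = (\<forall>x\<in>U. \<forall>\<^sub>F (x', y) in uniformity. x' = x \<longrightarrow> y \<in> U)" for U :: "l2 set"
    by (rule open_l2_def)
  show "inner x y = inner y x"
    by (simp add: inner_l2_def inner_commute)
  show "inner (x + y) z = inner x z + inner y z"
    by (cases x; cases y; cases z)
      (simp add: cls_add cls_inner L2_add inner_add_left L2_inner_integrable)
  show "inner (r *\<^sub>R x) y = r * inner x y"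
    by (cases x; cases y) (simp add: cls_scaleR cls_inner L2_scaleR)
  show "0 \<le> inner x x"
    by (simp add: inner_l2_def)
  show "(inner x x = 0) = (x = 0)"
    by (cases x) (simp add: zero_l2_def cls_eq_iff cls_inner L2_zero ae_eq_L2_iff power2_norm_eq_inner)
  show "norm x = sqrt (inner x x)" by (simp add: norm_l2_def)
qed

end

lemma cls_norm: "f \<in> L2 \<Longrightarrow> norm (cls f) = L2norm f"
  by (simp add: norm_l2_def cls_inner L2norm_def power2_norm_eq_inner)

lemma cls_zero: "cls (\<lambda>x. 0) = 0"
  by (simp add: zero_l2_def)

lemma cls_sum: "(\<And>i. i \<in> I \<Longrightarrow> f i \<in> L2) \<Longrightarrow> cls (\<lambda>x. \<Sum>i\<in>I. f i x) = (\<Sum>i\<in>I. cls (f i))"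
  by (induction I rule: infinite_finite_induct) (auto simp: cls_zero cls_add[symmetric] L2_sum)

instance l2 :: complete_space
proof
  fix X :: "nat \<Rightarrow> l2" assume X: "Cauchy X"
  define F where "F k = rep_l2 (X k)" for k
  have F: "F k \<in> L2" "X k = cls (F k)" for k by (simp_all add: F_def)
  have sq: "(norm (X k - cls f))\<^sup>2 = (LINT x|lborel. (norm (F k x - f x))\<^sup>2)" if "f \<in> L2" for k f
    using that by (simp add: F cls_diff cls_norm L2_diff L2norm_def)
  obtain f where f: "f \<in> L2" "(\<lambda>k. LINT x|lborel. (norm (F k x - f x))\<^sup>2) \<longlonglongrightarrow> 0"
  proof (rule L2_complete[of F])
    fix e :: real assume "e > 0"
    then obtain N where N: "\<And>k l. k \<ge> N \<Longrightarrow> l \<ge> N \<Longrightarrow> norm (X k - X l) < sqrt e"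
      using X by (metis CauchyD real_sqrt_gt_zero)
    have "(LINT x|lborel. (norm (F k x - F l x))\<^sup>2) < e" if "k \<ge> N" "l \<ge> N" for k l
    proof -
      have "(norm (X k - X l))\<^sup>2 < (sqrt e)\<^sup>2"
        using N[OF that] by (intro power_strict_mono) auto
      then show ?thesis using sq[OF F(1), of k l] F(2)[of l] \<open>e > 0\<close> by simp
    qed
    then show "\<exists>N. \<forall>k\<ge>N. \<forall>l\<ge>N. (LINT x|lborel. (norm (F k x - F l x))\<^sup>2) < e" by blast
  qed (use F in auto)
  have "(\<lambda>k. sqrt ((norm (X k - cls f))\<^sup>2)) \<longlonglongrightarrow> sqrt 0"
    unfolding sq[OF f(1)] by (intro tendsto_real_sqrt f(2))
  then have "(\<lambda>k. norm (X k - cls f)) \<longlonglongrightarrow> 0" by simp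
  then have "X \<longlonglongrightarrow> cls f"
    by (simp add: tendsto_norm_zero_iff LIM_zero_iff)
  then show "convergent X" by (auto simp: convergent_def)
qed

section \<open>Complex scalars, reflection and multiplication by the sign as operators on
  \<open>l2\<close>\<close>

lemma cmul_add: "cmul c (x + y) = cmul c x + cmul c y"
  by (cases x; cases y) (simp add: cmul_cls cls_add L2_add L2_cmult distrib_left)

lemma cmul_cmul: "cmul c (cmul d x) = cmul (c * d) x"
  by (cases x) (simp add: cmul_cls L2_cmult mult.assoc)

lemma cmul_of_real: "cmul (complex_of_real r) x = r *\<^sub>R x"
  by (cases x) (simp add: cmul_cls cls_scaleR scaleR_conv_of_real)

lemma cmul_1 [simp]: "cmul 1 x = x"
  using cmul_of_real[of 1 x] by simp

lemma cmul_minus1: "cmul (- 1) x = - x"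
  using cmul_of_real[of "-1" x] by simp

lemma inner_cmul_left: "inner (cmul c x) y = inner x (cmul (cnj c) y)"
  by (cases x; cases y)
    (simp add: cmul_cls cls_inner L2_cmult; simp add: inner_complex_def algebra_simps)

lemma norm_cmul: "norm (cmul c x) = norm c * norm x"
  unfolding norm_eq_sqrt_inner[of "cmul c x"]
  by (simp add: inner_cmul_left cmul_cmul norm_eq_sqrt_inner[of x] complex_norm_square[symmetric] mult.commute[of "cnj c"]
      cmul_of_real real_sqrt_mult flip: of_real_power)

lemma bounded_linear_cmul [bounded_linear]: "bounded_linear (cmul c)"
  by (rule bounded_linear_intro[of _ "norm c"])
    (auto simp: cmul_add norm_cmul cmul_of_real[symmetric] cmul_cmul mult.commute)

lemma reflect_add: "reflect (x + y) = reflect x + reflect y"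
  by (cases x; cases y) (simp add: reflect_cls cls_add L2_add L2_reflect)

lemma reflect_cmul: "reflect (cmul c x) = cmul c (reflect x)"
  by (cases x) (simp add: reflect_cls cmul_cls L2_cmult L2_reflect)

lemma reflect_reflect [simp]: "reflect (reflect x) = x"
  by (cases x) (simp add: reflect_cls L2_reflect)

lemma inner_reflect: "inner (reflect x) (reflect y) = inner x y"
proof (cases x; cases y)
  fix f g assume "f \<in> L2" "g \<in> L2" "x = cls f" "y = cls g"
  then show ?thesis
    using lborel_integral_real_affine[of "-1" "\<lambda>t. inner (f t) (g t)" 0]
    by (simp add: reflect_cls cls_inner L2_reflect)
qed

lemma bounded_linear_reflect [bounded_linear]: "bounded_linear reflect"
  by (rule bounded_linear_intro[of _ 1])
    (auto simp: reflect_add norm_eq_sqrt_inner inner_reflect reflect_cmul simp flip: cmul_of_real)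

lemma sgnmul_add: "sgnmul (x + y) = sgnmul x + sgnmul y"
  by (cases x; cases y) (simp add: sgnmul_cls cls_add L2_add L2_sgn distrib_left)

lemma sgnmul_cmul: "sgnmul (cmul c x) = cmul c (sgnmul x)"
  by (cases x) (simp add: sgnmul_cls cmul_cls L2_cmult L2_sgn mult.left_commute)

lemma sgnmul_reflect: "sgnmul (reflect x) = - reflect (sgnmul x)"
  by (cases x) (simp add: sgnmul_cls reflect_cls L2_sgn L2_reflect L2_minus cls_minus)

lemma sgnmul_sgnmul [simp]: "sgnmul (sgnmul x) = x"
proof (cases x)
  case (cls f)
  have "AE x in lborel. x \<noteq> (0::real)" by (rule AE_lborel_singleton)
  then have "ae_eq (\<lambda>x. complex_of_real (sgn x) * (complex_of_real (sgn x) * f x)) f"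
    unfolding ae_eq_def
    by eventually_elim (auto simp: sgn_if)
  then show ?thesis
    using cls by (simp add: sgnmul_cls L2_sgn cls_eq_iff)
qed

lemma inner_sgnmul_left: "inner (sgnmul x) y = inner x (sgnmul y)"
  by (cases x; cases y) (simp add: sgnmul_cls cls_inner L2_sgn; simp add: inner_complex_def algebra_simps)

lemma inner_sgnmul: "inner (sgnmul x) (sgnmul y) = inner x y"
  by (simp add: inner_sgnmul_left)

lemma bounded_linear_sgnmul [bounded_linear]: "bounded_linear sgnmul"
  by (rule bounded_linear_intro[of _ 1])
    (auto simp: sgnmul_add norm_eq_sqrt_inner inner_sgnmul sgnmul_cmul simp flip: cmul_of_real)

lemmas linear_cmul = bounded_linear.linear[OF bounded_linear_cmul]
  and linear_reflect = bounded_linear.linear[OF bounded_linear_reflect]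
  and linear_sgnmul = bounded_linear.linear[OF bounded_linear_sgnmul]

section \<open>Totality of symmetric intervals\<close>

text \<open>Half-lines are an intersection-stable generator of the Borel sets, so the Dynkin
  argument applies to the complex measure with density \<open>g\<close>; \<open>tot\<close> serves
  the passage to complements.\<close>

lemma AE_zero_if_halflines:
  fixes g :: "real \<Rightarrow> complex"
  assumes g: "integrable lborel g" and tot: "integral\<^sup>L lborel g = 0"
    and half: "\<And>a. (LINT x:{..a}|lborel. g x) = 0"
  shows "AE x in lborel. g x = 0"
proof (rule sigma_finite_measure.density_zero[OF sigma_finite_lborel g])
  have ss: "sigma_sets UNIV (range atMost) = sets (lborel :: real measure)"
    by (simp add: borel_eq_atMost)
  fix A :: "real set" assume "A \<in> sets lborel"
  then have A: "A \<in> sigma_sets UNIV (range atMost)"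
    by (simp add: ss)
  have "Int_stable (range (atMost :: real \<Rightarrow> _))"
    by (rule Int_stableI) auto
  moreover have "range (atMost :: real \<Rightarrow> _) \<subseteq> Pow UNIV" by simp
  ultimately have "(LINT x:A|lborel. g x) = 0" using A
  proof (induction rule: sigma_sets_induct_disjoint)
    case (basic A) then show ?case using half by auto
  next
    case empty show ?case by (simp add: set_lebesgue_integral_def)
  next
    case (compl A)
    have [measurable, simp]: "A \<in> sets borel" using compl(1) ss by auto
    have "(LINT x:UNIV - A|lborel. g x) = (LINT x|lborel. g x - indicator A x *\<^sub>R g x)"
      unfolding set_lebesgue_integral_def
      by (intro Bochner_Integration.integral_cong) (auto split: split_indicator)
    also have "\<dots> = integral\<^sup>L lborel g - (LINT x:A|lborel. g x)"
      unfolding set_lebesgue_integral_def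
      by (intro Bochner_Integration.integral_diff integrable_mult_indicator g) simp
    finally have "(LINT x:UNIV - A|lborel. g x) = integral\<^sup>L lborel g - (LINT x:A|lborel. g x)" .
    then show ?case using compl(2) tot by simp
  next
    case (union A)
    have [measurable]: "A i \<in> sets lborel" for i using union(2) unfolding ss by auto
    have "(\<Union>i. A i) \<in> sets lborel" by measurable
    have "(LINT x:(\<Union>i. A i)|lborel. g x) = (\<Sum>i. (LINT x:A i|lborel. g x))"
    proof (rule lebesgue_integral_countable_add)
      show "set_integrable lborel (\<Union>i. A i) g"
        unfolding set_integrable_def by (intro integrable_mult_indicator g) fact
    qed (use union(1,2) ss in \<open>auto simp: disjoint_family_on_def\<close>)
    then show ?case using union by simp
  qed
  then show "(LINT x:A|lborel. g x) = 0" .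
qed

text \<open>Half the sum and half the difference of \<open>g x\<close> and
  \<open>sgn x *\<^sub>R g x\<close> isolate the two half-axes. Symmetric intervals thus yield
  intervals ending at 0, and these yield half-lines.\<close>

lemma AE_zero_if_symmetric_intervals:
  fixes g :: "real \<Rightarrow> complex"
  assumes g: "integrable lborel g"
    and even: "\<And>a. a > 0 \<Longrightarrow> (LINT x:{-a..a}|lborel. g x) = 0"
    and odd: "\<And>a. a > 0 \<Longrightarrow> (LINT x:{-a..a}|lborel. sgn x *\<^sub>R g x) = 0"
  shows "AE x in lborel. g x = 0"
proof -
  have [measurable]: "g \<in> borel_measurable borel" using g by auto
  have sg: "integrable lborel (\<lambda>x. sgn x *\<^sub>R g x)"
    by (rule Bochner_Integration.integrable_bound[OF g]) (auto simp: sgn_if)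
  have si: "set_integrable lborel A g" if "A \<in> sets borel" for A
    unfolding set_integrable_def using that by (intro integrable_mult_indicator g) auto
  have ssi: "set_integrable lborel A (\<lambda>x. sgn x *\<^sub>R g x)" if "A \<in> sets borel" for A
    unfolding set_integrable_def using that by (intro integrable_mult_indicator sg) auto
  have lim: "integral\<^sup>L lborel h = 0"
    if h: "integrable lborel h" and z: "\<And>a. a > 0 \<Longrightarrow> (LINT x:{-a..a}|lborel. h x) = 0" for h :: "real \<Rightarrow> complex"
  proof -
    have [measurable]: "h \<in> borel_measurable borel" using h by auto
    have "(\<lambda>k::nat. LINT x:{-real k..real k}|lborel. h x) \<longlonglongrightarrow> integral\<^sup>L lborel h"
      unfolding set_lebesgue_integral_def
    proof (rule integral_dominated_convergence[where w = "\<lambda>x. norm (h x)"])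
      show "AE x in lborel. (\<lambda>k. indicat_real {- real k..real k} x *\<^sub>R h x) \<longlonglongrightarrow> h x"
      proof (intro AE_I2 tendsto_eventually)
        fix x :: real
        show "\<forall>\<^sub>F k in sequentially. indicat_real {- real k..real k} x *\<^sub>R h x = h x"
          using eventually_ge_at_top[of "nat \<lceil>\<bar>x\<bar>\<rceil>"]
        proof eventually_elim
          case (elim k)
          then have "\<bar>x\<bar> \<le> real k" by linarith
          then show ?case by (auto simp: indicator_def)
        qed
      qed
    qed (use h in \<open>auto simp: indicator_def\<close>)
    moreover have "(\<lambda>k::nat. LINT x:{-real k..real k}|lborel. h x) \<longlonglongrightarrow> 0"
      using z by (intro tendsto_eventually eventually_mono[OF eventually_gt_at_top[of 0]]) auto
    ultimately show ?thesis by (rule LIMSEQ_unique)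
  qed
  have tot: "integral\<^sup>L lborel g = 0" using lim[OF g even] .
  have stot: "(LINT x|lborel. sgn x *\<^sub>R g x) = 0" using lim[OF sg odd] .
  have nz: "AE x in lborel. x \<noteq> (0::real)" by (rule AE_lborel_singleton)
  have pm: "(LINT x:{0..a}|lborel. g x) = 0" "(LINT x:{-a..0}|lborel. g x) = 0" if a: "a > 0" for a
  proof -
    have "(LINT x:{0..a}|lborel. g x) = (LINT x:{-a..a}|lborel. (1/2) *\<^sub>R (g x + sgn x *\<^sub>R g x))"
      unfolding set_lebesgue_integral_def
      by (rule integral_cong_AE[OF _ _ eventually_mono[OF nz]]) (auto simp: sgn_if indicator_def)
    also have "\<dots> = (1/2) *\<^sub>R ((LINT x:{-a..a}|lborel. g x) + (LINT x:{-a..a}|lborel. sgn x *\<^sub>R g x))"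
      by (subst set_integral_add(2)[OF si ssi, symmetric]) (auto simp flip: set_integral_scaleR_right)
    finally show "(LINT x:{0..a}|lborel. g x) = 0" using even[OF a] odd[OF a] by simp
    have "(LINT x:{-a..0}|lborel. g x) = (LINT x:{-a..a}|lborel. (1/2) *\<^sub>R (g x - sgn x *\<^sub>R g x))"
      unfolding set_lebesgue_integral_def
      by (rule integral_cong_AE[OF _ _ eventually_mono[OF nz]]) (auto simp: sgn_if indicator_def)
    also have "\<dots> = (1/2) *\<^sub>R ((LINT x:{-a..a}|lborel. g x) - (LINT x:{-a..a}|lborel. sgn x *\<^sub>R g x))"
      by (subst set_integral_diff(2)[OF si ssi, symmetric]) (auto simp flip: set_integral_scaleR_right)
    finally show "(LINT x:{-a..0}|lborel. g x) = 0" using even[OF a] odd[OF a] by simp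
  qed
  have half0: "(LINT x:{..0}|lborel. g x) = 0"
  proof -
    have "(LINT x:{..0}|lborel. g x) = (LINT x|lborel. (1/2) *\<^sub>R (g x - sgn x *\<^sub>R g x))"
      unfolding set_lebesgue_integral_def
      by (rule integral_cong_AE[OF _ _ eventually_mono[OF nz]]) (auto simp: sgn_if indicator_def)
    also have "\<dots> = (1/2) *\<^sub>R (integral\<^sup>L lborel g - (LINT x|lborel. sgn x *\<^sub>R g x))"
      using g sg by simp
    finally show ?thesis using tot stot by simp
  qed
  have nz': "AE x in lborel. x \<noteq> (a::real)" for a by (rule AE_lborel_singleton)
  show ?thesis
  proof (rule AE_zero_if_halflines[OF g tot])
    fix a :: real
    show "(LINT x:{..a}|lborel. g x) = 0"
    proof (cases "a > 0")
      case True
      have "(LINT x:{..a}|lborel. g x) = (LINT x:{..0} \<union> {0..a}|lborel. g x)"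
        using True by (intro arg_cong[where f = "\<lambda>A. set_lebesgue_integral lborel A g"]) auto
      also have "\<dots> = (LINT x:{..0}|lborel. g x) + (LINT x:{0..a}|lborel. g x)"
        by (intro set_integral_Un_AE si eventually_mono[OF nz]) auto
      finally show ?thesis using pm[OF True] half0 by simp
    next
      case False
      have "(LINT x:{..0}|lborel. g x) = (LINT x:{..a} \<union> {a..0}|lborel. g x)"
        using False by (intro arg_cong[where f = "\<lambda>A. set_lebesgue_integral lborel A g"]) auto
      also have "\<dots> = (LINT x:{..a}|lborel. g x) + (LINT x:{a..0}|lborel. g x)"
        by (intro set_integral_Un_AE si eventually_mono[OF nz'[of a]]) auto
      finally show ?thesis using pm(2)[of "-a"] half0 False by (cases "a = 0") auto
    qed
  qed
qed

section \<open>Real square integrable functions and pairings with their complex multiples\<close>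

definition real_L2 :: "(real \<Rightarrow> real) \<Rightarrow> bool" where
  "real_L2 u \<longleftrightarrow> u \<in> borel_measurable borel \<and> integrable lborel (\<lambda>x. (u x)\<^sup>2)"

lemma real_L2_L2: "real_L2 u \<Longrightarrow> (\<lambda>x. complex_of_real (u x)) \<in> L2"
proof -
  assume u: "real_L2 u"
  then have [measurable]: "u \<in> borel_measurable borel" by (simp add: real_L2_def)
  have "(\<lambda>x. complex_of_real (u x)) \<in> borel_measurable borel" by measurable
  with u show ?thesis by (simp add: real_L2_def L2_def)
qed

lemma real_L2_indicator_interval: "real_L2 (indicator {a..b})"
proof -
  have "(\<lambda>x. (indicat_real {a..b} x)\<^sup>2) = indicat_real {a..b}"
    by (auto simp: indicator_def)
  then show ?thesis
    by (auto simp: real_L2_def emeasure_lborel_Icc_eq intro!: integrable_real_indicator)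
qed

text \<open>A member of \<open>L2\<close> need not be integrable, so it is first cut off to a
  bounded symmetric interval; intersecting that with \<open>{-a..a}\<close> gives a symmetric
  interval again.\<close>

lemma L2_AE_zero_if_symmetric_intervals:
  fixes f :: "real \<Rightarrow> complex"
  assumes f: "f \<in> L2"
    and even: "\<And>a. a > 0 \<Longrightarrow> (LINT x:{-a..a}|lborel. f x) = 0"
    and odd: "\<And>a. a > 0 \<Longrightarrow> (LINT x:{-a..a}|lborel. sgn x *\<^sub>R f x) = 0"
  shows "AE x in lborel. f x = 0"
proof -
  have [measurable]: "f \<in> borel_measurable borel" using f by measurable
  have "AE x in lborel. indicator {-real (Suc N)..real (Suc N)} x *\<^sub>R f x = 0" for N
  proof (rule AE_zero_if_symmetric_intervals)
    have "(\<lambda>x. complex_of_real (indicator {-real (Suc N)..real (Suc N)} x)) \<in> L2"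
      by (rule real_L2_L2[OF real_L2_indicator_interval])
    from L2_mult_integrable[OF this f]
    show "integrable lborel (\<lambda>x. indicator {-real (Suc N)..real (Suc N)} x *\<^sub>R f x)"
      by (simp add: scaleR_conv_of_real)
    fix a :: real assume a: "a > 0"
    define b where "b = min a (real (Suc N))"
    have b: "b > 0" using a by (simp add: b_def)
    have *: "indicator {-a..a} x * indicator {-real (Suc N)..real (Suc N)} x = (indicator {-b..b} x :: real)" for x
      by (auto simp: indicator_def b_def)
    show "(LINT x:{-a..a}|lborel. indicator {-real (Suc N)..real (Suc N)} x *\<^sub>R f x) = 0"
      using even[OF b] unfolding set_lebesgue_integral_def scaleR_scaleR * .
    show "(LINT x:{-a..a}|lborel. sgn x *\<^sub>R indicator {-real (Suc N)..real (Suc N)} x *\<^sub>R f x) = 0"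
      using odd[OF b] unfolding set_lebesgue_integral_def scaleR_scaleR *[symmetric] by (simp only: mult_ac)
  qed
  then have "AE x in lborel. \<forall>N. indicator {-real (Suc N)..real (Suc N)} x *\<^sub>R f x = 0"
    unfolding AE_all_countable by blast
  then show ?thesis
  proof (rule AE_mp, intro AE_I2 impI)
    fix x assume *: "\<forall>N. indicator {-real (Suc N)..real (Suc N)} x *\<^sub>R f x = 0"
    have "\<bar>x\<bar> \<le> real (Suc (nat \<lceil>\<bar>x\<bar>\<rceil>))" by linarith
    then have "x \<in> {-real (Suc (nat \<lceil>\<bar>x\<bar>\<rceil>))..real (Suc (nat \<lceil>\<bar>x\<bar>\<rceil>))}" by auto
    then show "f x = 0" using *[rule_format, of "nat \<lceil>\<bar>x\<bar>\<rceil>"] by simp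
  qed
qed

definition rcls :: "(real \<Rightarrow> real) \<Rightarrow> l2" where
  "rcls u = cls (\<lambda>x. complex_of_real (u x))"

lemma inner_rcls: "real_L2 u \<Longrightarrow> real_L2 v \<Longrightarrow> inner (rcls u) (rcls v) = (LINT x|lborel. u x * v x)"
  by (simp add: rcls_def cls_inner real_L2_L2 inner_complex_def)

text \<open>Complex coefficients enter a Gram matrix of real functions only through
  \<open>Re (c * cnj d)\<close>, so comparing two such matrices is a matter of real
  integrals.\<close>

lemma inner_cmul_rcls:
  assumes "real_L2 u" "real_L2 v"
  shows "inner (cmul c (rcls u)) (cmul d (rcls v)) = Re (c * cnj d) * (LINT x|lborel. u x * v x)"
proof -
  have "inner (cmul c (rcls u)) (cmul d (rcls v)) = (LINT x|lborel. inner (c * complex_of_real (u x)) (d * complex_of_real (v x)))"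
    using assms by (simp add: rcls_def cmul_cls cls_inner L2_cmult real_L2_L2)
  also have "\<dots> = (LINT x|lborel. Re (c * cnj d) * (u x * v x))"
    by (intro Bochner_Integration.integral_cong refl) (simp add: inner_complex_def algebra_simps)
  also have "\<dots> = Re (c * cnj d) * (LINT x|lborel. u x * v x)"
    by (rule integral_mult_right_zero)
  finally show ?thesis .
qed

lemma inner_cls_cmul_rcls:
  assumes f: "f \<in> L2" and u: "real_L2 u"
  shows "inner (cls f) (cmul c (rcls u)) = Re (cnj c * (LINT x|lborel. u x *\<^sub>R f x))"
proof -
  have i: "integrable lborel (\<lambda>x. u x *\<^sub>R f x)"
    using L2_mult_integrable[OF real_L2_L2[OF u] f] by (simp add: scaleR_conv_of_real)
  have "inner (cls f) (cmul c (rcls u)) = (LINT x|lborel. Re (cnj c * (u x *\<^sub>R f x)))"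
    using assms by (simp add: rcls_def cmul_cls cls_inner L2_cmult real_L2_L2; simp add: inner_complex_def algebra_simps)
  also have "\<dots> = Re (LINT x|lborel. cnj c * (u x *\<^sub>R f x))"
    using integrable_mult_right[OF i, of "cnj c"] by (intro integral_Re)
  finally show ?thesis by (simp only: integral_mult_right_zero)
qed

text \<open>The factors \<open>1\<close> and \<open>\<i>\<close> test the real and the imaginary
  part.\<close>

lemma integral_zero_if_orthogonal:
  assumes f: "f \<in> L2" and u: "real_L2 u" and orth: "\<And>c. inner (cls f) (cmul c (rcls u)) = 0"
  shows "(LINT x|lborel. u x *\<^sub>R f x) = 0"
  using orth[of 1] orth[of \<i>] unfolding inner_cls_cmul_rcls[OF f u]
  by (simp add: complex_eq_iff)

lemma real_L2_sgn: "real_L2 u \<Longrightarrow> real_L2 (\<lambda>x. sgn x * u x)"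
proof -
  assume u: "real_L2 u"
  then have [measurable]: "u \<in> borel_measurable borel" by (simp add: real_L2_def)
  have "integrable lborel (\<lambda>x. (sgn x * u x)\<^sup>2)"
    by (rule Bochner_Integration.integrable_bound[of _ "\<lambda>x. (u x)\<^sup>2"])
      (use u in \<open>auto simp: real_L2_def power_mult_distrib sgn_if\<close>)
  then show ?thesis by (simp add: real_L2_def)
qed

lemma sgnmul_rcls: "real_L2 u \<Longrightarrow> sgnmul (rcls u) = rcls (\<lambda>x. sgn x * u x)"
  by (simp add: rcls_def sgnmul_cls real_L2_L2)

definition symbox :: "real \<Rightarrow> l2" where
  "symbox a = rcls (indicator {-a..a})"

lemma total_symbox: "total_family ({cmul c (symbox a) |c a. a > 0} \<union> {cmul c (sgnmul (symbox a)) |c a. a > 0})"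
  unfolding total_family_def
proof (intro allI impI)
  fix x :: l2 assume *: "\<forall>s\<in>{cmul c (symbox a) |c a. a > 0} \<union> {cmul c (sgnmul (symbox a)) |c a. a > 0}. inner x s = 0"
  obtain f where f: "f \<in> L2" "x = cls f" by (cases x)
  note rL = real_L2_indicator_interval
  have "AE x in lborel. f x = 0"
  proof (rule L2_AE_zero_if_symmetric_intervals[OF f(1)])
    fix a :: real assume a: "a > 0"
    have "inner (cls f) (cmul c (rcls (indicator {-a..a}))) = 0" for c
      using * a f(2) unfolding symbox_def by blast
    from integral_zero_if_orthogonal[OF f(1) rL this]
    show "(LINT x:{-a..a}|lborel. f x) = 0" by (simp add: set_lebesgue_integral_def)
    have "inner (cls f) (cmul c (rcls (\<lambda>x. sgn x * indicator {-a..a} x))) = 0" for c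
      using * a f(2) unfolding symbox_def sgnmul_rcls[OF rL, symmetric] by blast
    from integral_zero_if_orthogonal[OF f(1) real_L2_sgn[OF rL] this]
    show "(LINT x:{-a..a}|lborel. sgn x *\<^sub>R f x) = 0" by (simp add: set_lebesgue_integral_def mult.commute)
  qed
  then show "x = 0"
    using f by (simp add: cls_zero[symmetric] cls_eq_iff L2_zero ae_eq_def)
qed

section \<open>Gaussian functions and the series\<close>

text \<open>For a nonnegative integrand a gauge integral is a Lebesgue integral of the same value,
  so values found by the fundamental theorem bring integrability with them.\<close>

lemma has_integral_nonneg_lborel:
  fixes f :: "real \<Rightarrow> real"
  assumes "(f has_integral I) S" "\<And>x. x \<in> S \<Longrightarrow> 0 \<le> f x"
    and [measurable]: "f \<in> borel_measurable borel" "S \<in> sets borel"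
  shows "set_integrable lborel S f" "(LINT x:S|lborel. f x) = I"
proof -
  have I: "I \<ge> 0" using has_integral_nonneg[OF assms(1)] assms(2) by auto
  have "(\<integral>\<^sup>+x. ennreal (indicator S x *\<^sub>R f x) \<partial>lborel) = ennreal I"
    using nn_integral_has_integral_lebesgue[OF assms(2,1)] by simp
  then have "has_bochner_integral lborel (\<lambda>x. indicator S x *\<^sub>R f x) I"
    using I assms(2) by (intro has_bochner_integral_nn_integral) (auto simp: indicator_def)
  then show "set_integrable lborel S f" "(LINT x:S|lborel. f x) = I"
    by (auto simp: set_integrable_def set_lebesgue_integral_def has_bochner_integral_iff)
qed

lemma even_integral_lborel:
  fixes f :: "real \<Rightarrow> real"
  assumes [measurable]: "f \<in> borel_measurable borel" and even: "\<And>x. f (- x) = f x"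
    and int: "set_integrable lborel {0<..} f"
  shows "integrable lborel f" "integral\<^sup>L lborel f = 2 * (LINT x:{0<..}|lborel. f x)"
proof -
  define g where "g x = indicator {0<..} x * f x" for x
  have g: "integrable lborel g"
    using int by (simp add: g_def[abs_def] set_integrable_def)
  have gr: "integrable lborel (\<lambda>x. g (- x))"
    using lborel_integrable_real_affine[OF g, of "-1" 0] by simp
  have [measurable]: "g \<in> borel_measurable borel" unfolding g_def by measurable
  have ae: "AE x in lborel. g x + g (- x) = f x"
    by (rule eventually_mono[OF AE_lborel_singleton[of 0]]) (auto simp: g_def indicator_def even)
  show "integrable lborel f"
    by (rule integrable_cong_AE_imp[OF Bochner_Integration.integrable_add[OF g gr]]) (use ae in auto)
  have "integral\<^sup>L lborel f = (LINT x|lborel. g x + g (- x))"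
    by (rule integral_cong_AE) (use ae in auto)
  also have "\<dots> = integral\<^sup>L lborel g + (LINT x|lborel. g (- x))"
    by (rule Bochner_Integration.integral_add[OF g gr])
  also have "(LINT x|lborel. g (- x)) = integral\<^sup>L lborel g"
    using lborel_integral_real_affine[of "-1" g 0] by simp
  finally show "integral\<^sup>L lborel f = 2 * (LINT x:{0<..}|lborel. f x)"
    by (simp add: set_lebesgue_integral_def g_def[abs_def])
qed

lemma Gamma_set_integral:
  fixes x :: real
  assumes "x > 0"
  shows "set_integrable lborel {0<..} (\<lambda>t. t powr (x - 1) * exp (- t))"
    "(LINT t:{0<..}|lborel. t powr (x - 1) * exp (- t)) = Gamma x"
proof -
  have h: "((\<lambda>t. t powr (x - 1) * exp (- t)) has_integral Gamma x) {0..}"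
    using Gamma_integral_real[OF assms] by (simp add: exp_minus field_simps)
  have h': "((\<lambda>t. t powr (x - 1) * exp (- t)) has_integral Gamma x) {0<..}"
    by (rule has_integral_spike_set_eq[THEN iffD1, OF _ _ h]) (auto intro: negligible_subset[of "{0}"])
  show "set_integrable lborel {0<..} (\<lambda>t. t powr (x - 1) * exp (- t))"
    "(LINT t:{0<..}|lborel. t powr (x - 1) * exp (- t)) = Gamma x"
    by (rule has_integral_nonneg_lborel[OF h']; simp)+
qed

definition gauss :: "nat \<Rightarrow> real \<Rightarrow> real \<Rightarrow> real" where
  "gauss n s x = exp (- (s * x ^ (2 * n)))"

lemma gauss_measurable [measurable]: "gauss n s \<in> borel_measurable borel"
  unfolding gauss_def by measurable

lemma gauss_minus [simp]: "gauss n s (- x) = gauss n s x"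
  by (simp add: gauss_def power_mult)

lemma gauss_mult: "gauss n s x * gauss n r x = gauss n (s + r) x"
  by (simp add: gauss_def exp_add[symmetric] algebra_simps)

lemma gauss_pos: "gauss n s x > 0"
  by (simp add: gauss_def)

lemma gauss_moment:
  assumes n: "n \<ge> 1" and s: "s > 0"
  shows "integrable lborel (\<lambda>x. x ^ (2 * n * l) * gauss n s x)"
    "(LINT x|lborel. x ^ (2 * n * l) * gauss n s x) =
      Gamma (real l + 1 / (2 * real n)) / (real n * s powr (real l + 1 / (2 * real n)))"
proof -
  define b where "b = 1 / (2 * real n)"
  have b: "b > 0" "b * (2 * real n) = 1" "2 * real n * b = 1" using n by (auto simp: b_def)
  define f where "f x = x ^ (2 * n * l) * gauss n s x" for x
  \<comment> \<open>Inverse of the substitution \<open>t = s * x ^ (2 * n)\<close> on the positive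
    axis; it turns the moment into the Gamma integral at \<open>real l + b\<close>.\<close>
  define g where "g t = (t / s) powr b" for t
  define g' where "g' t = b * s powr (- b) * t powr (b - 1)" for t
  have [measurable]: "f \<in> borel_measurable borel" unfolding f_def by measurable
  have gp: "g t ^ (2 * n) = t / s" if "t > 0" for t
    using that s b by (simp add: g_def powr_powr flip: powr_realpow)
  have fg: "f (g t) * g' t = b * s powr (- (real l + b)) * (t powr (real l + b - 1) * exp (- t))" if t: "t > 0" for t
  proof -
    have "f (g t) = (t / s) ^ l * exp (- t)"
      unfolding f_def gauss_def power_mult[of _ "2 * n" l] gp[OF t] using s by simp
    also have "(t / s) ^ l = t powr real l * s powr (- real l)"
      using t s by (simp add: powr_realpow power_divide powr_minus field_simps)
    finally have "f (g t) = t powr real l * s powr (- real l) * exp (- t)" .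
    moreover have "t powr real l * t powr (b - 1) = t powr (real l + b - 1)"
      using powr_add[of t "real l" "b - 1"] by (simp add: algebra_simps)
    moreover have "s powr (- real l) * s powr (- b) = s powr (- (real l + b))"
      using powr_add[of s "- real l" "- b"] by (simp add: algebra_simps)
    moreover have "f (g t) * g' t = b * (s powr (- real l) * s powr (- b)) * (t powr real l * t powr (b - 1) * exp (- t))"
      unfolding \<open>f (g t) = t powr real l * s powr (- real l) * exp (- t)\<close> g'_def by (simp only: mult_ac)
    ultimately show ?thesis by simp
  qed
  have lb: "real l + b > 0" using b by simp
  have eint: "einterval 0 \<infinity> = {0<..}" by (auto simp: einterval_def)
  have si: "set_integrable lborel (einterval 0 \<infinity>) (\<lambda>t. f (g t) * g' t)"
  proof -
    have "set_integrable lborel {0<..} (\<lambda>t. b * s powr (- (real l + b)) * (t powr (real l + b - 1) * exp (- t)))"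
      by (intro set_integrable_mult_right Gamma_set_integral lb)
    then show ?thesis unfolding eint
      by (rule set_integrable_cong[THEN iffD1, rotated 3]) (auto simp: fg)
  qed
  have d: "DERIV g t :> g' t" if "0 < ereal t" for t
  proof -
    have t: "t > 0" using that by simp
    have "((\<lambda>t. (t / s) powr b) has_real_derivative (b * (t/s) powr (b - 1) * (1 / s))) (at t)"
      using t s by (auto intro!: derivative_eq_intros simp: powr_diff field_simps)
    moreover have "b * (t/s) powr (b - 1) * (1 / s) = g' t"
      using t s by (simp add: g'_def powr_divide powr_diff powr_minus field_simps)
    ultimately show ?thesis by (simp add: g_def[abs_def])
  qed
  have cf: "isCont f (g t)" for t unfolding f_def gauss_def by (intro continuous_intros)
  have cg: "isCont g' t" if "0 < ereal t" for t
    unfolding g'_def using that by (intro continuous_intros) auto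
  have fn: "0 \<le> f (g t)" for t by (simp add: f_def g_def gauss_def)
  have gn: "0 \<le> g' t" for t using b by (simp add: g'_def)
  have "((\<lambda>t. (t / s) powr b) \<longlongrightarrow> 0) (at_right 0)"
    using s b by real_asymp
  then have "(g \<longlongrightarrow> 0) (at_right 0)" by (simp add: g_def[abs_def])
  then have A: "((ereal \<circ> g \<circ> real_of_ereal) \<longlongrightarrow> 0) (at_right 0)"
    unfolding zero_ereal_def ereal_tendsto_simps .
  have "filterlim (\<lambda>t. (t / s) powr b) at_top at_top"
    using s b by real_asymp
  then have "filterlim g at_top at_top" by (simp add: g_def[abs_def])
  then have B: "((ereal \<circ> g \<circ> real_of_ereal) \<longlongrightarrow> \<infinity>) (at_left \<infinity>)"
    unfolding ereal_tendsto_simps .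
  note sub = interval_integral_substitution_nonneg[of 0 \<infinity> g g' f 0 \<infinity>, OF _ d cf cg fn gn A B si, simplified]
  have half: "(LINT x:{0<..}|lborel. f x) = b * s powr (- (real l + b)) * Gamma (real l + b)"
  proof -
    have "(LINT x:{0<..}|lborel. f x) = (LBINT x=0..\<infinity>. f x)"
      by (simp add: interval_lebesgue_integral_def eint)
    also have "\<dots> = (LINT t:{0<..}|lborel. f (g t) * g' t)"
      unfolding sub(2) by (simp add: interval_lebesgue_integral_def eint)
    also have "\<dots> = (LINT t:{0<..}|lborel. b * s powr (- (real l + b)) * (t powr (real l + b - 1) * exp (- t)))"
      by (intro set_lebesgue_integral_cong) (auto simp: fg)
    also have "\<dots> = b * s powr (- (real l + b)) * Gamma (real l + b)"
      by (simp add: Gamma_set_integral[OF lb])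
    finally show ?thesis .
  qed
  have ev: "f (- x) = f x" for x by (simp add: f_def)
  have si: "set_integrable lborel {0<..} f" using sub(1) unfolding eint .
  have fm: "f \<in> borel_measurable borel" by measurable
  note e = even_integral_lborel[OF fm ev si]
  show "integrable lborel (\<lambda>x. x ^ (2 * n * l) * gauss n s x)"
    using e(1) by (simp add: f_def[abs_def])
  have nb: "2 * b = 1 / real n" using n by (simp add: b_def)
  have "(LINT x|lborel. x ^ (2 * n * l) * gauss n s x) = (2 * b) * s powr (- (real l + b)) * Gamma (real l + b)"
    using e(2) unfolding half by (simp add: f_def[abs_def])
  also have "\<dots> = Gamma (real l + b) / (real n * s powr (real l + b))"
    unfolding nb powr_minus_divide by simp
  finally show "(LINT x|lborel. x ^ (2 * n * l) * gauss n s x) =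
      Gamma (real l + 1 / (2 * real n)) / (real n * s powr (real l + 1 / (2 * real n)))"
    by (simp add: b_def)
qed

section \<open>The power series of the kernel and its integrals against Gaussians\<close>

definition cn_coeff :: "nat \<Rightarrow> nat \<Rightarrow> real" where
  "cn_coeff n l = real n / ((2 * real n) powr (2 * real l + 1 / (2 * real n)) * Gamma (real l + 1 / (2 * real n)) * fact l)"

text \<open>The series of \<open>cn\<close> with all signs positive, used as a majorant of
  \<open>cn\<close>.\<close>

definition cn_abs :: "nat \<Rightarrow> real \<Rightarrow> real" where
  "cn_abs n x = (\<Sum>l. cn_coeff n l * x ^ (2 * n * l))"

lemma cn_conv_coeff: "cn n x = (\<Sum>l. (-1) ^ l * cn_coeff n l * x ^ (2 * n * l))"
  by (simp add: cn_def cn_coeff_def)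

lemma cn_coeff_pos: "n \<ge> 1 \<Longrightarrow> cn_coeff n l > 0"
  unfolding cn_coeff_def by (intro divide_pos_pos mult_pos_pos Gamma_real_pos add_nonneg_pos) auto

lemma cn_coeff_Suc:
  assumes "n \<ge> 1"
  shows "cn_coeff n (Suc l) = cn_coeff n l / ((2 * real n)\<^sup>2 * (real l + 1 / (2 * real n)) * (real l + 1))"
proof -
  define b where "b = 1 / (2 * real n)"
  have b: "b > 0" using assms by (simp add: b_def)
  then have "real l + b \<notin> \<int>\<^sub>\<le>\<^sub>0"
    using nonpos_Ints_nonpos[of "real l + b"] by linarith
  then have "Gamma (real (Suc l) + b) = (real l + b) * Gamma (real l + b)"
    using Gamma_plus1[of "real l + b"] by (simp add: algebra_simps)
  moreover have "(2 * real n) powr (2 * real (Suc l) + b) = (2 * real n)\<^sup>2 * (2 * real n) powr (2 * real l + b)"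
    using assms powr_add[of "2 * real n" 2 "2 * real l + b"] by (simp add: algebra_simps)
  ultimately show ?thesis
    unfolding cn_coeff_def b_def[symmetric] by (simp add: divide_simps mult_ac)
qed

lemma cn_coeff_summable:
  assumes n: "n \<ge> 1"
  shows "summable (\<lambda>l. cn_coeff n l * x ^ l)"
\<comment> \<open>Beyond \<open>2 * \<bar>x\<bar>\<close> the factor \<open>real l + 1\<close> of
  the recurrence alone brings the ratio down to 1/2, because the remaining factor \<open>D\<close>
  is at least 1.\<close>
proof (rule summable_ratio_test[of "1/2" "Suc (nat \<lceil>2 * \<bar>x\<bar>\<rceil>)"])
  fix l assume l: "Suc (nat \<lceil>2 * \<bar>x\<bar>\<rceil>) \<le> l"
  have 1: "2 * \<bar>x\<bar> \<le> real l" using l by linarith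
  define D where "D = (2 * real n)\<^sup>2 * (real l + 1 / (2 * real n))"
  have "1\<^sup>2 \<le> (2 * real n)\<^sup>2" using n by (intro power_mono) auto
  then have "1 * 1 \<le> (2 * real n)\<^sup>2 * (real l + 1 / (2 * real n))"
    using l by (intro mult_mono) (auto intro!: add_increasing2)
  then have D: "D \<ge> 1" by (simp add: D_def)
  have "1 * (real l + 1) \<le> D * (real l + 1)" using D by (intro mult_right_mono) auto
  moreover have "2 * \<bar>x\<bar> \<le> 1 * (real l + 1)" using 1 by simp
  ultimately have 2: "2 * \<bar>x\<bar> \<le> D * (real l + 1)" by (rule order_trans[rotated])
  have P: "D * (real l + 1) > 0" using D by (intro mult_pos_pos) auto
  have "norm (cn_coeff n (Suc l) * x ^ Suc l) = (\<bar>x\<bar> / (D * (real l + 1))) * norm (cn_coeff n l * x ^ l)"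
    unfolding cn_coeff_Suc[OF n] D_def[symmetric] using D by (simp add: abs_mult)
  also have "\<dots> \<le> 1/2 * norm (cn_coeff n l * x ^ l)"
    using 2 P by (intro mult_right_mono) (auto simp: pos_divide_le_eq)
  finally show "norm (cn_coeff n (Suc l) * x ^ Suc l) \<le> 1/2 * norm (cn_coeff n l * x ^ l)" .
qed simp

lemma cn_abs_summable: "n \<ge> 1 \<Longrightarrow> summable (\<lambda>l. cn_coeff n l * x ^ (2 * n * l))"
  using cn_coeff_summable[of n "x ^ (2 * n)"] by (simp add: power_mult)

lemma cn_summable:
  assumes "n \<ge> 1"
  shows "summable (\<lambda>l. (-1) ^ l * cn_coeff n l * x ^ (2 * n * l))"
proof -
  have eq: "cn_coeff n l * (- (x ^ (2 * n))) ^ l = (-1) ^ l * cn_coeff n l * x ^ (2 * n * l)" for l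
    unfolding power_minus[of "x ^ (2 * n)" l] power_mult[of x "2 * n" l] by simp
  show ?thesis using cn_coeff_summable[OF assms, of "- (x ^ (2 * n))"] unfolding eq .
qed

lemma cn_measurable [measurable]: "cn n \<in> borel_measurable borel"
  unfolding cn_conv_coeff by measurable

lemma cn_abs_measurable [measurable]: "cn_abs n \<in> borel_measurable borel"
  unfolding cn_abs_def by measurable

lemma cn_minus [simp]: "cn n (- x) = cn n x"
  by (simp add: cn_conv_coeff power_mult)

lemma cn_abs_mono:
  assumes n: "n \<ge> 1" and xy: "\<bar>x\<bar> \<le> \<bar>y\<bar>"
  shows "\<bar>cn n x\<bar> \<le> cn_abs n y"
proof -
  have "summable (\<lambda>l. norm ((-1) ^ l * cn_coeff n l * x ^ (2 * n * l)))"
    using cn_abs_summable[OF n, of x] cn_coeff_pos[OF n] by (simp add: abs_mult power_mult less_imp_le abs_of_pos)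
  then have "norm (cn n x) \<le> (\<Sum>l. norm ((-1) ^ l * cn_coeff n l * x ^ (2 * n * l)))"
    unfolding cn_conv_coeff by (rule summable_norm)
  also have "\<dots> \<le> cn_abs n y"
    unfolding cn_abs_def
  proof (intro suminf_le allI)
    fix l
    have "norm ((-1) ^ l * cn_coeff n l * x ^ (2 * n * l)) = cn_coeff n l * \<bar>x\<bar> ^ (2 * n * l)"
      using cn_coeff_pos[OF n, of l] by (simp add: abs_mult power_abs)
    also have "\<dots> \<le> cn_coeff n l * \<bar>y\<bar> ^ (2 * n * l)"
      using xy cn_coeff_pos[OF n, of l] by (intro mult_left_mono power_mono) auto
    finally show "norm ((-1) ^ l * cn_coeff n l * x ^ (2 * n * l)) \<le> cn_coeff n l * y ^ (2 * n * l)"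
      by (simp add: power_mult)
  qed (use cn_abs_summable[OF n] \<open>summable (\<lambda>l. norm ((-1) ^ l * cn_coeff n l * x ^ (2 * n * l)))\<close> in auto)
  finally show ?thesis by simp
qed

text \<open>After the cancellation of the Gamma factors, termwise integration leaves the exponential
  series at \<open>- z\<close>. The same computation without signs gives the series of
  \<open>K * exp z\<close>, whose convergence justifies the exchange.\<close>

lemma gauss_transform:
  assumes n: "n \<ge> 1" and s: "s > 0"
  shows "integrable lborel (\<lambda>w. cn_abs n (w * t) * gauss n s w)"
    and "integrable lborel (\<lambda>w. cn n (w * t) * gauss n s w)"
    and "(LINT w|lborel. cn n (w * t) * gauss n s w) =
      (2 * real n * s) powr (- 1 / (2 * real n)) * gauss n (1 / (4 * (real n)\<^sup>2 * s)) t"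
proof -
  define b where "b = 1 / (2 * real n)"
  have b: "b > 0" using n by (simp add: b_def)
  define f where "f l w = (-1) ^ l * cn_coeff n l * (w * t) ^ (2 * n * l) * gauss n s w" for l w
  define g where "g l w = cn_coeff n l * (w * t) ^ (2 * n * l) * gauss n s w" for l w
  have f_eq: "f l w = ((-1) ^ l * cn_coeff n l * t ^ (2 * n * l)) * (w ^ (2 * n * l) * gauss n s w)" for l w
    by (simp add: f_def power_mult_distrib mult_ac)
  have g_eq: "g l w = (cn_coeff n l * t ^ (2 * n * l)) * (w ^ (2 * n * l) * gauss n s w)" for l w
    by (simp add: g_def power_mult_distrib mult_ac)
  define K where "K = (2 * real n * s) powr (- b)"
  define z where "z = t ^ (2 * n) / (4 * (real n)\<^sup>2 * s)"
  have m: "cn_coeff n l * t ^ (2 * n * l) * (LINT w|lborel. w ^ (2 * n * l) * gauss n s w) = K * (z ^ l / fact l)" for l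
  proof -
    have gauss_cls: "Gamma (real l + b) > 0" using b by (intro Gamma_real_pos) simp
    have "cn_coeff n l * t ^ (2 * n * l) * (LINT w|lborel. w ^ (2 * n * l) * gauss n s w)
      = t ^ (2 * n * l) / ((2 * real n) powr (2 * real l + b) * s powr (real l + b) * fact l)"
      unfolding gauss_moment[OF n s] cn_coeff_def b_def[symmetric] using gauss_cls n by simp
    also have "(2 * real n) powr (2 * real l + b) = (4 * (real n)\<^sup>2) ^ l * (2 * real n) powr b"
    proof -
      have "(2 * real n) powr (2 * real l + b) = (2 * real n) powr real (2 * l) * (2 * real n) powr b"
        by (simp add: powr_add)
      also have "(2 * real n) powr real (2 * l) = (2 * real n) ^ (2 * l)"
        using n by (intro powr_realpow) simp
      finally show ?thesis by (simp add: power_mult power_mult_distrib)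
    qed
    also have "s powr (real l + b) = s ^ l * s powr b"
      using s by (simp add: powr_add powr_realpow)
    also have "t ^ (2 * n * l) / ((4 * (real n)\<^sup>2) ^ l * (2 * real n) powr b * (s ^ l * s powr b) * fact l) = K * (z ^ l / fact l)"
      using n s by (simp add: K_def z_def powr_mult powr_minus_divide power_divide power_mult_distrib power_mult)
    finally show ?thesis .
  qed
  have K: "K > 0" using n s by (simp add: K_def)
  have z: "z \<ge> 0" using s by (simp add: z_def power_mult)
  have ig: "integrable lborel (g l)" for l
    unfolding g_eq by (intro integrable_mult_right gauss_moment(1)[OF n s])
  have "integrable lborel (f l)" for l
    unfolding f_eq by (intro integrable_mult_right gauss_moment(1)[OF n s])
  have nf: "norm (f l w) = g l w" "norm (g l w) = g l w" for l w
    using cn_coeff_pos[OF n, of l] gauss_pos[of n s w] by (simp_all add: f_def g_def abs_mult power_mult)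
  have ing: "integral\<^sup>L lborel (g l) = K * (z ^ l / fact l)" for l
    unfolding g_eq m[symmetric] by (rule integral_mult_right_zero)
  have inf: "integral\<^sup>L lborel (f l) = K * ((- z) ^ l / fact l)" for l
  proof -
    have "integral\<^sup>L lborel (f l) = (-1) ^ l * (cn_coeff n l * t ^ (2 * n * l) * (LINT w|lborel. w ^ (2 * n * l) * gauss n s w))"
      unfolding f_eq by (subst integral_mult_right_zero) (simp add: mult_ac)
    then show ?thesis unfolding m by (simp add: power_minus[of z])
  qed
  have ex: "(\<lambda>l. y ^ l / fact l) sums exp y" for y :: real
    using exp_converges[of y] by (simp add: divide_inverse mult.commute)
  have sg: "summable (\<lambda>l. g l w)" for w
    unfolding g_def by (intro summable_mult2 cn_abs_summable n)
  have sig: "summable (\<lambda>l. integral\<^sup>L lborel (g l))"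
    unfolding ing by (intro summable_mult sums_summable[OF ex])
  have sum_g: "(\<Sum>l. g l w) = cn_abs n (w * t) * gauss n s w" for w
    unfolding g_def cn_abs_def by (intro suminf_mult2[symmetric] cn_abs_summable n)
  have sum_f: "(\<Sum>l. f l w) = cn n (w * t) * gauss n s w" for w
    unfolding f_def cn_conv_coeff by (intro suminf_mult2[symmetric] cn_summable n)
  show "integrable lborel (\<lambda>w. cn_abs n (w * t) * gauss n s w)"
    unfolding sum_g[symmetric] by (rule integrable_suminf) (use ig sg sig nf in auto)
  show "integrable lborel (\<lambda>w. cn n (w * t) * gauss n s w)"
    unfolding sum_f[symmetric] by (rule integrable_suminf) (use \<open>\<And>l. integrable lborel (f l)\<close> sg sig nf in auto)
  have "(LINT w|lborel. cn n (w * t) * gauss n s w) = (\<Sum>l. integral\<^sup>L lborel (f l))"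
    unfolding sum_f[symmetric] by (rule integral_suminf) (use \<open>\<And>l. integrable lborel (f l)\<close> sg sig nf in auto)
  also have "\<dots> = K * exp (- z)"
    unfolding inf by (subst suminf_mult) (use ex[of "- z"] in \<open>auto simp: sums_iff\<close>)
  finally show "(LINT w|lborel. cn n (w * t) * gauss n s w) =
      (2 * real n * s) powr (- 1 / (2 * real n)) * gauss n (1 / (4 * (real n)\<^sup>2 * s)) t"
    by (simp add: K_def z_def b_def gauss_def)
qed

section \<open>The transform on even and odd Gaussians\<close>

text \<open>By Weierstrass, \<open>phi\<close> is uniformly approximated by polynomials on
  \<open>{0..1}\<close>, where \<open>y\<close> takes its values, and \<open>mom\<close> annihilates
  polynomials in \<open>y\<close>.\<close>

lemma integral_compose_continuous_zero:
  fixes g :: "real \<Rightarrow> complex" and y :: "real \<Rightarrow> real"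
  assumes g: "integrable lborel g" and [measurable]: "y \<in> borel_measurable borel"
    and y: "\<And>x. 0 \<le> y x" "\<And>x. y x \<le> 1"
    and mom: "\<And>k. (LINT x|lborel. y x ^ k *\<^sub>R g x) = 0"
    and phi: "continuous_on UNIV (phi :: real \<Rightarrow> real)"
  shows "(LINT x|lborel. phi (y x) *\<^sub>R g x) = 0"
proof -
  have [measurable]: "g \<in> borel_measurable borel" using g by auto
  have [measurable]: "phi \<in> borel_measurable borel" using phi by (rule borel_measurable_continuous_onI)
  have cb: "integrable lborel (\<lambda>x. h (y x) *\<^sub>R g x)" if h: "continuous_on UNIV h" for h :: "real \<Rightarrow> real"
  proof -
    have [measurable]: "h \<in> borel_measurable borel" using h by (rule borel_measurable_continuous_onI)
    have "compact (h ` {0..1})"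
      using h by (intro compact_continuous_image) (auto intro: continuous_on_subset)
    then obtain B where B: "\<And>z. z \<in> {0..1} \<Longrightarrow> norm (h z) \<le> B"
      by (meson compact_imp_bounded bounded_iff imageI)
    show ?thesis
    proof (rule Bochner_Integration.integrable_bound)
      show "integrable lborel (\<lambda>x. B *\<^sub>R g x)" using g by simp
      show "AE x in lborel. norm (h (y x) *\<^sub>R g x) \<le> norm (B *\<^sub>R g x)"
        using B y by (intro AE_I2) (auto intro!: mult_right_mono order_trans[OF _ abs_ge_self])
    qed measurable
  qed
  define I where "I = (LINT x|lborel. norm (g x))"
  have I: "I \<ge> 0" by (simp add: I_def)
  have bound: "norm (LINT x|lborel. phi (y x) *\<^sub>R g x) \<le> e * I" if e: "e > 0" for e
  proof -
    obtain p where p: "real_polynomial_function p" "\<And>z. z \<in> {0..1} \<Longrightarrow> \<bar>phi z - p z\<bar> < e"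
      using Stone_Weierstrass_real_polynomial_function[of "{0..1}" phi e] phi e
      by (auto intro: continuous_on_subset)
    obtain a N where pa: "p = (\<lambda>z. \<Sum>i\<le>N. a i * z ^ i)"
      using p(1) real_polynomial_function_iff_sum by blast
    have pc: "continuous_on UNIV p" unfolding pa by (intro continuous_intros)
    have "(LINT x|lborel. p (y x) *\<^sub>R g x) = (LINT x|lborel. (\<Sum>i\<le>N. a i *\<^sub>R (y x ^ i *\<^sub>R g x)))"
      by (simp add: pa scaleR_sum_left)
    also have "\<dots> = (\<Sum>i\<le>N. a i *\<^sub>R (LINT x|lborel. y x ^ i *\<^sub>R g x))"
      using cb[of "\<lambda>z. z ^ _"]
      by (subst Bochner_Integration.integral_sum) (auto intro!: integrable_scaleR_right simp del: scaleR_scaleR simp: continuous_intros)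
    finally have p0: "(LINT x|lborel. p (y x) *\<^sub>R g x) = 0" using mom by simp
    have "(LINT x|lborel. phi (y x) *\<^sub>R g x) = (LINT x|lborel. phi (y x) *\<^sub>R g x - p (y x) *\<^sub>R g x)"
      by (subst Bochner_Integration.integral_diff) (use cb phi pc p0 in auto)
    also have "norm \<dots> \<le> (LINT x|lborel. norm (phi (y x) *\<^sub>R g x - p (y x) *\<^sub>R g x))"
      by (rule integral_norm_bound)
    also have "\<dots> \<le> (LINT x|lborel. e * norm (g x))"
    proof (rule integral_mono)
      show "integrable lborel (\<lambda>x. norm (phi (y x) *\<^sub>R g x - p (y x) *\<^sub>R g x))"
        using cb phi pc by auto
      show "integrable lborel (\<lambda>x. e * norm (g x))" using g by auto
      show "norm (phi (y x) *\<^sub>R g x - p (y x) *\<^sub>R g x) \<le> e * norm (g x)" for x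
        using p(2)[of "y x"] y[of x] unfolding scaleR_left_diff_distrib[symmetric] norm_scaleR
        by (intro mult_right_mono) auto
    qed
    finally show ?thesis by (simp add: I_def)
  qed
  have "norm (LINT x|lborel. phi (y x) *\<^sub>R g x) \<le> 0"
  proof (rule field_le_epsilon)
    fix d :: real assume d: "d > 0"
    \<comment> \<open>Dividing by \<open>I + 1\<close> avoids a case distinction on
      \<open>I = 0\<close>.\<close>
    have "norm (LINT x|lborel. phi (y x) *\<^sub>R g x) \<le> (d / (I + 1)) * I"
      using d I by (intro bound) auto
    also have "\<dots> \<le> d" using d I by (simp add: field_simps)
    finally show "norm (LINT x|lborel. phi (y x) *\<^sub>R g x) \<le> 0 + d" by simp
  qed
  then show ?thesis by simp
qed

lemma integral_superlevel_zero:
  fixes g :: "real \<Rightarrow> complex" and y :: "real \<Rightarrow> real"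
  assumes g: "integrable lborel g" and [measurable]: "y \<in> borel_measurable borel"
    and y: "\<And>x. 0 \<le> y x" "\<And>x. y x \<le> 1"
    and mom: "\<And>k. (LINT x|lborel. y x ^ k *\<^sub>R g x) = 0"
  shows "(LINT x|lborel. indicat_real {c..} (y x) *\<^sub>R g x) = 0"
proof -
  have [measurable]: "g \<in> borel_measurable borel" using g by auto
  \<comment> \<open>For \<open>m > 0\<close> a ramp rising from 0 at \<open>c - 1 / m\<close> to 1
    at \<open>c\<close>. Rising on the left of \<open>c\<close> makes the pointwise limit the
    indicator of the closed half-line.\<close>
  define phi where "phi m z = max 0 (min 1 (1 + real m * (z - c)))" for m z
  have pc: "continuous_on UNIV (phi m)" for m
    unfolding phi_def by (intro continuous_intros)
  have [measurable]: "phi m \<in> borel_measurable borel" for m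
    using pc by (rule borel_measurable_continuous_onI)
  have "(\<lambda>m. LINT x|lborel. phi m (y x) *\<^sub>R g x) \<longlonglongrightarrow> (LINT x|lborel. indicat_real {c..} (y x) *\<^sub>R g x)"
  proof (rule integral_dominated_convergence[where w = "\<lambda>x. norm (g x)"])
    show "AE x in lborel. (\<lambda>m. phi m (y x) *\<^sub>R g x) \<longlonglongrightarrow> indicat_real {c..} (y x) *\<^sub>R g x"
    proof (intro AE_I2 tendsto_eventually)
      fix x
      show "\<forall>\<^sub>F m in sequentially. phi m (y x) *\<^sub>R g x = indicat_real {c..} (y x) *\<^sub>R g x"
      proof (cases "c \<le> y x")
        case True
        then show ?thesis by (auto simp: phi_def)
      next
        case False
        show ?thesis using eventually_ge_at_top[of "nat \<lceil>1 / (c - y x)\<rceil>"]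
        proof eventually_elim
          case (elim m)
          then have "1 / (c - y x) \<le> real m" by linarith
          then have "1 + real m * (y x - c) \<le> 0" using False by (simp add: field_simps)
          then show ?case using False by (simp add: phi_def)
        qed
      qed
    qed
    show "AE x in lborel. norm (phi m (y x) *\<^sub>R g x) \<le> norm (g x)" for m
    proof (intro AE_I2)
      fix x
      have "\<bar>phi m (y x)\<bar> \<le> 1" by (simp add: phi_def)
      then show "norm (phi m (y x) *\<^sub>R g x) \<le> norm (g x)"
        by (simp add: mult_left_le_one_le)
    qed
  qed (use g in auto)
  moreover have "(LINT x|lborel. phi m (y x) *\<^sub>R g x) = 0" for m
    by (rule integral_compose_continuous_zero[OF g _ y mom pc]) measurable
  ultimately show ?thesis by (simp add: LIMSEQ_const_iff)
qed

lemma gauss_power: "gauss n 1 x ^ k = gauss n (real k) x"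
  by (simp add: gauss_def flip: exp_of_nat_mult)

text \<open>The powers of \<open>gauss n 1\<close> are the functions
  \<open>gauss n (real k)\<close>, and its superlevel sets are symmetric intervals, so vanishing
  moments in \<open>gauss n 1\<close> give vanishing integrals over \<open>{-a..a}\<close>.\<close>

lemma AE_zero_if_gauss_orthogonal:
  fixes g :: "real \<Rightarrow> complex"
  assumes n: "n \<ge> 1" and g: "integrable lborel g"
    and even: "\<And>k::nat. (LINT x|lborel. gauss n (real k) x *\<^sub>R g x) = 0"
    and odd: "\<And>k::nat. (LINT x|lborel. gauss n (real k) x *\<^sub>R sgn x *\<^sub>R g x) = 0"
  shows "AE x in lborel. g x = 0"
proof (rule AE_zero_if_symmetric_intervals[OF g])
  have [measurable]: "g \<in> borel_measurable borel" using g by auto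
  have sg: "integrable lborel (\<lambda>x. sgn x *\<^sub>R g x)"
    by (rule Bochner_Integration.integrable_bound[OF g]) (auto simp: sgn_if)
  fix a :: real assume a: "a > 0"
  have ind: "indicat_real {- a..a} x = indicat_real {exp (- (a ^ (2 * n)))..} (gauss n 1 x)" for x
  proof -
    have "x ^ (2 * n) \<le> a ^ (2 * n) \<longleftrightarrow> \<bar>x\<bar> \<le> a"
      using n a power_mono_iff[of "\<bar>x\<bar>" a "2 * n"] by (simp add: power_even_abs)
    then show ?thesis by (auto simp: indicator_def gauss_def)
  qed
  have y: "0 \<le> gauss n 1 x" "gauss n 1 x \<le> 1" for x by (simp_all add: gauss_def power_mult)
  show "(LINT x:{-a..a}|lborel. g x) = 0"
    unfolding set_lebesgue_integral_def ind
    by (rule integral_superlevel_zero[OF g _ y]) (simp_all add: gauss_power even)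
  show "(LINT x:{-a..a}|lborel. sgn x *\<^sub>R g x) = 0"
    unfolding set_lebesgue_integral_def ind
    by (rule integral_superlevel_zero[OF sg _ y]) (simp_all only: gauss_power odd gauss_measurable)
qed

lemma real_L2_gauss:
  assumes "n \<ge> 1" "s > 0"
  shows "real_L2 (gauss n s)"
  using gauss_moment(1)[of n "s + s" 0] assms by (simp add: real_L2_def power2_eq_square gauss_mult)

definition gauss_cls :: "nat \<Rightarrow> real \<Rightarrow> l2" where
  "gauss_cls n s = rcls (gauss n s)"

lemma total_gauss:
  assumes n: "n \<ge> 1"
  shows "total_family ({cmul c (gauss_cls n s) |c s. s > 0} \<union> {cmul c (sgnmul (gauss_cls n s)) |c s. s > 0})"
  unfolding total_family_def
proof (intro allI impI)
  fix x :: l2 assume *: "\<forall>y\<in>{cmul c (gauss_cls n s) |c s. s > 0} \<union> {cmul c (sgnmul (gauss_cls n s)) |c s. s > 0}. inner x y = 0"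
  obtain f where f: "f \<in> L2" "x = cls f" by (cases x)
  note rL = real_L2_gauss[OF n]
  have e: "(LINT x|lborel. gauss n s x *\<^sub>R f x) = 0" if s: "s > 0" for s
  proof -
    have "inner (cls f) (cmul c (rcls (gauss n s))) = 0" for c
      using * s f(2) unfolding gauss_cls_def by blast
    from integral_zero_if_orthogonal[OF f(1) rL[OF s] this] show ?thesis .
  qed
  have o: "(LINT x|lborel. (sgn x * gauss n s x) *\<^sub>R f x) = 0" if s: "s > 0" for s
  proof -
    have "inner (cls f) (cmul c (rcls (\<lambda>x. sgn x * gauss n s x))) = 0" for c
      using * s f(2) unfolding gauss_cls_def sgnmul_rcls[OF rL[OF s], symmetric] by blast
    from integral_zero_if_orthogonal[OF f(1) real_L2_sgn[OF rL[OF s]] this] show ?thesis .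
  qed
  \<comment> \<open>The factor \<open>gauss n 1\<close> makes \<open>f\<close> integrable and shifts
    the exponents from \<open>k\<close> to \<open>k + 1\<close>, so that only parameters
    \<open>s > 0\<close> are tested.\<close>
  have "AE x in lborel. gauss n 1 x *\<^sub>R f x = 0"
  proof (rule AE_zero_if_gauss_orthogonal[OF n])
    show "integrable lborel (\<lambda>x. gauss n 1 x *\<^sub>R f x)"
      using L2_mult_integrable[OF real_L2_L2[OF rL[of 1]] f(1)] by (simp add: scaleR_conv_of_real)
    show "(LINT x|lborel. gauss n (real k) x *\<^sub>R gauss n 1 x *\<^sub>R f x) = 0" for k
      unfolding scaleR_scaleR gauss_mult by (rule e) simp
    show "(LINT x|lborel. gauss n (real k) x *\<^sub>R sgn x *\<^sub>R gauss n 1 x *\<^sub>R f x) = 0" for k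
      using o[of "real k + 1"] unfolding scaleR_scaleR gauss_mult[symmetric] by (simp only: mult_ac)
  qed
  then have "AE x in lborel. f x = 0"
    using gauss_pos[of n 1] by (auto elim!: AE_mp simp: less_le)
  then show "x = 0"
    using f by (simp add: cls_zero[symmetric] cls_eq_iff L2_zero ae_eq_def)
qed

section \<open>The isometric involution on Gaussians and their sign multiples\<close>

lemma reflect_rcls:
  assumes "real_L2 u" "\<And>x. u (- x) = u x"
  shows "reflect (rcls u) = rcls u"
  using assms by (simp add: rcls_def reflect_cls real_L2_L2)

lemma inner_even_sgnmul_even:
  assumes "reflect x = x" "reflect y = y"
  shows "inner x (sgnmul y) = 0"
proof -
  have "reflect (sgnmul y) = - sgnmul y"
    using sgnmul_reflect[of y] assms(2) by (metis minus_minus)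
  then show ?thesis using inner_reflect[of x "sgnmul y"] assms(1) by simp
qed

lemma reflect_gauss_cls: "n \<ge> 1 \<Longrightarrow> s > 0 \<Longrightarrow> reflect (gauss_cls n s) = gauss_cls n s"
  unfolding gauss_cls_def by (intro reflect_rcls real_L2_gauss) auto

text \<open>With \<open>gdual\<close> below: the factor and the parameter of the image of
  \<open>gauss n s\<close> in \<open>gauss_transform\<close>.\<close>

definition gscale :: "nat \<Rightarrow> real \<Rightarrow> real" where
  "gscale n s = (2 * real n * s) powr (- 1 / (2 * real n))"

definition gdual :: "nat \<Rightarrow> real \<Rightarrow> real" where
  "gdual n s = 1 / (4 * (real n)\<^sup>2 * s)"

lemma gdual_pos: "n \<ge> 1 \<Longrightarrow> s > 0 \<Longrightarrow> gdual n s > 0"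
  by (simp add: gdual_def)

lemma gdual_gdual: "n \<ge> 1 \<Longrightarrow> s > 0 \<Longrightarrow> gdual n (gdual n s) = s"
  by (simp add: gdual_def)

lemma gscale_gdual:
  assumes "n \<ge> 1" "s > 0"
  shows "gscale n s * gscale n (gdual n s) = 1"
proof -
  have "2 * real n * s * (2 * real n * gdual n s) = 1"
    using assms by (simp add: gdual_def power2_eq_square)
  then show ?thesis
    unfolding gscale_def using assms gdual_pos[OF assms] by (subst powr_mult[symmetric]) auto
qed

lemma inner_gauss_cls:
  assumes "n \<ge> 1" "s > 0" "r > 0"
  shows "inner (cmul c (gauss_cls n s)) (cmul d (gauss_cls n r)) =
    Re (c * cnj d) * (Gamma (1 / (2 * real n)) / real n * (s + r) powr (- 1 / (2 * real n)))"
proof -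
  have "inner (cmul c (gauss_cls n s)) (cmul d (gauss_cls n r)) = Re (c * cnj d) * (LINT x|lborel. gauss n s x * gauss n r x)"
    unfolding gauss_cls_def by (rule inner_cmul_rcls[OF real_L2_gauss real_L2_gauss]) (use assms in auto)
  also have "(LINT x|lborel. gauss n s x * gauss n r x) = Gamma (1 / (2 * real n)) / real n * (s + r) powr (- 1 / (2 * real n))"
    using gauss_moment(2)[of n "s + r" 0] assms by (simp add: gauss_mult powr_minus_divide)
  finally show ?thesis .
qed

text \<open>This is the equality of Gram entries behind the isometry. It is \<open>2 * real n * s *
  (2 * real n * r) * (gdual n s + gdual n r) = s + r\<close>, raised to the power
  \<open>- 1 / (2 * real n)\<close>.\<close>

lemma gscale_gram:
  assumes "n \<ge> 1" "s > 0" "r > 0"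
  shows "gscale n s * gscale n r * (gdual n s + gdual n r) powr (- 1 / (2 * real n)) = (s + r) powr (- 1 / (2 * real n))"
proof -
  have eq: "2 * real n * s * (2 * real n * r) * (gdual n s + gdual n r) = s + r"
    using assms by (simp add: gdual_def field_simps power2_eq_square)
  have "gdual n s + gdual n r > 0" using assms gdual_pos by (simp add: add_pos_pos)
  then show ?thesis
    unfolding gscale_def eq[symmetric] using assms by (subst (1 2) powr_mult) auto
qed

lemma cmul_scaleR: "cmul c (r *\<^sub>R x) = r *\<^sub>R cmul c x"
  by (simp add: cmul_of_real[symmetric] cmul_cmul mult.commute)

lemma sgnmul_scaleR: "sgnmul (r *\<^sub>R x) = r *\<^sub>R sgnmul x"
  by (simp add: cmul_of_real[symmetric] sgnmul_cmul)

lemma reflect_scaleR: "reflect (r *\<^sub>R x) = r *\<^sub>R reflect x"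
  by (simp add: cmul_of_real[symmetric] reflect_cmul)

lemma Phi_exists:
  assumes n: "n \<ge> 1"
  shows "\<exists>T. bounded_linear T \<and> (\<forall>x y. inner (T x) (T y) = inner x y) \<and>
    (\<forall>c s. s > 0 \<longrightarrow> T (cmul c (gauss_cls n s)) = gscale n s *\<^sub>R cmul c (gauss_cls n (gdual n s)) \<and>
      T (cmul c (sgnmul (gauss_cls n s))) = gscale n s *\<^sub>R cmul c (sgnmul (gauss_cls n (gdual n s))))"
proof -
  define sg_if where "sg_if b = (if b then sgnmul else (\<lambda>x. x))" for b
  \<comment> \<open>\<open>exp s\<close> runs through the positive parameters, so the index type
    needs no side condition; \<open>b\<close> selects the odd generators. Mixed Gram entries vanish
    by parity.\<close>
  define u where "u = (\<lambda>(c, s, b). cmul c (sg_if b (gauss_cls n (exp s))))"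
  define v where "v = (\<lambda>(c, s, b). gscale n (exp s) *\<^sub>R cmul c (sg_if b (gauss_cls n (gdual n (exp s)))))"
  have ran: "range u = {cmul c (gauss_cls n s) |c s. s > 0} \<union> {cmul c (sgnmul (gauss_cls n s)) |c s. s > 0}"
  proof (intro equalityI subsetI)
    fix x assume "x \<in> range u"
    then show "x \<in> {cmul c (gauss_cls n s) |c s. s > 0} \<union> {cmul c (sgnmul (gauss_cls n s)) |c s. s > 0}"
      by (auto simp: u_def sg_if_def split: if_splits) (metis exp_gt_zero)+
  next
    fix x assume "x \<in> {cmul c (gauss_cls n s) |c s. s > 0} \<union> {cmul c (sgnmul (gauss_cls n s)) |c s. s > 0}"
    then consider c s where "s > 0" "x = cmul c (gauss_cls n s)" | c s where "s > 0" "x = cmul c (sgnmul (gauss_cls n s))" by blast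
    then show "x \<in> range u"
    proof cases
      case 1
      then have "x = u (c, ln s, False)" by (simp add: u_def sg_if_def)
      then show ?thesis by blast
    next
      case 2
      then have "x = u (c, ln s, True)" by (simp add: u_def sg_if_def)
      then show ?thesis by blast
    qed
  qed
  have gram: "inner (u i) (u j) = inner (v i) (v j)" for i j
  proof -
    obtain c s a where i: "i = (c, s, a)" by (cases i)
    obtain d r b where j: "j = (d, r, b)" by (cases j)
    have p: "exp s > 0" "exp r > 0" by auto
    have mixed: "inner (cmul c x) (cmul d (sgnmul y)) = 0" "inner (cmul c (sgnmul x)) (cmul d y) = 0"
      if "reflect x = x" "reflect y = y" for x y
    proof -
      show "inner (cmul c x) (cmul d (sgnmul y)) = 0"
        unfolding sgnmul_cmul[symmetric] using that by (intro inner_even_sgnmul_even) (auto simp: reflect_cmul)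
      show "inner (cmul c (sgnmul x)) (cmul d y) = 0"
        unfolding sgnmul_cmul[symmetric] inner_sgnmul_left using that by (intro inner_even_sgnmul_even) (auto simp: reflect_cmul)
    qed
    have even: "inner (cmul c (gauss_cls n (exp s))) (cmul d (gauss_cls n (exp r))) =
      inner (gscale n (exp s) *\<^sub>R cmul c (gauss_cls n (gdual n (exp s)))) (gscale n (exp r) *\<^sub>R cmul d (gauss_cls n (gdual n (exp r))))"
      unfolding inner_scaleR_left inner_scaleR_right inner_gauss_cls[OF n p]
        inner_gauss_cls[OF n gdual_pos[OF n p(1)] gdual_pos[OF n p(2)]] gscale_gram[OF n p, symmetric]
      by (simp only: mult_ac)
    show ?thesis
    proof (cases "a = b")
      case True
      then show ?thesis
        unfolding i j u_def v_def prod.case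
        by (cases b) (simp_all add: sg_if_def even inner_sgnmul flip: sgnmul_cmul sgnmul_scaleR del: inner_scaleR_left inner_scaleR_right)
    next
      case False
      then show ?thesis
        unfolding i j u_def v_def prod.case
        by (cases b) (simp_all add: sg_if_def mixed reflect_gauss_cls[OF n] gdual_pos[OF n])
    qed
  qed
  obtain T where T: "bounded_linear T" "\<And>i. T (u i) = v i" "\<And>x y. inner (T x) (T y) = inner x y"
    using isometry_extension[of u v] total_gauss[OF n] gram unfolding ran by metis
  show ?thesis
  proof (intro exI[of _ T] conjI allI impI)
    fix c and s :: real assume s: "s > 0"
    show "T (cmul c (gauss_cls n s)) = gscale n s *\<^sub>R cmul c (gauss_cls n (gdual n s))"
      using T(2)[of "(c, ln s, False)"] s by (simp add: u_def v_def sg_if_def)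
    show "T (cmul c (sgnmul (gauss_cls n s))) = gscale n s *\<^sub>R cmul c (sgnmul (gauss_cls n (gdual n s)))"
      using T(2)[of "(c, ln s, True)"] s by (simp add: u_def v_def sg_if_def)
  qed (use T in auto)
qed

definition Phi :: "nat \<Rightarrow> l2 \<Rightarrow> l2" where
  "Phi n = (SOME T. bounded_linear T \<and> (\<forall>x y. inner (T x) (T y) = inner x y) \<and>
    (\<forall>c s. s > 0 \<longrightarrow> T (cmul c (gauss_cls n s)) = gscale n s *\<^sub>R cmul c (gauss_cls n (gdual n s)) \<and>
      T (cmul c (sgnmul (gauss_cls n s))) = gscale n s *\<^sub>R cmul c (sgnmul (gauss_cls n (gdual n s)))))"

context
  fixes n :: nat
  assumes n: "n \<ge> 1"
begin

lemma bounded_linear_Phi: "bounded_linear (Phi n)"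
  and inner_Phi: "inner (Phi n x) (Phi n y) = inner x y"
  and Phi_gauss_cls: "s > 0 \<Longrightarrow> Phi n (cmul c (gauss_cls n s)) = gscale n s *\<^sub>R cmul c (gauss_cls n (gdual n s))"
  and Phi_sgnmul_gauss_cls: "s > 0 \<Longrightarrow> Phi n (cmul c (sgnmul (gauss_cls n s))) = gscale n s *\<^sub>R cmul c (sgnmul (gauss_cls n (gdual n s)))"
  using someI_ex[OF Phi_exists[OF n]] unfolding Phi_def[symmetric] by blast+

lemmas linear_Phi = bounded_linear.linear[OF bounded_linear_Phi]

lemma Phi_eqI:
  assumes "bounded_linear f" "bounded_linear g"
    and "\<And>c s. s > 0 \<Longrightarrow> f (cmul c (gauss_cls n s)) = g (cmul c (gauss_cls n s))"
    and "\<And>c s. s > 0 \<Longrightarrow> f (cmul c (sgnmul (gauss_cls n s))) = g (cmul c (sgnmul (gauss_cls n s)))"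
  shows "f x = g (x :: l2)"
  by (rule total_eqI[OF total_gauss[OF n] assms(1,2)]) (use assms(3,4) in auto)

lemma Phi_Phi: "Phi n (Phi n x) = x"
proof (rule Phi_eqI[where f = "\<lambda>x. Phi n (Phi n x)" and g = "\<lambda>x. x"])
  show "bounded_linear (\<lambda>x. Phi n (Phi n x))"
    by (intro bounded_linear_compose[OF bounded_linear_Phi] bounded_linear_Phi)
  fix c and s :: real assume s: "s > 0"
  note lin = linear_scale[OF linear_Phi]
  note gg = gscale_gdual[OF n s] gdual_gdual[OF n s] gdual_pos[OF n s]
  show "Phi n (Phi n (cmul c (gauss_cls n s))) = cmul c (gauss_cls n s)"
    using gg by (simp add: Phi_gauss_cls s lin)
  show "Phi n (Phi n (cmul c (sgnmul (gauss_cls n s)))) = cmul c (sgnmul (gauss_cls n s))"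
    using gg by (simp add: Phi_sgnmul_gauss_cls s lin)
qed (rule bounded_linear_ident)

text \<open>\<open>isometry_extension\<close> gives real linearity only; complex linearity follows
  since the generators come with all complex factors.\<close>

lemma Phi_cmul: "Phi n (cmul d x) = cmul d (Phi n x)"
proof (rule Phi_eqI[where f = "\<lambda>x. Phi n (cmul d x)" and g = "\<lambda>x. cmul d (Phi n x)"])
  show "bounded_linear (\<lambda>x. Phi n (cmul d x))" "bounded_linear (\<lambda>x. cmul d (Phi n x))"
    by (intro bounded_linear_compose[OF bounded_linear_Phi] bounded_linear_compose[OF bounded_linear_cmul]
        bounded_linear_Phi bounded_linear_cmul)+
qed (simp_all add: cmul_cmul Phi_gauss_cls Phi_sgnmul_gauss_cls cmul_scaleR)

lemma Phi_reflect: "Phi n (reflect x) = reflect (Phi n x)"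
proof (rule Phi_eqI[where f = "\<lambda>x. Phi n (reflect x)" and g = "\<lambda>x. reflect (Phi n x)"])
  show "bounded_linear (\<lambda>x. Phi n (reflect x))" "bounded_linear (\<lambda>x. reflect (Phi n x))"
    by (intro bounded_linear_compose[OF bounded_linear_Phi] bounded_linear_compose[OF bounded_linear_reflect]
        bounded_linear_Phi bounded_linear_reflect)+
  have rs: "reflect (sgnmul y) = - sgnmul y" if "reflect y = y" for y
    using sgnmul_reflect[of y] that by (metis minus_minus)
  fix c and s :: real assume s: "s > 0"
  note R = reflect_gauss_cls[OF n s] reflect_gauss_cls[OF n gdual_pos[OF n s]]
  show "Phi n (reflect (cmul c (gauss_cls n s))) = reflect (Phi n (cmul c (gauss_cls n s)))"
    by (simp add: reflect_cmul R Phi_gauss_cls s reflect_scaleR)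
  have "Phi n (reflect (cmul c (sgnmul (gauss_cls n s)))) = Phi n (cmul (- c) (sgnmul (gauss_cls n s)))"
    by (simp add: reflect_cmul rs R cmul_cmul flip: cmul_minus1)
  also have "\<dots> = reflect (Phi n (cmul c (sgnmul (gauss_cls n s))))"
    by (simp add: Phi_sgnmul_gauss_cls s reflect_scaleR reflect_cmul rs R cmul_cmul flip: cmul_minus1)
  finally show "Phi n (reflect (cmul c (sgnmul (gauss_cls n s)))) = reflect (Phi n (cmul c (sgnmul (gauss_cls n s))))" .
qed

text \<open>An isometry that is its own inverse is self-adjoint.\<close>

lemma inner_Phi_left: "inner (Phi n x) y = inner x (Phi n y)"
  using inner_Phi[of x "Phi n y"] by (simp add: Phi_Phi)

end

section \<open>The integral formula\<close>

lemma inner_cls_cmul_rcls_eq: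
  assumes f: "f \<in> L2" "real_L2 u" and g: "g \<in> L2" "real_L2 v"
    and eq: "\<And>c. inner (cls f) (cmul c (rcls u)) = inner (cls g) (cmul c (rcls v))"
  shows "(LINT x|lborel. u x *\<^sub>R f x) = (LINT x|lborel. v x *\<^sub>R g x)"
  using eq[of 1] eq[of \<i>] unfolding inner_cls_cmul_rcls[OF f] inner_cls_cmul_rcls[OF g]
  by (simp add: complex_eq_iff)

lemma odd_integral_zero:
  fixes f :: "real \<Rightarrow> 'a :: {banach, second_countable_topology}"
  assumes "\<And>x. f (- x) = - f x"
  shows "integral\<^sup>L lborel f = 0"
proof -
  have eq: "integral\<^sup>L lborel f = - integral\<^sup>L lborel f"
    using lborel_integral_real_affine[of "-1" f 0] assms by simp
  have "2 *\<^sub>R integral\<^sup>L lborel f = integral\<^sup>L lborel f + integral\<^sup>L lborel f"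
    by (rule scaleR_2)
  also have "\<dots> = 0" by (subst (2) eq) simp
  finally show ?thesis by simp
qed

lemma scaled_gauss_cmul: "r *\<^sub>R cmul c (rcls u) = cmul c (rcls (\<lambda>x. r * u x))" if "real_L2 u"
  using that by (simp add: rcls_def cmul_cls cls_scaleR real_L2_L2 L2_cmult scaleR_conv_of_real mult.left_commute)

lemma real_L2_cmult: "real_L2 u \<Longrightarrow> real_L2 (\<lambda>x. r * u x)"
  by (auto simp: real_L2_def power_mult_distrib)

text \<open>The integral formula is tested against the functions \<open>gauss n s\<close>, where Fubini applies
  although \<open>cn n\<close> itself is only controlled by the entire function \<open>cn_abs n\<close>.\<close>

lemma Phi_integral:
  assumes n: "n \<ge> 1" and h: "h \<in> L2" and supp: "\<And>t. \<bar>t\<bar> > A \<Longrightarrow> h t = 0" and even: "\<And>t. h (- t) = h t"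
  defines "Q \<equiv> \<lambda>w. LINT t|lborel. complex_of_real (cn n (w * t)) * h t"
  shows "Q \<in> L2" "Phi n (cls h) = cls Q"
proof -
  have [measurable]: "h \<in> borel_measurable borel" using h by measurable
  have ih: "integrable lborel h"
  proof -
    have "integrable lborel (\<lambda>x. complex_of_real (indicator {-A..A} x) * h x)"
      by (intro L2_mult_integrable real_L2_L2 real_L2_indicator_interval h)
    moreover have "(\<lambda>x. complex_of_real (indicator {-A..A} x) * h x) = h"
    proof
      fix x show "complex_of_real (indicator {-A..A} x) * h x = h x"
        using supp[of x] by (cases "\<bar>x\<bar> > A") (auto simp: indicator_def)
    qed
    ultimately show ?thesis by simp
  qed
  have [measurable]: "Q \<in> borel_measurable borel"
    unfolding Q_def by measurable
  define F where "F s w t = gauss n s w *\<^sub>R (complex_of_real (cn n (w * t)) * h t)" for s w t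
  \<comment> \<open>The bounded support of \<open>h\<close> replaces \<open>w * t\<close> by
    \<open>w * A\<close>, which leaves a product of a function of \<open>w\<close> and a function of
    \<open>t\<close>, integrable by \<open>gauss_transform\<close>.\<close>
  have bd: "norm (F s w t) \<le> cn_abs n (w * A) * gauss n s w * norm (h t)" for s w t
  proof (cases "\<bar>t\<bar> > A")
    case True
    then show ?thesis using supp[of t] by (simp add: F_def)
  next
    case False
    then have "\<bar>w * t\<bar> \<le> \<bar>w * A\<bar>" by (auto simp: abs_mult intro!: mult_left_mono)
    then have "\<bar>cn n (w * t)\<bar> * (gauss n s w * norm (h t)) \<le> cn_abs n (w * A) * (gauss n s w * norm (h t))"
      using gauss_pos[of n s w] by (intro mult_right_mono cn_abs_mono n) auto
    then show ?thesis using gauss_pos[of n s w] by (simp add: F_def norm_mult mult_ac)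
  qed
  have iF: "integrable (lborel \<Otimes>\<^sub>M lborel) (\<lambda>(w, t). F s w t)" if s: "s > 0" for s
  proof (rule Bochner_Integration.integrable_bound)
    note ia = gauss_transform(1)[OF n s, of A]
    have ca: "0 \<le> cn_abs n x" for x using cn_abs_mono[OF n, of x x] by simp
    show "integrable (lborel \<Otimes>\<^sub>M lborel) (\<lambda>(w, t). cn_abs n (w * A) * gauss n s w * norm (h t))"
    proof (rule lborel_pair.Fubini_integrable)
      show "integrable lborel (\<lambda>w. LINT t|lborel. norm (case (w, t) of (w, t) \<Rightarrow> cn_abs n (w * A) * gauss n s w * norm (h t)))"
        using ia ca gauss_pos[of n s] by (simp add: abs_mult less_imp_le abs_of_nonneg)
      show "AE w in lborel. integrable lborel (\<lambda>t. case (w, t) of (w, t) \<Rightarrow> cn_abs n (w * A) * gauss n s w * norm (h t))"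
        using ih by simp
    qed measurable
    show "(\<lambda>(w, t). F s w t) \<in> borel_measurable (lborel \<Otimes>\<^sub>M lborel)"
      unfolding F_def by measurable
    show "AE x in lborel \<Otimes>\<^sub>M lborel. norm (case x of (w, t) \<Rightarrow> F s w t) \<le> norm (case x of (w, t) \<Rightarrow> cn_abs n (w * A) * gauss n s w * norm (h t))"
      using bd by (auto intro!: AE_I2 order_trans[OF bd abs_ge_self])
  qed
  have FQ: "(LINT t|lborel. F s w t) = gauss n s w *\<^sub>R Q w" for s w
    unfolding F_def Q_def by (rule integral_scaleR_right)
  have iQ: "integrable lborel (\<lambda>w. gauss n s w *\<^sub>R Q w)" if "s > 0" for s
    using lborel_pair.integrable_fst'[OF iF[OF that]] by (simp add: FQ)
  have tQ: "(LINT w|lborel. gauss n s w *\<^sub>R Q w) = (LINT t|lborel. (gscale n s * gauss n (gdual n s) t) *\<^sub>R h t)" if s: "s > 0" for s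
  proof -
    have "(LINT w|lborel. gauss n s w *\<^sub>R Q w) = (LINT w|lborel. LINT t|lborel. F s w t)"
      by (simp add: FQ)
    also have "\<dots> = (LINT t|lborel. LINT w|lborel. F s w t)"
      using lborel_pair.Fubini_integral[OF iF[OF s]] by simp
    also have "(\<lambda>t. LINT w|lborel. F s w t) = (\<lambda>t. (gscale n s * gauss n (gdual n s) t) *\<^sub>R h t)"
    proof
      fix t
      have "(LINT w|lborel. F s w t) = (LINT w|lborel. (cn n (w * t) * gauss n s w) *\<^sub>R h t)"
        by (simp add: F_def scaleR_conv_of_real mult_ac)
      also have "\<dots> = (LINT w|lborel. cn n (w * t) * gauss n s w) *\<^sub>R h t"
        using gauss_transform(2)[OF n s] by (intro integral_scaleR_left) auto
      finally show "(LINT w|lborel. F s w t) = (gscale n s * gauss n (gdual n s) t) *\<^sub>R h t"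
        unfolding gauss_transform(3)[OF n s] gscale_def gdual_def .
    qed
    finally show ?thesis .
  qed
  have Qe: "Q (- w) = Q w" for w
    unfolding Q_def by simp
  obtain f where f: "f \<in> L2" "Phi n (cls h) = cls f" by (cases "Phi n (cls h)")
  have [measurable]: "f \<in> borel_measurable borel" using f by measurable
  have rL: "real_L2 (gauss n s)" if "s > 0" for s by (rule real_L2_gauss[OF n that])
  have if': "integrable lborel (\<lambda>w. u w *\<^sub>R f w)" if "real_L2 u" for u
    using L2_mult_integrable[OF real_L2_L2[OF that] f(1)] by (simp add: scaleR_conv_of_real)
  \<comment> \<open>Self-adjointness moves the operator onto the Gaussian, which yields the value
    that \<open>tQ\<close> gives for \<open>Q\<close>. The odd test functions annihilate both
    \<open>f\<close> and \<open>Q\<close>, as \<open>h\<close> and \<open>Q\<close> are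
    even.\<close>
  have tf: "(LINT w|lborel. gauss n s w *\<^sub>R f w) = (LINT t|lborel. (gscale n s * gauss n (gdual n s) t) *\<^sub>R h t)" if s: "s > 0" for s
  proof (rule inner_cls_cmul_rcls_eq[OF f(1) rL[OF s] h real_L2_cmult[OF rL[OF gdual_pos[OF n s]]]])
    fix c
    show "inner (cls f) (cmul c (rcls (gauss n s))) = inner (cls h) (cmul c (rcls (\<lambda>t. gscale n s * gauss n (gdual n s) t)))"
      unfolding f(2)[symmetric] inner_Phi_left[OF n] gauss_cls_def[symmetric] Phi_gauss_cls[OF n s]
      unfolding gauss_cls_def scaled_gauss_cmul[OF rL[OF gdual_pos[OF n s]]] ..
  qed
  have tf': "(LINT w|lborel. (sgn w * gauss n s w) *\<^sub>R f w) = 0" if s: "s > 0" for s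
  proof -
    have "(LINT w|lborel. (sgn w * gauss n s w) *\<^sub>R f w) = (LINT t|lborel. (gscale n s * (sgn t * gauss n (gdual n s) t)) *\<^sub>R h t)"
    proof (rule inner_cls_cmul_rcls_eq[OF f(1) real_L2_sgn[OF rL[OF s]] h real_L2_cmult[OF real_L2_sgn[OF rL[OF gdual_pos[OF n s]]]]])
      fix c
      show "inner (cls f) (cmul c (rcls (\<lambda>w. sgn w * gauss n s w))) = inner (cls h) (cmul c (rcls (\<lambda>t. gscale n s * (sgn t * gauss n (gdual n s) t))))"
        unfolding f(2)[symmetric] inner_Phi_left[OF n] sgnmul_rcls[OF rL[OF s], symmetric] gauss_cls_def[symmetric] Phi_sgnmul_gauss_cls[OF n s]
        unfolding gauss_cls_def sgnmul_rcls[OF rL[OF gdual_pos[OF n s]]] scaled_gauss_cmul[OF real_L2_sgn[OF rL[OF gdual_pos[OF n s]]]] ..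
    qed
    also have "\<dots> = 0" by (rule odd_integral_zero) (simp add: even)
    finally show ?thesis .
  qed
  have "AE w in lborel. gauss n 1 w *\<^sub>R (f w - Q w) = 0"
  proof (rule AE_zero_if_gauss_orthogonal[OF n])
    show "integrable lborel (\<lambda>w. gauss n 1 w *\<^sub>R (f w - Q w))"
      using if'[OF rL[of 1]] iQ[of 1] by (simp add: scaleR_diff_right)
    fix k :: nat
    have k: "real k + 1 > 0" by simp
    have "(LINT w|lborel. gauss n (real k) w *\<^sub>R gauss n 1 w *\<^sub>R (f w - Q w)) =
      (LINT w|lborel. gauss n (real k + 1) w *\<^sub>R f w - gauss n (real k + 1) w *\<^sub>R Q w)"
      unfolding scaleR_scaleR gauss_mult scaleR_diff_right ..
    also have "\<dots> = 0"
      using Bochner_Integration.integral_diff[OF if'[OF rL[OF k]] iQ[OF k]] tf[OF k] tQ[OF k] by simp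
    finally show "(LINT w|lborel. gauss n (real k) w *\<^sub>R gauss n 1 w *\<^sub>R (f w - Q w)) = 0" .
    have s2: "integrable lborel (\<lambda>w. (sgn w * gauss n (real k + 1) w) *\<^sub>R Q w)"
      by (rule Bochner_Integration.integrable_bound[OF iQ[OF k]]) (auto simp: sgn_if)
    have "gauss n (real k) w *\<^sub>R sgn w *\<^sub>R gauss n 1 w *\<^sub>R (f w - Q w) =
      (sgn w * gauss n (real k + 1) w) *\<^sub>R f w - (sgn w * gauss n (real k + 1) w) *\<^sub>R Q w" for w
      unfolding scaleR_scaleR gauss_mult[symmetric] scaleR_diff_right by (simp only: mult_ac)
    then have "(LINT w|lborel. gauss n (real k) w *\<^sub>R sgn w *\<^sub>R gauss n 1 w *\<^sub>R (f w - Q w)) =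
      (LINT w|lborel. (sgn w * gauss n (real k + 1) w) *\<^sub>R f w - (sgn w * gauss n (real k + 1) w) *\<^sub>R Q w)" by simp
    also have "\<dots> = 0 - (LINT w|lborel. (sgn w * gauss n (real k + 1) w) *\<^sub>R Q w)"
      using Bochner_Integration.integral_diff[OF if'[OF real_L2_sgn[OF rL[OF k]]] s2] tf'[OF k] by simp
    also have "(LINT w|lborel. (sgn w * gauss n (real k + 1) w) *\<^sub>R Q w) = 0"
      by (rule odd_integral_zero) (simp add: Qe)
    finally show "(LINT w|lborel. gauss n (real k) w *\<^sub>R sgn w *\<^sub>R gauss n 1 w *\<^sub>R (f w - Q w)) = 0" by simp
  qed
  then have ae: "ae_eq f Q"
    using gauss_pos[of n 1] unfolding ae_eq_def by (auto elim!: AE_mp simp: less_le)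
  show "Q \<in> L2" by (rule L2_AE_cong[OF f(1) ae]) simp
  then show "Phi n (cls h) = cls Q" using f ae by (simp add: cls_eq_iff)
qed

section \<open>Logarithmic integrals\<close>

text \<open>The terms of the Basel sum are grouped in pairs; the even squares make up a quarter of
  it.\<close>

lemma odd_squares_sums: "(\<lambda>k. 1 / (2 * real k + 1)\<^sup>2) sums (pi\<^sup>2 / 8)"
proof -
  have a: "(\<lambda>n. 1 / (real n + 1)\<^sup>2) sums (pi\<^sup>2 / 6)"
    using inverse_squares_sums by (simp add: add.commute)
  have g: "(\<lambda>n. \<Sum>i\<in>{n * 2..<n * 2 + 2}. 1 / (real i + 1)\<^sup>2) sums (pi\<^sup>2 / 6)"
    using a by (rule sums_group) simp
  have e: "(\<Sum>i\<in>{n * 2..<n * 2 + 2}. 1 / (real i + 1)\<^sup>2) = 1 / (2 * real n + 1)\<^sup>2 + (1 / 4) * (1 / (real n + 1)\<^sup>2)" for n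
  proof -
    have "{n * 2..<n * 2 + 2} = {2 * n, 2 * n + 1}" by auto
    moreover have "(2 * real n + 2)\<^sup>2 = 4 * (real n + 1)\<^sup>2" by (simp add: power2_eq_square algebra_simps)
    ultimately show ?thesis by (simp add: algebra_simps)
  qed
  have "(\<lambda>n. 1 / (2 * real n + 1)\<^sup>2 + (1 / 4) * (1 / (real n + 1)\<^sup>2) - (1 / 4) * (1 / (real n + 1)\<^sup>2)) sums (pi\<^sup>2 / 6 - (1 / 4) * (pi\<^sup>2 / 6))"
    using g unfolding e by (intro sums_diff sums_mult a)
  then show ?thesis by simp
qed

text \<open>Up to the factor \<open>pi\<close>, the Hilbert transform of the indicator of
  \<open>{-1..1}\<close>. At \<open>1\<close> and \<open>- 1\<close> the conventions
  \<open>x / 0 = 0\<close> and \<open>ln 0 = 0\<close> give the value 0, so oddness has no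
  exceptions.\<close>

definition log_ratio :: "real \<Rightarrow> real" where
  "log_ratio t = ln \<bar>(t + 1) / (t - 1)\<bar>"

lemma log_ratio_measurable [measurable]: "log_ratio \<in> borel_measurable borel"
  unfolding log_ratio_def by measurable

lemma log_ratio_minus: "log_ratio (- t) = - log_ratio t"
proof (cases "t = 1 \<or> t = -1")
  case True then show ?thesis by (auto simp: log_ratio_def)
next
  case False
  have "(- t + 1) / (- t - 1) = (- (t - 1)) / (- (t + 1))" by simp
  also have "\<dots> = inverse ((t + 1) / (t - 1))"
    unfolding minus_divide_divide by simp
  finally have "\<bar>(- t + 1) / (- t - 1)\<bar> = inverse \<bar>(t + 1) / (t - 1)\<bar>" by (simp only: abs_inverse)
  moreover have "\<bar>(t + 1) / (t - 1)\<bar> > 0" using False by auto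
  ultimately show ?thesis unfolding log_ratio_def by (simp only: ln_inverse)
qed

lemma log_ratio_inverse:
  assumes "t \<noteq> 0"
  shows "log_ratio (1 / t) = log_ratio t"
proof -
  have "\<bar>(1 / t + 1) / (1 / t - 1)\<bar> = \<bar>(t + 1) / (t - 1)\<bar>"
  proof -
    have "(1 / t + 1) / (1 / t - 1) = (1 + t) / (1 - t)"
    proof -
      have "1 / t + 1 = (1 + t) / t" "1 / t - 1 = (1 - t) / t" using assms by (simp_all add: field_simps)
      then show ?thesis using assms by simp
    qed
    moreover have "\<bar>(1 + t) / (1 - t)\<bar> = \<bar>(t + 1) / (t - 1)\<bar>"
      by (simp add: abs_divide abs_minus_commute add.commute)
    ultimately show ?thesis by simp
  qed
  then show ?thesis by (simp add: log_ratio_def)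
qed

lemma log_ratio_series:
  assumes t: "0 < t" "t < 1"
  shows "(\<lambda>k. 2 * t ^ (2 * k) / (2 * real k + 1)) sums (log_ratio t / t)"
proof -
  define x where "x = (1 + t) / (1 - t)"
  have x: "x > 0" "(x - 1) / (x + 1) = t" using t by (auto simp: x_def field_simps)
  have "(\<lambda>n. 2 * ((x - 1) / (x + 1)) ^ (2 * n + 1) / real (2 * n + 1)) sums ln x"
    using ln_series_quadratic[OF x(1)] by simp
  then have "(\<lambda>n. 2 * t ^ (2 * n + 1) / real (2 * n + 1) * (1 / t)) sums (ln x * (1 / t))"
    unfolding x(2) by (rule sums_mult2)
  moreover have "ln x = log_ratio t"
    using t unfolding x_def log_ratio_def by (subst abs_divide) (simp add: abs_minus_commute add.commute)
  ultimately show ?thesis using t by (simp add: algebra_simps)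
qed

lemma log_ratio_pos: "0 < t \<Longrightarrow> t < 1 \<Longrightarrow> log_ratio t \<ge> 0"
  unfolding log_ratio_def by (intro ln_ge_zero) (auto simp: abs_divide field_simps)

lemma power_integral_01:
  "set_integrable lborel {0<..<1} (\<lambda>t::real. c * t ^ m)"
  "(LINT t:{0<..<1}|lborel. c * t ^ m) = c / (real m + 1)"
proof -
  have h: "((\<lambda>t::real. t ^ m) has_integral (1 / (real m + 1))) {0..1}"
  proof -
    have "((\<lambda>t. t ^ Suc m / (real m + 1)) has_real_derivative t ^ m) (at t within {0..1})" for t :: real
      using DERIV_cdivide[OF DERIV_pow[of "Suc m" t "{0..1}"], of "real m + 1"] by (simp add: add.commute)
    then have "((\<lambda>t::real. t ^ m) has_integral (1 ^ Suc m / (real m + 1) - 0 ^ Suc m / (real m + 1))) {0..1}"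
      by (intro fundamental_theorem_of_calculus) (auto simp: has_real_derivative_iff_has_vector_derivative[symmetric] simp del: power_Suc)
    then show ?thesis by simp
  qed
  then have h': "((\<lambda>t::real. t ^ m) has_integral (1 / (real m + 1))) {0<..<1}"
    by (simp add: has_integral_Icc_iff_Ioo)
  have "set_integrable lborel {0<..<1} (\<lambda>t::real. t ^ m)" "(LINT t:{0<..<1}|lborel. t ^ m) = 1 / (real m + 1)"
    by (rule has_integral_nonneg_lborel[OF h']; simp)+
  then show "set_integrable lborel {0<..<1} (\<lambda>t::real. c * t ^ m)"
    "(LINT t:{0<..<1}|lborel. c * t ^ m) = c / (real m + 1)" by simp_all
qed

text \<open>Termwise integration of \<open>log_ratio_series\<close> gives twice the sum of the
  inverse odd squares; the terms are nonnegative, so the exchange needs only its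
  convergence.\<close>

lemma log_ratio_div_integral_01:
  "set_integrable lborel {0<..<1} (\<lambda>t. log_ratio t / t)"
  "(LINT t:{0<..<1}|lborel. log_ratio t / t) = pi\<^sup>2 / 4"
proof -
  define f where "f k t = indicator {0<..<1} t *\<^sub>R (2 / (2 * real k + 1) * t ^ (2 * k))" for k :: nat and t :: real
  have s: "(\<lambda>k. f k t) sums (indicator {0<..<1} t *\<^sub>R (log_ratio t / t))" for t
    using log_ratio_series[of t] by (auto simp: f_def indicator_def mult_ac)
  have i: "integrable lborel (f k)" for k
    unfolding f_def using power_integral_01(1) by (simp add: set_integrable_def)
  have v: "integral\<^sup>L lborel (f k) = 2 * (1 / (2 * real k + 1)\<^sup>2)" for k
  proof -
    have "integral\<^sup>L lborel (f k) = (LINT t:{0<..<1}|lborel. 2 / (2 * real k + 1) * t ^ (2 * k))"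
      by (simp only: f_def[abs_def] set_lebesgue_integral_def)
    then show ?thesis unfolding power_integral_01(2) by (simp add: power2_eq_square)
  qed
  have nf: "norm (f k t) = f k t" for k t by (simp add: f_def indicator_def)
  have su: "(\<lambda>k. integral\<^sup>L lborel (f k)) sums (2 * (pi\<^sup>2 / 8))"
    unfolding v by (intro sums_mult odd_squares_sums)
  have e: "(\<Sum>k. f k t) = indicator {0<..<1} t *\<^sub>R (log_ratio t / t)" for t using s by (simp add: sums_iff)
  show "set_integrable lborel {0<..<1} (\<lambda>t. log_ratio t / t)"
    unfolding set_integrable_def e[symmetric]
    by (rule integrable_suminf) (use i s su nf in \<open>auto simp: sums_iff\<close>)
  have "(LINT t:{0<..<1}|lborel. log_ratio t / t) = (\<Sum>k. integral\<^sup>L lborel (f k))"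
    unfolding set_lebesgue_integral_def e[symmetric]
    by (rule integral_suminf) (use i s su nf in \<open>auto simp: sums_iff\<close>)
  then show "(LINT t:{0<..<1}|lborel. log_ratio t / t) = pi\<^sup>2 / 4" using su by (simp add: sums_iff)
qed

text \<open>The sign in \<open>t \<mapsto> - 1 / t\<close> makes the substitution increasing.\<close>

lemma inversion_integral:
  fixes f :: "real \<Rightarrow> real"
  assumes [measurable]: "f \<in> borel_measurable borel"
    and f0: "\<And>x. x < - 1 \<Longrightarrow> 0 \<le> f x" and cont: "\<And>x. x < -1 \<Longrightarrow> isCont f x"
    and int: "set_integrable lborel {0<..<1} (\<lambda>t. f (- 1 / t) / t\<^sup>2)"
  shows "set_integrable lborel {1<..} (\<lambda>x. f (- x))"
    "(LINT x:{1<..}|lborel. f (- x)) = (LINT t:{0<..<1}|lborel. f (- 1 / t) / t\<^sup>2)"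
proof -
  have e1: "einterval 0 1 = {0<..<1}" by (auto simp: einterval_def)
  have e2: "einterval (-\<infinity>) (- 1) = {..<- 1}" by (auto simp: einterval_def one_ereal_def)
  define g where "g t = - 1 / t" for t :: real
  have si: "set_integrable lborel (einterval 0 1) (\<lambda>t. f (g t) * (1 / t\<^sup>2))"
    using int unfolding e1 g_def by simp
  have "(g \<longlongrightarrow> -1) (at_left 1)"
    unfolding g_def by (intro tendsto_eq_intros) auto
  then have B: "((ereal \<circ> g \<circ> real_of_ereal) \<longlongrightarrow> -1) (at_left 1)"
    unfolding one_ereal_def uminus_ereal.simps ereal_tendsto_simps .
  have "filterlim g at_bot (at_right 0)"
    unfolding g_def by real_asymp
  then have A: "((ereal \<circ> g \<circ> real_of_ereal) \<longlongrightarrow> -\<infinity>) (at_right 0)"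
    unfolding zero_ereal_def ereal_tendsto_simps .
  have d: "DERIV g t :> 1 / t\<^sup>2" if "0 < ereal t" "ereal t < 1" for t
    unfolding g_def using that by (auto intro!: derivative_eq_intros simp: power2_eq_square)
  have lt: "g t < -1" if "0 < ereal t" "ereal t < 1" for t
    using that by (simp add: g_def one_ereal_def)
  have cf: "isCont f (g t)" if "0 < ereal t" "ereal t < 1" for t
    by (rule cont[OF lt[OF that]])
  have cg: "isCont (\<lambda>t. 1 / t\<^sup>2) t" if "0 < ereal t" "ereal t < 1" for t :: real
    using that by (intro continuous_intros) auto
  have fn: "0 \<le> f (g t)" if "0 < ereal t" "ereal t < 1" for t
    by (rule f0[OF lt[OF that]])
  have gn: "0 \<le> 1 / t\<^sup>2" for t :: real by simp
  note sub = interval_integral_substitution_nonneg[of 0 1 g "\<lambda>t. 1 / t\<^sup>2" f "-\<infinity>" "-1", OF _ d cf cg fn gn A B si]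
  have i: "set_integrable lborel {..<- 1} f" using sub(1) unfolding e2 by simp
  have v: "(LINT x:{..<- 1}|lborel. f x) = (LINT t:{0<..<1}|lborel. f (- 1 / t) / t\<^sup>2)"
    using sub(2) by (simp add: interval_lebesgue_integral_def e1 e2 g_def)
  have ind: "indicat_real {..<- 1} (- x) = indicat_real {1<..} x" for x :: real by (auto simp: indicator_def)
  show "set_integrable lborel {1<..} (\<lambda>x. f (- x))"
    using lborel_integrable_real_affine[OF i[unfolded set_integrable_def], of "-1" 0] by (simp add: set_integrable_def ind)
  show "(LINT x:{1<..}|lborel. f (- x)) = (LINT t:{0<..<1}|lborel. f (- 1 / t) / t\<^sup>2)"
    using lborel_integral_real_affine[of "-1" "\<lambda>x. indicat_real {..<- 1} x *\<^sub>R f x" 0] v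
    by (simp add: set_lebesgue_integral_def ind)
qed

lemma set_integral_join_at_1:
  fixes f :: "real \<Rightarrow> real"
  assumes "set_integrable lborel {0<..<1} f" "set_integrable lborel {1<..} f"
  shows "set_integrable lborel {0<..} f"
    "(LINT x:{0<..}|lborel. f x) = (LINT x:{0<..<1}|lborel. f x) + (LINT x:{1<..}|lborel. f x)"
proof -
  have u: "set_integrable lborel ({0<..<1} \<union> {1<..}) f"
    by (rule set_integrable_Un[OF assms]) auto
  have "set_integrable lborel ({0<..<1} \<union> {1<..}) f \<longleftrightarrow> set_integrable lborel {0<..} f"
    by (rule set_integrable_discrete_difference[where X = "{1}"]) auto
  with u show "set_integrable lborel {0<..} f" by simp
  have "(LINT x:{0<..}|lborel. f x) = (LINT x:{0<..<1} \<union> {1<..}|lborel. f x)"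
    by (rule set_integral_discrete_difference[where X = "{1}"]) auto
  also have "\<dots> = (LINT x:{0<..<1}|lborel. f x) + (LINT x:{1<..}|lborel. f x)"
    by (rule set_integral_Un[OF _ assms]) auto
  finally show "(LINT x:{0<..}|lborel. f x) = (LINT x:{0<..<1}|lborel. f x) + (LINT x:{1<..}|lborel. f x)" .
qed

lemma log_ratio_nonneg:
  assumes "0 < t"
  shows "log_ratio t \<ge> 0"
proof -
  consider "t < 1" | "t = 1" | "t > 1" by linarith
  then show ?thesis
  proof cases
    case 3
    then show ?thesis using log_ratio_pos[of "1 / t"] log_ratio_inverse[of t] by simp
  qed (use assms log_ratio_pos in \<open>auto simp: log_ratio_def\<close>)
qed

lemma isCont_log_ratio: "t \<noteq> 1 \<Longrightarrow> t \<noteq> -1 \<Longrightarrow> isCont log_ratio t"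
  unfolding log_ratio_def by (intro continuous_intros) (auto simp: add_eq_0_iff2)

text \<open>\<open>log_ratio\<close> and the measure \<open>dt / t\<close> are invariant under
  inversion, and the integrand is even, so the line splits into four copies of the integral over
  \<open>{0<..<1}\<close>.\<close>

lemma log_ratio_div_integral:
  "integrable lborel (\<lambda>t. log_ratio t / t)" "(LINT t|lborel. log_ratio t / t) = pi\<^sup>2"
proof -
  have e: "log_ratio (- 1 / t) / (- 1 / t) / t\<^sup>2 = log_ratio t / t" for t
    using log_ratio_minus[of "1 / t"] log_ratio_inverse[of t] by (cases "t = 0") (simp_all add: power2_eq_square)
  have m: "log_ratio (- x) / (- x) = log_ratio x / x" for x by (simp add: log_ratio_minus)
  have nn: "0 \<le> log_ratio x / x" if "x < -1" for x
    using divide_nonneg_pos[OF log_ratio_nonneg[of "- x"], of "- x"] that by (simp add: log_ratio_minus)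
  note inv = inversion_integral[of "\<lambda>x. log_ratio x / x", unfolded e m]
  have i1: "set_integrable lborel {1<..} (\<lambda>x. log_ratio x / x)" "(LINT x:{1<..}|lborel. log_ratio x / x) = pi\<^sup>2 / 4"
    using inv log_ratio_div_integral_01
    by (auto simp: nn isCont_log_ratio intro!: isCont_divide continuous_ident)
  note j = set_integral_join_at_1[OF log_ratio_div_integral_01(1) i1(1)]
  have me: "(\<lambda>x. log_ratio x / x) \<in> borel_measurable borel" by measurable
  note ev = even_integral_lborel[OF me m j(1)]
  show "integrable lborel (\<lambda>t. log_ratio t / t)" by (rule ev)
  show "(LINT t|lborel. log_ratio t / t) = pi\<^sup>2"
    unfolding ev(2) j(2) i1(2) log_ratio_div_integral_01(2) by simp
qed

lemma log_ratio_deriv: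
  assumes "0 < t" "t < 1"
  shows "(log_ratio has_real_derivative (- 2 / (t\<^sup>2 - 1))) (at t)"
proof -
  have "((\<lambda>t. ln (1 + t) - ln (1 - t)) has_real_derivative (- 2 / (t\<^sup>2 - 1))) (at t)"
    using assms mult_strict_mono[of t 1 t 1]
    by (auto intro!: derivative_eq_intros simp: divide_simps power2_eq_square) (simp add: algebra_simps)
  then show ?thesis
  proof (rule has_field_derivative_transform_within_open[of _ _ _ "{0<..<1}"])
    fix x :: real assume x: "x \<in> {0<..<1}"
    have "\<bar>(x + 1) / (x - 1)\<bar> = (1 + x) / (1 - x)"
      using x by (simp add: abs_divide)
    then show "ln (1 + x) - ln (1 - x) = log_ratio x"
      using x by (simp add: log_ratio_def ln_div)
  qed (use assms in auto)
qed

text \<open>The weight \<open>1 + 1 / t\<^sup>2\<close> accounts for \<open>{1<..}\<close> after inversion. It is the derivative of \<open>t - 1 / t\<close>, and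
  integration by parts leaves the integral of \<open>4 * log_ratio t / t\<close>.\<close>

lemma log_ratio_sq_weighted_integral_01:
  "set_integrable lborel {0<..<1} (\<lambda>t. (1 + 1 / t\<^sup>2) * (log_ratio t)\<^sup>2)"
  "(LINT t:{0<..<1}|lborel. (1 + 1 / t\<^sup>2) * (log_ratio t)\<^sup>2) = pi\<^sup>2"
proof -
  define F where "F t = (t - 1 / t) * (log_ratio t)\<^sup>2" for t
  \<comment> \<open>These values, the first by \<open>1 / 0 = 0\<close>, agree with the one-sided
    limits, so \<open>F\<close> is continuous on the closed interval as it stands.\<close>
  have F01: "F 0 = 0" "F 1 = 0" by (simp_all add: F_def)
  have eqF: "F x = (x - 1 / x) * (ln ((1 + x) / (1 - x)))\<^sup>2" if "0 < x" "x < 1" for x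
    using that by (simp add: F_def log_ratio_def abs_divide add.commute)
  have d: "(F has_real_derivative ((1 + 1 / t\<^sup>2) * (log_ratio t)\<^sup>2 - 4 * (log_ratio t / t))) (at t)" if t: "0 < t" "t < 1" for t
  proof -
    have "(F has_real_derivative ((1 + 1 / t\<^sup>2) * (log_ratio t)\<^sup>2 + (t - 1 / t) * (2 * log_ratio t * (- 2 / (t\<^sup>2 - 1))))) (at t)"
      unfolding F_def using t by (auto intro!: derivative_eq_intros log_ratio_deriv simp: power2_eq_square)
    moreover have "(t - 1 / t) * (2 * log_ratio t * (- 2 / (t\<^sup>2 - 1))) = - 4 * (log_ratio t / t)"
    proof -
      have "t\<^sup>2 < 1" using t by (simp add: power_less_one_iff)
      then have "t\<^sup>2 - 1 \<noteq> 0" by simp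
      moreover have "t - 1 / t = (t\<^sup>2 - 1) / t" using t by (simp add: field_simps power2_eq_square)
      ultimately show ?thesis by simp
    qed
    ultimately show ?thesis by simp
  qed
  have c: "continuous_on {0..1} F"
  proof (rule continuous_on_IccI)
    have "((\<lambda>x::real. (x - 1 / x) * (ln ((1 + x) / (1 - x)))\<^sup>2) \<longlongrightarrow> 0) (at_right 0)" by real_asymp
    then show "(F \<longlongrightarrow> F 0) (at_right 0)"
      unfolding F01 by (rule Lim_transform_eventually) (auto simp: eqF eventually_at_right_field intro!: exI[of _ 1])
    have "((\<lambda>x::real. (x - 1 / x) * (ln ((1 + x) / (1 - x)))\<^sup>2) \<longlongrightarrow> 0) (at_left 1)" by real_asymp
    then show "(F \<longlongrightarrow> F 1) (at_left 1)"
      unfolding F01 by (rule Lim_transform_eventually) (auto simp: eqF eventually_at_left_field intro!: exI[of _ 0])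
    show "F \<midarrow>x\<rightarrow> F x" if "0 < x" "x < 1" for x
      using DERIV_isCont[OF d[OF that]] by (simp add: isCont_def)
  qed simp
  have "((\<lambda>t. (1 + 1 / t\<^sup>2) * (log_ratio t)\<^sup>2 - 4 * (log_ratio t / t)) has_integral (F 1 - F 0)) {0..1}"
    by (rule fundamental_theorem_of_calculus_interior[OF _ c])
      (use d in \<open>auto simp: has_real_derivative_iff_has_vector_derivative[symmetric]\<close>)
  then have 1: "((\<lambda>t. (1 + 1 / t\<^sup>2) * (log_ratio t)\<^sup>2 - 4 * (log_ratio t / t)) has_integral 0) {0<..<1}"
    by (simp add: F01 has_integral_Icc_iff_Ioo)
  have 2: "((\<lambda>t. log_ratio t / t) has_integral (pi\<^sup>2 / 4)) {0<..<1}"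
    using set_borel_integral_eq_integral[OF log_ratio_div_integral_01(1)] log_ratio_div_integral_01(2) by (simp add: has_integral_iff)
  have 3: "((\<lambda>t. (1 + 1 / t\<^sup>2) * (log_ratio t)\<^sup>2) has_integral pi\<^sup>2) {0<..<1}"
    using has_integral_add[OF 1 has_integral_mult_right[OF 2, of 4]] by simp
  show "set_integrable lborel {0<..<1} (\<lambda>t. (1 + 1 / t\<^sup>2) * (log_ratio t)\<^sup>2)"
    "(LINT t:{0<..<1}|lborel. (1 + 1 / t\<^sup>2) * (log_ratio t)\<^sup>2) = pi\<^sup>2"
    by (rule has_integral_nonneg_lborel[OF 3]; simp)+
qed

text \<open>Inversion turns the part over \<open>{1<..}\<close> into the term with
  \<open>1 / t\<^sup>2\<close> of the weighted integral, and evenness doubles the result. The value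
  is \<open>pi\<^sup>2\<close> times the length of \<open>{-1..1}\<close>, as the isometry
  demands.\<close>

lemma log_ratio_sq_integral:
  "integrable lborel (\<lambda>t. (log_ratio t)\<^sup>2)" "(LINT t|lborel. (log_ratio t)\<^sup>2) = 2 * pi\<^sup>2"
proof -
  have bnd: "set_integrable lborel {0<..<1} f" if "\<And>t. 0 \<le> f t" "\<And>t. f t \<le> (1 + 1 / t\<^sup>2) * (log_ratio t)\<^sup>2"
    and [measurable]: "f \<in> borel_measurable borel" for f :: "real \<Rightarrow> real"
  proof (rule set_integrable_bound[OF log_ratio_sq_weighted_integral_01(1)])
    show "set_borel_measurable lborel {0<..<1} f" by (simp add: set_borel_measurable_def)
    show "AE x in lborel. x \<in> {0<..<1} \<longrightarrow> norm (f x) \<le> norm ((1 + 1 / x\<^sup>2) * (log_ratio x)\<^sup>2)"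
      using that(1,2) by (intro AE_I2 impI) (simp add: order_trans[OF _ abs_ge_self])
  qed
  have i0: "set_integrable lborel {0<..<1} (\<lambda>t. (log_ratio t)\<^sup>2)"
    by (rule bnd) (auto simp: distrib_right)
  have i1: "set_integrable lborel {0<..<1} (\<lambda>t. (log_ratio t)\<^sup>2 / t\<^sup>2)"
    by (rule bnd) (auto simp: distrib_right)
  have e: "(log_ratio (- 1 / t))\<^sup>2 / t\<^sup>2 = (log_ratio t)\<^sup>2 / t\<^sup>2" for t
    using log_ratio_minus[of "1 / t"] log_ratio_inverse[of t] by (cases "t = 0") simp_all
  have m: "(log_ratio (- x))\<^sup>2 = (log_ratio x)\<^sup>2" for x by (simp add: log_ratio_minus)
  have ic: "isCont (\<lambda>x. (log_ratio x)\<^sup>2) x" if "x < -1" for x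
    using that isCont_log_ratio[of x] by (intro continuous_intros) auto
  note inv = inversion_integral[of "\<lambda>x. (log_ratio x)\<^sup>2", unfolded e m]
  have i2: "set_integrable lborel {1<..} (\<lambda>x. (log_ratio x)\<^sup>2)"
    "(LINT x:{1<..}|lborel. (log_ratio x)\<^sup>2) = (LINT t:{0<..<1}|lborel. (log_ratio t)\<^sup>2 / t\<^sup>2)"
    using inv i1 ic by auto
  note j = set_integral_join_at_1[OF i0 i2(1)]
  have me: "(\<lambda>x. (log_ratio x)\<^sup>2) \<in> borel_measurable borel" by measurable
  note ev = even_integral_lborel[OF me m j(1)]
  show "integrable lborel (\<lambda>t. (log_ratio t)\<^sup>2)" by (rule ev)
  have "pi\<^sup>2 = (LINT t:{0<..<1}|lborel. (log_ratio t)\<^sup>2 + (log_ratio t)\<^sup>2 / t\<^sup>2)"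
    unfolding log_ratio_sq_weighted_integral_01(2)[symmetric] by (simp add: distrib_right)
  also have "\<dots> = (LINT t:{0<..<1}|lborel. (log_ratio t)\<^sup>2) + (LINT t:{0<..<1}|lborel. (log_ratio t)\<^sup>2 / t\<^sup>2)"
    by (rule set_integral_add(2)[OF i0 i1])
  finally show "(LINT t|lborel. (log_ratio t)\<^sup>2) = 2 * pi\<^sup>2"
    unfolding ev(2) j(2) i2(2) by simp
qed

section \<open>The Hilbert transform on square integrable functions\<close>

definition logd :: "real \<Rightarrow> real \<Rightarrow> real \<Rightarrow> real" where
  "logd a b x = ln \<bar>(x - a) / (x - b)\<bar>"

lemma logd_measurable [measurable]: "logd a b \<in> borel_measurable borel"
  unfolding logd_def by measurable

lemma logd_diff: "x \<noteq> a \<Longrightarrow> x \<noteq> b \<Longrightarrow> logd a b x = ln \<bar>x - a\<bar> - ln \<bar>x - b\<bar>"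
  unfolding logd_def abs_divide by (subst ln_div) auto

lemma logd_same: "logd a a x = 0"
  by (cases "x = a") (auto simp: logd_def)

lemma logd_swap: "logd b a x = - logd a b x"
proof (cases "x = a \<or> x = b")
  case True then show ?thesis by (auto simp: logd_def)
next
  case False then show ?thesis by (simp add: logd_diff)
qed

lemma logd_minus: "logd a b (- x) = - logd (- b) (- a) x"
proof -
  have "logd a b (- x) = logd (- a) (- b) x"
  proof -
    have "(- x - a) / (- x - b) = (- (x - - a)) / (- (x - - b))" by simp
    also have "\<dots> = (x - - a) / (x - - b)" by (rule minus_divide_divide)
    finally show ?thesis by (simp add: logd_def)
  qed
  then show ?thesis by (simp add: logd_swap[of "- b"])
qed

text \<open>The argument on the right is the affine map taking \<open>a\<close> to
  \<open>- 1\<close> and \<open>b\<close> to \<open>1\<close>.\<close>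

lemma logd_log_ratio:
  assumes "a \<noteq> b"
  shows "logd a b x = log_ratio (- (a + b) / (b - a) + 2 / (b - a) * x)"
proof -
  define t where "t = - (a + b) / (b - a) + 2 / (b - a) * x"
  define q where "q = b - a"
  have q: "q \<noteq> 0" "b = a + q" using assms by (simp_all add: q_def)
  have "t + 1 = 2 / q * (x - a)" "t - 1 = 2 / q * (x - b)"
    using q(1) by (simp_all add: t_def q(2) field_simps)
  then have "(t + 1) / (t - 1) = (2 / q * (x - a)) / (2 / q * (x - b))" by (simp only:)
  also have "\<dots> = (x - a) / (x - b)"
    using q(1) by (intro mult_divide_mult_cancel_left) simp
  finally have "(t + 1) / (t - 1) = (x - a) / (x - b)" .
  then show ?thesis by (simp add: logd_def log_ratio_def t_def)
qed

text \<open>No order of \<open>a\<close> and \<open>b\<close> is assumed, because the polarization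
  in \<open>logd_mult_integral\<close> pairs endpoints of different intervals in any order.\<close>

lemma logd_sq_integral:
  "integrable lborel (\<lambda>x. (logd a b x)\<^sup>2)" "(LINT x|lborel. (logd a b x)\<^sup>2) = pi\<^sup>2 * \<bar>b - a\<bar>"
proof -
  have "integrable lborel (\<lambda>x. (logd a b x)\<^sup>2) \<and> (LINT x|lborel. (logd a b x)\<^sup>2) = pi\<^sup>2 * \<bar>b - a\<bar>"
  proof (cases "a = b")
    case True
    then show ?thesis by (simp add: logd_same)
  next
    case False
    define c where "c = 2 / (b - a)"
    define s where "s = - (a + b) / (b - a)"
    have c: "c \<noteq> 0" using False by (simp add: c_def)
    have eq: "(logd a b x)\<^sup>2 = (log_ratio (s + c * x))\<^sup>2" for x
      unfolding logd_log_ratio[OF False] c_def s_def ..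
    have i: "integrable lborel (\<lambda>x. (log_ratio (s + c * x))\<^sup>2)"
      using lborel_integrable_real_affine[OF log_ratio_sq_integral(1) c, of s] .
    have "2 * pi\<^sup>2 = \<bar>c\<bar> * (LINT x|lborel. (log_ratio (s + c * x))\<^sup>2)"
      using lborel_integral_real_affine[OF c, of "\<lambda>x. (log_ratio x)\<^sup>2" s] log_ratio_sq_integral(2) by simp
    then have "(LINT x|lborel. (log_ratio (s + c * x))\<^sup>2) = 2 * pi\<^sup>2 / \<bar>c\<bar>" using c by (simp add: field_simps)
    also have "\<dots> = pi\<^sup>2 * \<bar>b - a\<bar>" using False by (simp add: c_def)
    finally show ?thesis using i by (simp add: eq)
  qed
  then show "integrable lborel (\<lambda>x. (logd a b x)\<^sup>2)" "(LINT x|lborel. (logd a b x)\<^sup>2) = pi\<^sup>2 * \<bar>b - a\<bar>" by auto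
qed

text \<open>With \<open>A, B, C, D\<close> the logarithms of the distances to \<open>a, b, c, d\<close>, this integrates
  \<open>2 * (A - B) * (C - D) = (A - D)\<^sup>2 + (B - C)\<^sup>2 - (A - C)\<^sup>2 - (B - D)\<^sup>2\<close>.\<close>

lemma logd_mult_integral:
  "(LINT x|lborel. logd a b x * logd c d x) = pi\<^sup>2 / 2 * (\<bar>d - a\<bar> + \<bar>c - b\<bar> - \<bar>c - a\<bar> - \<bar>d - b\<bar>)"
proof -
  note i = logd_sq_integral(1)
  have "(LINT x|lborel. logd a b x * logd c d x) =
    (LINT x|lborel. ((logd a d x)\<^sup>2 + (logd b c x)\<^sup>2 - (logd a c x)\<^sup>2 - (logd b d x)\<^sup>2) / 2)"
  proof (rule integral_discrete_difference[where X = "{a, b, c, d}"])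
    fix x assume "x \<notin> {a, b, c, d}"
    then show "logd a b x * logd c d x = ((logd a d x)\<^sup>2 + (logd b c x)\<^sup>2 - (logd a c x)\<^sup>2 - (logd b d x)\<^sup>2) / 2"
      by (simp add: logd_diff power2_eq_square algebra_simps)
  qed auto
  also have "\<dots> = pi\<^sup>2 / 2 * (\<bar>d - a\<bar> + \<bar>c - b\<bar> - \<bar>c - a\<bar> - \<bar>d - b\<bar>)"
    using i by (simp add: logd_sq_integral(2) add_divide_distrib diff_divide_distrib algebra_simps)
  finally show ?thesis .
qed

text \<open>The length of the overlap is written in the form that \<open>logd_mult_integral\<close>
  produces, so that the Gram matrices of intervals and of their transforms can be compared
  directly.\<close>

lemma indicator_mult_integral:
  fixes a b c d :: real
  assumes "a \<le> b" "c \<le> d"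
  shows "(LINT x|lborel. indicat_real {a..b} x * indicat_real {c..d} x) = (\<bar>d - a\<bar> + \<bar>c - b\<bar> - \<bar>c - a\<bar> - \<bar>d - b\<bar>) / 2"
proof -
  have "(LINT x|lborel. indicat_real {a..b} x * indicat_real {c..d} x) = (LINT x|lborel. indicat_real {max a c..min b d} x)"
    by (intro Bochner_Integration.integral_cong) (auto simp: indicator_def)
  also have "\<dots> = max 0 (min b d - max a c)"
    by (cases "max a c \<le> min b d") auto
  also have "\<dots> = (\<bar>d - a\<bar> + \<bar>c - b\<bar> - \<bar>c - a\<bar> - \<bar>d - b\<bar>) / 2"
    using assms by (auto simp: max_def min_def abs_if)
  finally show ?thesis .
qed

text \<open>The Hilbert transform of the indicator of \<open>{a..b}\<close> away from the endpoints,
  as \<open>has_pv_indicator\<close> shows.\<close>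

definition hlog :: "real \<Rightarrow> real \<Rightarrow> real \<Rightarrow> real" where
  "hlog a b x = logd a b x / pi"

lemma real_L2_hlog: "real_L2 (hlog a b)"
proof -
  have "(\<lambda>x. (hlog a b x)\<^sup>2) = (\<lambda>x. (logd a b x)\<^sup>2 / pi\<^sup>2)"
    by (simp add: hlog_def power_divide)
  then show ?thesis
    using logd_sq_integral(1) by (simp add: real_L2_def hlog_def[abs_def])
qed

definition interval_cls :: "real \<Rightarrow> real \<Rightarrow> l2" where
  "interval_cls a b = rcls (indicator {a..b})"

definition hlog_cls :: "real \<Rightarrow> real \<Rightarrow> l2" where
  "hlog_cls a b = rcls (hlog a b)"

lemma inner_hlog_cls:
  assumes "a \<le> b" "e \<le> f"
  shows "inner (cmul c (hlog_cls a b)) (cmul d (hlog_cls e f)) = inner (cmul c (interval_cls a b)) (cmul d (interval_cls e f))"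
proof -
  have "(LINT x|lborel. hlog a b x * hlog e f x) = (LINT x|lborel. logd a b x * logd e f x) / pi\<^sup>2"
    by (simp add: hlog_def power2_eq_square)
  also have "\<dots> = (LINT x|lborel. indicat_real {a..b} x * indicat_real {e..f} x)"
    unfolding indicator_mult_integral[OF assms] logd_mult_integral by simp
  finally show ?thesis
    unfolding hlog_cls_def interval_cls_def inner_cmul_rcls[OF real_L2_hlog real_L2_hlog]
      inner_cmul_rcls[OF real_L2_indicator_interval real_L2_indicator_interval] by simp
qed

lemma rcls_diff: "real_L2 u \<Longrightarrow> real_L2 v \<Longrightarrow> rcls u - rcls v = rcls (\<lambda>x. u x - v x)"
  by (simp add: rcls_def cls_diff real_L2_L2)

lemma sgnmul_symbox:
  assumes "a > 0"
  shows "sgnmul (symbox a) = interval_cls 0 a - interval_cls (- a) 0"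
proof -
  note r = real_L2_indicator_interval
  have "sgnmul (symbox a) = rcls (\<lambda>x. sgn x * indicator {-a..a} x)"
    by (simp add: symbox_def sgnmul_rcls r)
  \<comment> \<open>Both closed intervals contain 0, so their indicators cancel there, in accordance
    with \<open>sgn 0 = 0\<close>, and the functions agree everywhere.\<close>
  also have "\<dots> = rcls (\<lambda>x. indicator {0..a} x - indicator {-a..0} x)"
  proof -
    have "(\<lambda>x. complex_of_real (sgn x * indicator {-a..a} x)) = (\<lambda>x. complex_of_real (indicator {0..a} x - indicator {-a..0} x))"
      using assms by (intro ext) (auto simp: indicator_def sgn_if)
    then show ?thesis by (simp add: rcls_def)
  qed
  also have "\<dots> = interval_cls 0 a - interval_cls (- a) 0"
    by (simp add: interval_cls_def rcls_diff r)
  finally show ?thesis .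
qed

lemma cmul_diff: "cmul c (x - y) = cmul c x - cmul c y"
  using bounded_linear_cmul[of c] by (simp add: linear_diff bounded_linear.linear)

lemma total_intervals: "total_family {cmul c (interval_cls a b) |c a b. a \<le> b}"
  unfolding total_family_def
proof (intro allI impI)
  fix x :: l2 assume *: "\<forall>s\<in>{cmul c (interval_cls a b) |c a b. a \<le> b}. inner x s = 0"
  have 1: "inner x (cmul c (interval_cls a b)) = 0" if "a \<le> b" for c a b
    using * that by blast
  have "inner x (cmul c (symbox a)) = 0" "inner x (cmul c (sgnmul (symbox a))) = 0" if "a > 0" for c a
    using that 1[of "-a" a c] 1[of 0 a c] 1[of "-a" 0 c]
    by (simp_all add: symbox_def interval_cls_def[symmetric] sgnmul_symbox[unfolded symbox_def interval_cls_def[symmetric]] cmul_diff inner_diff_right)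
  then show "x = 0" using total_symbox unfolding total_family_def by blast
qed

lemma isCont_xln: "isCont (\<lambda>x::real. x * ln \<bar>x\<bar> - x) z"
proof (cases "z = 0")
  case False
  then show ?thesis by (intro continuous_intros) auto
next
  case True
  have "((\<lambda>x::real. x * ln \<bar>x\<bar>) \<longlongrightarrow> 0) (at_right 0)" by real_asymp
  moreover have "((\<lambda>x::real. x * ln \<bar>x\<bar>) \<longlongrightarrow> 0) (at_left 0)" by real_asymp
  ultimately have "((\<lambda>x::real. x * ln \<bar>x\<bar>) \<longlongrightarrow> 0) (at 0)" by (simp add: filterlim_split_at)
  from tendsto_diff[OF this tendsto_ident_at] show ?thesis
    by (simp add: True isCont_def)
qed

text \<open>\<open>L\<close> is an antiderivative of \<open>ln \<bar>x\<bar>\<close> that stays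
  continuous at 0, so the fundamental theorem applies across the singularities, with
  \<open>{a, b}\<close> as exceptional set.\<close>

lemma logd_integral:
  assumes "e \<le> f"
  defines "L \<equiv> \<lambda>x. x * ln \<bar>x\<bar> - x"
  shows "(LINT x|lborel. logd a b x * indicator {e..f} x) = L (f - a) - L (f - b) - (L (e - a) - L (e - b))"
proof -
  have d: "(L has_real_derivative ln \<bar>x\<bar>) (at x)" if "x \<noteq> 0" for x
  proof (cases "x > 0")
    case True
    have "((\<lambda>x. x * ln x - x) has_real_derivative ln x) (at x)"
      using True by (auto intro!: derivative_eq_intros)
    then have "(L has_real_derivative ln x) (at x)"
      by (rule has_field_derivative_transform_within_open[of _ _ _ "{0<..}"]) (use True in \<open>auto simp: L_def\<close>)
    then show ?thesis using True by simp
  next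
    case False
    then have n: "x < 0" using that by simp
    have "((\<lambda>x. x * ln (- x) - x) has_real_derivative ln (- x)) (at x)"
      using n by (auto intro!: derivative_eq_intros)
    then have "(L has_real_derivative ln (- x)) (at x)"
      by (rule has_field_derivative_transform_within_open[of _ _ _ "{..<0}"]) (use n in \<open>auto simp: L_def\<close>)
    then show ?thesis using n by simp
  qed
  have dd: "((\<lambda>x. L (x - a) - L (x - b)) has_real_derivative logd a b x) (at x)" if "x \<noteq> a" "x \<noteq> b" for x
  proof -
    have "((\<lambda>x. L (x - p)) has_real_derivative ln \<bar>x - p\<bar>) (at x)" if "x \<noteq> p" for p
    proof -
      have "((\<lambda>x. x - p) has_real_derivative 1) (at x)" by (auto intro!: derivative_eq_intros)
      then show ?thesis
        using DERIV_chain2[of L "ln \<bar>x - p\<bar>" "\<lambda>x. x - p" x 1 UNIV, OF d] that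
        by simp
    qed
    from DERIV_diff[OF this this] that show ?thesis by (simp add: logd_diff)
  qed
  have c: "continuous_on {e..f} (\<lambda>x. L (x - a) - L (x - b))"
    unfolding L_def using isCont_xln
    by (intro continuous_at_imp_continuous_on ballI continuous_diff isCont_o2[OF _ isCont_xln]) (auto intro!: continuous_intros)
  have "(logd a b has_integral ((L (f - a) - L (f - b)) - (L (e - a) - L (e - b)))) {e..f}"
    by (rule fundamental_theorem_of_calculus_interior_strong[of "{a, b}", OF _ assms(1) _ c])
      (use dd in \<open>auto simp: has_real_derivative_iff_has_vector_derivative[symmetric]\<close>)
  moreover have "set_integrable lborel {e..f} (logd a b)"
  proof -
    have "integrable lborel (\<lambda>x. Re (complex_of_real (indicator {e..f} x) * complex_of_real (hlog a b x)))"
      by (intro integrable_Re L2_mult_integrable real_L2_L2 real_L2_indicator_interval real_L2_hlog)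
    then have "integrable lborel (\<lambda>x. pi * (indicator {e..f} x * hlog a b x))" by simp
    then show ?thesis by (simp add: set_integrable_def hlog_def)
  qed
  ultimately have "(LINT x:{e..f}|lborel. logd a b x) = (L (f - a) - L (f - b)) - (L (e - a) - L (e - b))"
    using set_borel_integral_eq_integral(2) by (metis integral_unique)
  then show ?thesis by (simp add: set_lebesgue_integral_def mult.commute)
qed

text \<open>Both pairings are the same four-term expression in \<open>L\<close>, at arguments of
  opposite sign, and \<open>L\<close> is odd. This is the skew-adjointness on generators.\<close>

lemma inner_hlog_cls_interval_cls:
  assumes "a \<le> b" "e \<le> f"
  shows "inner (cmul c (hlog_cls a b)) (cmul d (interval_cls e f)) = - inner (cmul c (interval_cls a b)) (cmul d (hlog_cls e f))"
proof -
  define L where "L = (\<lambda>x::real. x * ln \<bar>x\<bar> - x)"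
  have odd: "L (- x) = - L x" for x by (simp add: L_def)
  have 1: "(LINT x|lborel. hlog a b x * indicator {e..f} x) = (L (f - a) - L (f - b) - (L (e - a) - L (e - b))) / pi"
    using logd_integral[OF assms(2), of a b] by (simp add: hlog_def L_def)
  have 2: "(LINT x|lborel. indicator {a..b} x * hlog e f x) = (L (b - e) - L (b - f) - (L (a - e) - L (a - f))) / pi"
    using logd_integral[OF assms(1), of e f] by (simp add: hlog_def L_def mult.commute)
  have "(LINT x|lborel. hlog a b x * indicator {e..f} x) = - (LINT x|lborel. indicator {a..b} x * hlog e f x)"
    unfolding 1 2 using odd[of "f - a"] odd[of "f - b"] odd[of "e - a"] odd[of "e - b"]
    by (simp add: minus_divide_left)
  then show ?thesis
    unfolding hlog_cls_def interval_cls_def inner_cmul_rcls[OF real_L2_hlog real_L2_indicator_interval]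
      inner_cmul_rcls[OF real_L2_indicator_interval real_L2_hlog] by simp
qed

section \<open>The Hilbert transform as a skew-adjoint isometry\<close>

lemma Hilbert_op_exists:
  "\<exists>T. bounded_linear T \<and> (\<forall>x y. inner (T x) (T y) = inner x y) \<and>
    (\<forall>c a b. a \<le> b \<longrightarrow> T (cmul c (interval_cls a b)) = cmul c (hlog_cls a b))"
proof -
  \<comment> \<open>The endpoint \<open>a + \<bar>r\<bar>\<close> builds the order of the endpoints
    into the index.\<close>
  define u where "u = (\<lambda>(c, a, r). cmul c (interval_cls a (a + \<bar>r\<bar>)))"
  define v where "v = (\<lambda>(c, a, r). cmul c (hlog_cls a (a + \<bar>r\<bar>)))"
  have u: "cmul c (interval_cls a b) = u (c, a, b - a)" "cmul c (hlog_cls a b) = v (c, a, b - a)" if "a \<le> b" for c a b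
    using that by (simp_all add: u_def v_def)
  have "{cmul c (interval_cls a b) |c a b. a \<le> b} \<subseteq> range u" using u by auto
  then have tot: "total_family (range u)"
    using total_intervals unfolding total_family_def by blast
  have gram: "inner (u i) (u j) = inner (v i) (v j)" for i j
    by (cases i; cases j) (simp add: u_def v_def inner_hlog_cls)
  obtain T where T: "bounded_linear T" "\<And>i. T (u i) = v i" "\<And>x y. inner (T x) (T y) = inner x y"
    using isometry_extension[of u v] tot gram by metis
  then show ?thesis using u by (intro exI[of _ T]) auto
qed

definition Hilbert_op :: "l2 \<Rightarrow> l2" where
  "Hilbert_op = (SOME T. bounded_linear T \<and> (\<forall>x y. inner (T x) (T y) = inner x y) \<and>
    (\<forall>c a b. a \<le> b \<longrightarrow> T (cmul c (interval_cls a b)) = cmul c (hlog_cls a b)))"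

lemma bounded_linear_Hilbert_op: "bounded_linear Hilbert_op"
  and inner_Hilbert_op: "inner (Hilbert_op x) (Hilbert_op y) = inner x y"
  and Hilbert_op_interval_cls: "a \<le> b \<Longrightarrow> Hilbert_op (cmul c (interval_cls a b)) = cmul c (hlog_cls a b)"
  using someI_ex[OF Hilbert_op_exists] unfolding Hilbert_op_def[symmetric] by blast+

lemmas linear_Hilbert_op = bounded_linear.linear[OF bounded_linear_Hilbert_op]

lemma interval_eqI:
  fixes f :: "l2 \<Rightarrow> 'b::real_normed_vector"
  assumes "bounded_linear f" "bounded_linear g"
    and "\<And>c a b. a \<le> b \<Longrightarrow> f (cmul c (interval_cls a b)) = g (cmul c (interval_cls a b))"
  shows "f x = g x"
  by (rule total_eqI[OF total_intervals assms(1,2)]) (use assms(3) in auto)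

lemma Hilbert_op_skew: "inner (Hilbert_op x) y = - inner x (Hilbert_op y)"
proof (rule interval_eqI[where f = "\<lambda>x. inner (Hilbert_op x) y" and g = "\<lambda>x. - inner x (Hilbert_op y)"])
  show "bounded_linear (\<lambda>x. inner (Hilbert_op x) y)" "bounded_linear (\<lambda>x. - inner x (Hilbert_op y))"
    by (intro bounded_linear_minus bounded_linear_inner_left bounded_linear_compose[OF bounded_linear_inner_left bounded_linear_Hilbert_op])+
  fix c and a b :: real assume ab: "a \<le> b"
  show "inner (Hilbert_op (cmul c (interval_cls a b))) y = - inner (cmul c (interval_cls a b)) (Hilbert_op y)"
  proof (rule interval_eqI[where f = "\<lambda>y. inner (Hilbert_op (cmul c (interval_cls a b))) y" and g = "\<lambda>y. - inner (cmul c (interval_cls a b)) (Hilbert_op y)"])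
    show "bounded_linear (\<lambda>y. inner (Hilbert_op (cmul c (interval_cls a b))) y)" "bounded_linear (\<lambda>y. - inner (cmul c (interval_cls a b)) (Hilbert_op y))"
      by (intro bounded_linear_minus bounded_linear_inner_right bounded_linear_compose[OF bounded_linear_inner_right bounded_linear_Hilbert_op])+
  qed (simp add: Hilbert_op_interval_cls ab inner_hlog_cls_interval_cls)
qed

text \<open>Skew-adjointness and isometry together give
  \<open>inner (Hilbert_op (Hilbert_op x)) y = - inner x y\<close> for every \<open>y\<close>;
  surjectivity is not involved.\<close>

lemma Hilbert_op_Hilbert_op: "Hilbert_op (Hilbert_op x) = - x"
proof -
  have "inner (Hilbert_op (Hilbert_op x) + x) y = 0" for y
    using Hilbert_op_skew[of "Hilbert_op x" y] inner_Hilbert_op[of x y] by (simp add: inner_add_left)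
  from this[of "Hilbert_op (Hilbert_op x) + x"] show ?thesis by (simp add: add_eq_0_iff2)
qed

lemma Hilbert_op_cmul: "Hilbert_op (cmul d x) = cmul d (Hilbert_op x)"
proof (rule interval_eqI[where f = "\<lambda>x. Hilbert_op (cmul d x)" and g = "\<lambda>x. cmul d (Hilbert_op x)"])
  show "bounded_linear (\<lambda>x. Hilbert_op (cmul d x))" "bounded_linear (\<lambda>x. cmul d (Hilbert_op x))"
    by (intro bounded_linear_compose[OF bounded_linear_Hilbert_op] bounded_linear_compose[OF bounded_linear_cmul]
        bounded_linear_Hilbert_op bounded_linear_cmul)+
qed (simp add: cmul_cmul Hilbert_op_interval_cls)

lemma reflect_interval_cls: "reflect (interval_cls a b) = interval_cls (- b) (- a)"
proof -
  have "indicat_real {a..b} (- x) = indicator {-b..-a} x" for x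
    by (auto simp: indicator_def)
  then show ?thesis by (simp add: interval_cls_def rcls_def reflect_cls real_L2_L2 real_L2_indicator_interval)
qed

lemma reflect_hlog_cls: "reflect (hlog_cls a b) = - hlog_cls (- b) (- a)"
proof -
  have "hlog a b (- x) = - hlog (- b) (- a) x" for x by (simp add: hlog_def logd_minus[of a b])
  then show ?thesis by (simp add: hlog_cls_def rcls_def reflect_cls real_L2_L2 real_L2_hlog cls_minus)
qed

lemma Hilbert_op_reflect: "Hilbert_op (reflect x) = - reflect (Hilbert_op x)"
proof (rule interval_eqI[where f = "\<lambda>x. Hilbert_op (reflect x)" and g = "\<lambda>x. - reflect (Hilbert_op x)"])
  show "bounded_linear (\<lambda>x. Hilbert_op (reflect x))" "bounded_linear (\<lambda>x. - reflect (Hilbert_op x))"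
    by (intro bounded_linear_minus bounded_linear_compose[OF bounded_linear_Hilbert_op] bounded_linear_compose[OF bounded_linear_reflect]
        bounded_linear_Hilbert_op bounded_linear_reflect)+
qed (simp add: reflect_cmul reflect_interval_cls Hilbert_op_interval_cls reflect_hlog_cls cmul_cmul flip: cmul_minus1)

section \<open>Principal values\<close>

definition pv_kernel :: "(real \<Rightarrow> complex) \<Rightarrow> real \<Rightarrow> real \<Rightarrow> real \<Rightarrow> complex" where
  "pv_kernel f x \<epsilon> t = indicator {t. \<epsilon> < \<bar>x - t\<bar>} t * (f t / complex_of_real (x - t))"

text \<open>\<open>hilbert\<close> is a \<open>Lim\<close> of possibly meaningless integrals.
  Demanding integrability of the truncations and actual convergence makes the notion additive and
  determines \<open>hilbert\<close>.\<close>

definition has_pv :: "(real \<Rightarrow> complex) \<Rightarrow> real \<Rightarrow> complex \<Rightarrow> bool" where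
  "has_pv f x L \<longleftrightarrow> (\<forall>\<epsilon>>0. integrable lborel (pv_kernel f x \<epsilon>)) \<and>
    ((\<lambda>\<epsilon>. complex_of_real (1 / pi) * integral\<^sup>L lborel (pv_kernel f x \<epsilon>)) \<longlongrightarrow> L) (at_right 0)"

lemma hilbert_eq: "has_pv f x L \<Longrightarrow> hilbert f x = L"
  unfolding has_pv_def hilbert_def pv_kernel_def[abs_def] by (intro tendsto_Lim) auto

lemma has_pv_cmult:
  assumes "has_pv f x L"
  shows "has_pv (\<lambda>t. c * f t) x (c * L)"
proof -
  have e: "pv_kernel (\<lambda>t. c * f t) x \<epsilon> = (\<lambda>t. c * pv_kernel f x \<epsilon> t)" for \<epsilon>
    by (simp add: pv_kernel_def fun_eq_iff)
  have "((\<lambda>\<epsilon>. c * (complex_of_real (1 / pi) * integral\<^sup>L lborel (pv_kernel f x \<epsilon>))) \<longlongrightarrow> c * L) (at_right 0)"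
    using assms unfolding has_pv_def by (intro tendsto_mult_left) auto
  then show ?thesis
    using assms unfolding has_pv_def e integral_mult_right_zero
    by (intro conjI allI impI integrable_mult_right) (auto simp only: mult.left_commute[of c])
qed

lemma has_pv_zero: "has_pv (\<lambda>t. 0) x 0"
  by (simp add: has_pv_def pv_kernel_def[abs_def])

lemma has_pv_add:
  assumes "has_pv f x L" "has_pv g x M"
  shows "has_pv (\<lambda>t. f t + g t) x (L + M)"
proof -
  have e: "pv_kernel (\<lambda>t. f t + g t) x \<epsilon> = (\<lambda>t. pv_kernel f x \<epsilon> t + pv_kernel g x \<epsilon> t)" for \<epsilon>
    by (simp add: pv_kernel_def fun_eq_iff add_divide_distrib distrib_left)
  have "((\<lambda>\<epsilon>. complex_of_real (1 / pi) * integral\<^sup>L lborel (pv_kernel f x \<epsilon>) +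
      complex_of_real (1 / pi) * integral\<^sup>L lborel (pv_kernel g x \<epsilon>)) \<longlongrightarrow> L + M) (at_right 0)"
    using assms unfolding has_pv_def by (intro tendsto_add) auto
  then have "((\<lambda>\<epsilon>. complex_of_real (1 / pi) * (LINT t|lborel. pv_kernel f x \<epsilon> t + pv_kernel g x \<epsilon> t)) \<longlongrightarrow> L + M) (at_right 0)"
    by (rule Lim_transform_eventually, use eventually_at_right_less[of 0] in eventually_elim)
      (use assms in \<open>simp add: has_pv_def distrib_left add_divide_distrib\<close>)
  then show ?thesis
    using assms unfolding has_pv_def e by auto
qed

lemma has_pv_sum:
  assumes "finite I" "\<And>i. i \<in> I \<Longrightarrow> has_pv (f i) x (L i)"
  shows "has_pv (\<lambda>t. \<Sum>i\<in>I. f i t) x (\<Sum>i\<in>I. L i)"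
  using assms by (induction I rule: finite_induct) (auto intro: has_pv_add has_pv_zero)

text \<open>Needed for the iterated transform: \<open>hilbert h\<close> is known only off the
  endpoints of the steps.\<close>

lemma has_pv_cong:
  assumes "has_pv f x L" and X: "countable X" "\<And>t. t \<notin> X \<Longrightarrow> f t = g t"
  shows "has_pv g x L"
proof -
  have "integrable lborel (pv_kernel f x \<epsilon>) \<longleftrightarrow> integrable lborel (pv_kernel g x \<epsilon>)"
    "integral\<^sup>L lborel (pv_kernel f x \<epsilon>) = integral\<^sup>L lborel (pv_kernel g x \<epsilon>)" for \<epsilon>
    by (rule integrable_discrete_difference[OF X(1)] integral_discrete_difference[OF X(1)]; use X(2) in \<open>auto simp: pv_kernel_def\<close>)+
  then show ?thesis using assms(1) unfolding has_pv_def by auto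
qed

lemma has_pv_of_real:
  assumes int: "\<And>\<epsilon>. \<epsilon> > 0 \<Longrightarrow> integrable lborel (\<lambda>t. indicator {t. \<epsilon> < \<bar>x - t\<bar>} t * (f t / (x - t)))"
    and lim: "((\<lambda>\<epsilon>. (LINT t|lborel. indicator {t. \<epsilon> < \<bar>x - t\<bar>} t * (f t / (x - t))) / pi) \<longlongrightarrow> L) (at_right 0)"
  shows "has_pv (\<lambda>t. complex_of_real (f t)) x (complex_of_real L)"
proof -
  have e: "pv_kernel (\<lambda>t. complex_of_real (f t)) x \<epsilon> =
    (\<lambda>t. complex_of_real (indicator {t. \<epsilon> < \<bar>x - t\<bar>} t * (f t / (x - t))))" for \<epsilon>
    by (simp add: pv_kernel_def indicator_def fun_eq_iff)
  show ?thesis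
    unfolding has_pv_def e integral_complex_of_real
    using tendsto_of_real[OF lim, where 'a = complex] int
    by (intro conjI allI impI integrable_of_real) simp_all
qed

lemma kernel_integral_outside:
  fixes p q x :: real
  assumes "p \<le> q" "x < p \<or> q < x"
  shows "integrable lborel (\<lambda>t. indicator {p..q} t * (1 / (x - t)))"
    "(LINT t|lborel. indicator {p..q} t * (1 / (x - t))) = ln \<bar>x - p\<bar> - ln \<bar>x - q\<bar>"
proof -
  have c: "continuous_on {p..q} (\<lambda>t. 1 / (x - t))"
    by (intro continuous_on_divide continuous_on_const continuous_on_diff continuous_on_id ballI)
      (use assms(2) in auto)
  show i: "integrable lborel (\<lambda>t. indicator {p..q} t * (1 / (x - t)))"
    using borel_integrable_atLeastAtMost'[OF c] by (simp add: set_integrable_def)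
  have d: "((\<lambda>t. - ln \<bar>x - t\<bar>) has_real_derivative (1 / (x - t))) (at t within {p..q})" if "t \<in> {p..q}" for t
  proof (cases "t < x")
    case True
    have "((\<lambda>t. - ln (x - t)) has_real_derivative (1 / (x - t))) (at t)"
      using True by (auto intro!: derivative_eq_intros)
    then have "((\<lambda>t. - ln \<bar>x - t\<bar>) has_real_derivative (1 / (x - t))) (at t)"
      by (rule has_field_derivative_transform_within_open[of _ _ _ "{..<x}"]) (use True in auto)
    then show ?thesis by (rule has_field_derivative_at_within)
  next
    case False
    then have t: "x < t" using that assms(2) by auto
    have "((\<lambda>t. - ln (t - x)) has_real_derivative (1 / (x - t))) (at t)"
      using t by (auto intro!: derivative_eq_intros simp: field_simps)
    then have "((\<lambda>t. - ln \<bar>x - t\<bar>) has_real_derivative (1 / (x - t))) (at t)"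
      by (rule has_field_derivative_transform_within_open[of _ _ _ "{x<..}"]) (use t in auto)
    then show ?thesis by (rule has_field_derivative_at_within)
  qed
  have "((\<lambda>t. 1 / (x - t)) has_integral (- ln \<bar>x - q\<bar> - (- ln \<bar>x - p\<bar>))) {p..q}"
    by (rule fundamental_theorem_of_calculus[OF assms(1)])
      (use d in \<open>auto simp: has_real_derivative_iff_has_vector_derivative[symmetric]\<close>)
  moreover have "(LINT t:{p..q}|lborel. 1 / (x - t)) = integral {p..q} (\<lambda>t. 1 / (x - t))"
    by (rule set_borel_integral_eq_integral(2)) (use i in \<open>simp add: set_integrable_def\<close>)
  ultimately show "(LINT t|lborel. indicator {p..q} t * (1 / (x - t))) = ln \<bar>x - p\<bar> - ln \<bar>x - q\<bar>"
    by (simp add: set_lebesgue_integral_def integral_unique)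
qed

text \<open>For small \<open>\<epsilon>\<close> the truncated integral is already constant: outside
  the interval the truncation is not felt, and inside the two terms \<open>ln \<epsilon>\<close>
  cancel.\<close>

lemma has_pv_indicator:
  assumes ab: "a \<le> b" and x: "x \<noteq> a" "x \<noteq> b"
  shows "has_pv (\<lambda>t. complex_of_real (indicator {a..b} t)) x (complex_of_real (hlog a b x))"
proof (rule has_pv_of_real)
  fix \<epsilon> :: real assume e: "\<epsilon> > 0"
  have "integrable lborel (\<lambda>t. (1 / \<epsilon>) * indicat_real {a..b} t)"
    by (intro integrable_mult_right integrable_real_indicator) (auto simp: emeasure_lborel_Icc_eq)
  then show "integrable lborel (\<lambda>t. indicator {t. \<epsilon> < \<bar>x - t\<bar>} t * (indicator {a..b} t / (x - t)))"
  proof (rule Bochner_Integration.integrable_bound)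
    show "AE t in lborel. norm (indicat_real {t. \<epsilon> < \<bar>x - t\<bar>} t * (indicator {a..b} t / (x - t))) \<le> norm ((1 / \<epsilon>) * indicat_real {a..b} t)"
      using e by (intro AE_I2) (auto simp: indicator_def abs_divide intro!: divide_left_mono)
  qed measurable
next
  have ev: "\<forall>\<^sub>F \<epsilon> in at_right 0. (LINT t|lborel. indicator {t. \<epsilon> < \<bar>x - t\<bar>} t * (indicator {a..b} t / (x - t))) = logd a b x"
  proof -
    define m where "m = min \<bar>x - a\<bar> \<bar>x - b\<bar>"
    have m: "m > 0" using x by (simp add: m_def)
    have "(LINT t|lborel. indicator {t. \<epsilon> < \<bar>x - t\<bar>} t * (indicator {a..b} t / (x - t))) = logd a b x"
      if e: "0 < \<epsilon>" "\<epsilon> < m" for \<epsilon>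
    proof (cases "x < a \<or> b < x")
      case True
      have "(LINT t|lborel. indicator {t. \<epsilon> < \<bar>x - t\<bar>} t * (indicator {a..b} t / (x - t))) =
        (LINT t|lborel. indicator {a..b} t * (1 / (x - t)))"
        using e True by (intro Bochner_Integration.integral_cong) (auto simp: indicator_def m_def)
      then show ?thesis
        unfolding kernel_integral_outside(2)[OF ab True] logd_diff[OF x] .
    next
      case False
      then have x': "a < x" "x < b" using x by auto
      have ee: "a \<le> x - \<epsilon>" "x < a \<or> x - \<epsilon> < x" "x + \<epsilon> \<le> b" "x < x + \<epsilon> \<or> b < x"
        using e x' by (auto simp: m_def)
      note k1 = kernel_integral_outside[OF ee(1,2)] and k2 = kernel_integral_outside[OF ee(3,4)]
      have "(LINT t|lborel. indicator {t. \<epsilon> < \<bar>x - t\<bar>} t * (indicator {a..b} t / (x - t))) =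
        (LINT t|lborel. indicator {a..x - \<epsilon>} t * (1 / (x - t)) + indicator {x + \<epsilon>..b} t * (1 / (x - t)))"
        using e x' by (intro integral_discrete_difference[where X = "{x - \<epsilon>, x + \<epsilon>}"]) (auto simp: indicator_def m_def)
      also have "\<dots> = logd a b x"
        unfolding Bochner_Integration.integral_add[OF k1(1) k2(1)] k1(2) k2(2) logd_diff[OF x] using e by simp
      finally show ?thesis .
    qed
    then show ?thesis using m by (auto simp: eventually_at_right_field)
  qed
  show "((\<lambda>\<epsilon>. (LINT t|lborel. indicator {t. \<epsilon> < \<bar>x - t\<bar>} t * (indicator {a..b} t / (x - t))) / pi) \<longlongrightarrow> hlog a b x) (at_right 0)"
    unfolding hlog_def by (rule tendsto_eventually) (use ev in eventually_elim, simp)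
qed

text \<open>\<open>hlog\<close> is square integrable, so a square integrable truncated kernel makes
  the truncated integrals of \<open>hlog\<close> converge absolutely.\<close>

lemma real_L2_kernel:
  assumes e: "\<epsilon> > 0"
  shows "real_L2 (\<lambda>u. indicator {u. \<epsilon> < \<bar>u\<bar>} u / u)"
proof -
  define f where "f u = (indicat_real {u. \<epsilon> < \<bar>u\<bar>} u / u)\<^sup>2" for u
  have [measurable]: "f \<in> borel_measurable borel" unfolding f_def by measurable
  have ev: "f (- u) = f u" for u by (simp add: f_def indicator_def)
  have hi: "((\<lambda>x. 1 / x ^ 2) has_integral (1 / (real (2 - 1) * \<epsilon> ^ (2 - 1)))) {\<epsilon>..}"
    by (rule has_integral_inverse_power_to_inf) (use e in auto)
  have si: "set_integrable lborel {\<epsilon>..} (\<lambda>x. 1 / x ^ 2)"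
    by (rule has_integral_nonneg_lborel(1)[OF hi]) auto
  have "set_integrable lborel {0<..} f"
    unfolding set_integrable_def
  proof (rule Bochner_Integration.integrable_bound[OF si[unfolded set_integrable_def]])
    show "AE x in lborel. norm (indicat_real {0<..} x *\<^sub>R f x) \<le> norm (indicat_real {\<epsilon>..} x *\<^sub>R (1 / x\<^sup>2))"
      by (intro AE_I2) (auto simp: f_def indicator_def power_divide)
  qed measurable
  from even_integral_lborel(1)[OF _ ev this] show ?thesis
    by (simp add: real_L2_def f_def[abs_def])
qed

text \<open>Equal to \<open>(ln \<bar>u + p\<bar> - ln \<bar>u - p\<bar>) / u\<close> off
  \<open>p\<close> and \<open>- p\<close>: what remains of a logarithmic singularity at distance
  \<open>p\<close> when the principal value is symmetrized.\<close>

definition log_kernel :: "real \<Rightarrow> real \<Rightarrow> real" where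
  "log_kernel p u = log_ratio (u / p) / u"

lemma log_kernel_integral:
  assumes "p \<noteq> 0"
  shows "integrable lborel (log_kernel p)" "integral\<^sup>L lborel (log_kernel p) = sgn p * pi\<^sup>2"
proof -
  have e: "log_kernel p u = (1 / p) * (log_ratio (0 + (1 / p) * u) / (0 + (1 / p) * u))" for u
    using assms by (simp add: log_kernel_def)
  have i: "integrable lborel (\<lambda>u. log_ratio (0 + (1 / p) * u) / (0 + (1 / p) * u))"
    using assms by (intro lborel_integrable_real_affine[OF log_ratio_div_integral(1)]) auto
  show "integrable lborel (log_kernel p)"
    unfolding e by (intro integrable_mult_right i)
  have "pi\<^sup>2 = \<bar>1 / p\<bar> * (LINT u|lborel. log_ratio (0 + (1 / p) * u) / (0 + (1 / p) * u))"
    using lborel_integral_real_affine[of "1 / p" "\<lambda>u. log_ratio u / u" 0] assms log_ratio_div_integral(2) by simp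
  then have "(LINT u|lborel. log_ratio (0 + (1 / p) * u) / (0 + (1 / p) * u)) = \<bar>p\<bar> * pi\<^sup>2"
    using assms by (simp add: field_simps)
  then have "integral\<^sup>L lborel (log_kernel p) = (1 / p) * (\<bar>p\<bar> * pi\<^sup>2)"
    unfolding e by (subst integral_mult_right_zero) simp
  then show "integral\<^sup>L lborel (log_kernel p) = sgn p * pi\<^sup>2"
    using assms by (simp add: sgn_if abs_if)
qed

lemma log_kernel_measurable [measurable]: "log_kernel p \<in> borel_measurable borel"
  unfolding log_kernel_def by measurable

lemma log_kernel_ln:
  assumes "p \<noteq> 0" "u \<noteq> p" "u \<noteq> - p"
  shows "log_kernel p u = (ln \<bar>u + p\<bar> - ln \<bar>u - p\<bar>) / u"
proof -
  have "u / p + 1 = (u + p) / p" "u / p - 1 = (u - p) / p" using assms by (simp_all add: field_simps)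
  then have "(u / p + 1) / (u / p - 1) = (u + p) / (u - p)" using assms(1) by simp
  then have "log_ratio (u / p) = ln \<bar>u + p\<bar> - ln \<bar>u - p\<bar>"
    using assms by (simp add: log_ratio_def abs_divide ln_div add_eq_0_iff2)
  then show ?thesis by (simp add: log_kernel_def)
qed

lemma trunc_limit:
  fixes f :: "real \<Rightarrow> real"
  assumes f: "integrable lborel f"
  shows "((\<lambda>\<epsilon>. LINT u|lborel. indicator {u. \<epsilon> < \<bar>u\<bar>} u * f u) \<longlongrightarrow> integral\<^sup>L lborel f) (at_right 0)"
proof (rule tendsto_at_right_sequentially[of 0 1])
  have [measurable]: "f \<in> borel_measurable borel" using f by auto
  fix S :: "nat \<Rightarrow> real" assume S: "\<And>k. 0 < S k" "S \<longlonglongrightarrow> 0"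
  show "(\<lambda>k. LINT u|lborel. indicator {u. S k < \<bar>u\<bar>} u * f u) \<longlonglongrightarrow> integral\<^sup>L lborel f"
  proof (rule integral_dominated_convergence[where w = "\<lambda>x. norm (f x)"])
    show "AE u in lborel. (\<lambda>k. indicator {u. S k < \<bar>u\<bar>} u * f u) \<longlonglongrightarrow> f u"
    proof (rule eventually_mono[OF AE_lborel_singleton[of 0]])
      fix u :: real assume u: "u \<noteq> 0"
      have "\<forall>\<^sub>F k in sequentially. S k < \<bar>u\<bar>"
        using order_tendstoD(2)[OF S(2), of "\<bar>u\<bar>"] u by simp
      then have "\<forall>\<^sub>F k in sequentially. indicator {u. S k < \<bar>u\<bar>} u * f u = f u"
        by eventually_elim simp
      then show "(\<lambda>k. indicator {u. S k < \<bar>u\<bar>} u * f u) \<longlonglongrightarrow> f u"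
        by (rule tendsto_eventually)
    qed
  qed (use f in \<open>auto simp: indicator_def\<close>)
qed simp

text \<open>Averaging the substitutions \<open>t = x + u\<close> and \<open>t = x - u\<close>, which
  share the truncation, replaces the principal value by an absolutely convergent integral of
  \<open>log_kernel q - log_kernel p\<close>. Each kernel integrates to \<open>pi\<^sup>2\<close>
  times a sign, and the signs differ exactly when \<open>x\<close> lies between \<open>a\<close> and
  \<open>b\<close>.\<close>

lemma has_pv_hlog:
  assumes ab: "a \<le> b" and x: "x \<noteq> a" "x \<noteq> b"
  shows "has_pv (\<lambda>t. complex_of_real (hlog a b t)) x (- complex_of_real (indicator {a..b} x))"
proof -
  define p where "p = x - a"
  define q where "q = x - b"
  have pq: "p \<noteq> 0" "q \<noteq> 0" using x by (simp_all add: p_def q_def)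
  define T where "T \<epsilon> t = indicator {t. \<epsilon> < \<bar>x - t\<bar>} t * (hlog a b t / (x - t))" for \<epsilon> t
  have Tm: "T \<epsilon> \<in> borel_measurable borel" for \<epsilon>
    unfolding T_def hlog_def by measurable
  have shift: "T \<epsilon> (x + s * u) = - (s * (indicator {u. \<epsilon> < \<bar>u\<bar>} u * (hlog a b (x + s * u) / u)))" if "s = 1 \<or> s = -1" for \<epsilon> s u
    using that by (auto simp: T_def indicator_def)
  have iT1: "integrable lborel (\<lambda>u. T \<epsilon> (x + 1 * u))" if e: "\<epsilon> > 0" for \<epsilon>
  proof -
    have h: "real_L2 (\<lambda>u. hlog a b (x + 1 * u))"
      using lborel_integrable_real_affine[of "\<lambda>t. (hlog a b t)\<^sup>2" 1 x] real_L2_hlog[of a b]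
      by (auto simp: real_L2_def)
    have "integrable lborel (\<lambda>u. Re (complex_of_real (hlog a b (x + 1 * u)) * complex_of_real (indicator {u. \<epsilon> < \<bar>u\<bar>} u / u)))"
      by (intro integrable_Re L2_mult_integrable real_L2_L2 h real_L2_kernel e)
    then have "integrable lborel (\<lambda>u. - (hlog a b (x + 1 * u) * (indicator {u. \<epsilon> < \<bar>u\<bar>} u / u)))" by simp
    then show ?thesis unfolding shift[of 1, simplified] by (simp add: mult.commute)
  qed
  have iT: "integrable lborel (T \<epsilon>)" if "\<epsilon> > 0" for \<epsilon>
    using lborel_integrable_real_affine_iff[of 1 "T \<epsilon>" x] iT1[OF that] by simp
  have iT2: "integrable lborel (\<lambda>u. T \<epsilon> (x + (-1) * u))" if "\<epsilon> > 0" for \<epsilon>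
    using lborel_integrable_real_affine[OF iT[OF that], of "-1" x] by simp
  have J: "integral\<^sup>L lborel (T \<epsilon>) = (LINT u|lborel. indicator {u. \<epsilon> < \<bar>u\<bar>} u * (log_kernel q u - log_kernel p u)) / (2 * pi)" if e: "\<epsilon> > 0" for \<epsilon>
  proof -
    have "2 * integral\<^sup>L lborel (T \<epsilon>) = (LINT u|lborel. T \<epsilon> (x + 1 * u)) + (LINT u|lborel. T \<epsilon> (x + (-1) * u))"
      using lborel_integral_real_affine[of 1 "T \<epsilon>" x] lborel_integral_real_affine[of "-1" "T \<epsilon>" x] by simp
    also have "\<dots> = (LINT u|lborel. T \<epsilon> (x + 1 * u) + T \<epsilon> (x + (-1) * u))"
      by (rule Bochner_Integration.integral_add[symmetric, OF iT1[OF e] iT2[OF e]])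
    also have "\<dots> = (LINT u|lborel. (indicator {u. \<epsilon> < \<bar>u\<bar>} u * (log_kernel q u - log_kernel p u)) / pi)"
    proof (rule integral_discrete_difference[where X = "{p, -p, q, -q}"])
      fix u assume u: "u \<notin> {p, - p, q, - q}"
      have 1: "hlog a b (x + 1 * u) = (ln \<bar>u + p\<bar> - ln \<bar>u + q\<bar>) / pi"
      proof -
        have "x + u \<noteq> a" "x + u \<noteq> b" using u by (auto simp: p_def q_def)
        then show ?thesis by (simp add: hlog_def logd_diff p_def q_def algebra_simps)
      qed
      have 2: "hlog a b (x + (-1) * u) = (ln \<bar>u - p\<bar> - ln \<bar>u - q\<bar>) / pi"
      proof -
        have "x - u \<noteq> a" "x - u \<noteq> b" using u by (auto simp: p_def q_def)
        moreover have "\<bar>x - u - a\<bar> = \<bar>u - p\<bar>" "\<bar>x - u - b\<bar> = \<bar>u - q\<bar>" by (auto simp: p_def q_def)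
        ultimately show ?thesis by (simp add: hlog_def logd_diff)
      qed
      have 3: "log_kernel p u = (ln \<bar>u + p\<bar> - ln \<bar>u - p\<bar>) / u" "log_kernel q u = (ln \<bar>u + q\<bar> - ln \<bar>u - q\<bar>) / u"
        using log_kernel_ln[OF pq(1), of u] log_kernel_ln[OF pq(2), of u] u by auto
      have s: "T \<epsilon> (x + 1 * u) = - (indicator {u. \<epsilon> < \<bar>u\<bar>} u * (hlog a b (x + 1 * u) / u))"
        "T \<epsilon> (x + (-1) * u) = indicator {u. \<epsilon> < \<bar>u\<bar>} u * (hlog a b (x + (-1) * u) / u)"
        using shift[of 1 \<epsilon> u] shift[of "-1" \<epsilon> u] by simp_all
      show "T \<epsilon> (x + 1 * u) + T \<epsilon> (x + (-1) * u) = (indicator {u. \<epsilon> < \<bar>u\<bar>} u * (log_kernel q u - log_kernel p u)) / pi"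
        unfolding s 1 2 3 by (simp add: algebra_simps diff_divide_distrib add_divide_distrib)
    qed auto
    finally show ?thesis by simp
  qed
  have lim: "((\<lambda>\<epsilon>. integral\<^sup>L lborel (T \<epsilon>) / pi) \<longlongrightarrow> - indicator {a..b} x) (at_right 0)"
  proof -
    have i: "integrable lborel (\<lambda>u. log_kernel q u - log_kernel p u)"
      using log_kernel_integral(1) pq by simp
    have v: "(LINT u|lborel. log_kernel q u - log_kernel p u) = (sgn q - sgn p) * pi\<^sup>2"
      using log_kernel_integral pq by (simp add: algebra_simps)
    have "((\<lambda>\<epsilon>. (LINT u|lborel. indicator {u. \<epsilon> < \<bar>u\<bar>} u * (log_kernel q u - log_kernel p u)) / (2 * pi) / pi) \<longlongrightarrow>
      (sgn q - sgn p) * pi\<^sup>2 / (2 * pi) / pi) (at_right 0)"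
      unfolding v[symmetric] by (intro tendsto_divide tendsto_const trunc_limit i) auto
    moreover have "(sgn q - sgn p) * pi\<^sup>2 / (2 * pi) / pi = - indicator {a..b} x"
      using ab x by (auto simp: p_def q_def sgn_if indicator_def power2_eq_square)
    ultimately have "((\<lambda>\<epsilon>. (LINT u|lborel. indicator {u. \<epsilon> < \<bar>u\<bar>} u * (log_kernel q u - log_kernel p u)) / (2 * pi) / pi) \<longlongrightarrow>
      - indicator {a..b} x) (at_right 0)" by simp
    then show ?thesis
    proof (rule Lim_transform_eventually)
      show "\<forall>\<^sub>F \<epsilon> in at_right 0. (LINT u|lborel. indicator {u. \<epsilon> < \<bar>u\<bar>} u * (log_kernel q u - log_kernel p u)) / (2 * pi) / pi = integral\<^sup>L lborel (T \<epsilon>) / pi"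
        using eventually_at_right_less[of 0] by eventually_elim (simp add: J)
    qed
  qed
  show ?thesis
    using has_pv_of_real[of x "hlog a b" "- indicator {a..b} x"] iT lim by (simp add: T_def[abs_def])
qed

section \<open>Commutation with the Hilbert transform\<close>

definition phibox :: "nat \<Rightarrow> real \<Rightarrow> real \<Rightarrow> real" where
  "phibox n b w = (LINT t|lborel. cn n (w * t) * indicator {-b..b} t)"

lemma Phi_symbox:
  assumes "n \<ge> 1"
  shows "real_L2 (phibox n b)" "Phi n (symbox b) = rcls (phibox n b)"
proof -
  have q: "(LINT t|lborel. complex_of_real (cn n (w * t)) * complex_of_real (indicator {-b..b} t)) = complex_of_real (phibox n b w)" for w
    unfolding phibox_def by (subst integral_complex_of_real[symmetric]) simp
  have P: "(\<lambda>w. complex_of_real (phibox n b w)) \<in> L2"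
    "Phi n (cls (\<lambda>t. complex_of_real (indicator {-b..b} t))) = cls (\<lambda>w. complex_of_real (phibox n b w))"
    unfolding q[symmetric]
    by (rule Phi_integral[OF assms real_L2_L2[OF real_L2_indicator_interval], of b]; auto simp: indicator_def)+
  have "phibox n b \<in> borel_measurable borel"
    unfolding phibox_def by measurable
  then show "real_L2 (phibox n b)" using L2_integrable_sq[OF P(1)] by (simp add: real_L2_def)
  show "Phi n (symbox b) = rcls (phibox n b)" using P(2) by (simp add: symbox_def rcls_def)
qed

lemma phibox_scale:
  assumes "b > 0"
  shows "phibox n b w = b * phibox n 1 (b * w)"
proof -
  have i: "indicat_real {-b..b} (b * v) = indicator {-1..1} v" for v
    using assms mult_le_cancel_left_pos[of b "-1" v] mult_le_cancel_left_pos[of b v 1] by (auto simp: indicator_def)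
  have "phibox n b w = b * (LINT v|lborel. cn n (w * (b * v)) * indicator {-b..b} (b * v))"
    unfolding phibox_def
    using lborel_integral_real_affine[of b "\<lambda>t. cn n (w * t) * indicator {-b..b} t" 0] assms
    by simp
  then show ?thesis unfolding i phibox_def by (simp only: mult_ac)
qed

definition shlog :: "real \<Rightarrow> real \<Rightarrow> real" where
  "shlog a x = sgn x * hlog (- a) a x"

lemma sgnmul_Hilbert_op_symbox:
  assumes "a > 0"
  shows "sgnmul (Hilbert_op (symbox a)) = rcls (shlog a)"
proof -
  have "Hilbert_op (cmul 1 (interval_cls (- a) a)) = cmul 1 (hlog_cls (- a) a)" using assms by (intro Hilbert_op_interval_cls) simp
  then have "Hilbert_op (symbox a) = hlog_cls (- a) a" by (simp add: symbox_def interval_cls_def)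
  then show ?thesis by (simp add: hlog_cls_def sgnmul_rcls real_L2_hlog shlog_def[abs_def])
qed

lemma real_L2_shlog: "real_L2 (shlog a)"
  unfolding shlog_def by (intro real_L2_sgn real_L2_hlog)

lemma shlog_scale:
  assumes "a > 0"
  shows "shlog a (a * y) = shlog 1 y"
proof -
  have "(a * y + a) / (a * y - a) = (a * (y + 1)) / (a * (y - 1))" by (simp add: algebra_simps)
  also have "\<dots> = (y + 1) / (y - 1)" using assms by simp
  finally show ?thesis using assms by (simp add: shlog_def hlog_def logd_def sgn_mult)
qed

text \<open>Scaling shows that this pairing of \<open>symbox a\<close> and \<open>symbox b\<close> depends on \<open>a * b\<close> only.\<close>

lemma pairing_scale:
  assumes "a > 0" "b > 0"
  shows "(LINT x|lborel. shlog a x * phibox n b x) = (a * b) * (LINT y|lborel. shlog 1 y * phibox n 1 ((a * b) * y))"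
proof -
  have "(LINT x|lborel. shlog a x * phibox n b x) = a * (LINT y|lborel. shlog a (a * y) * phibox n b (a * y))"
    using lborel_integral_real_affine[of a "\<lambda>x. shlog a x * phibox n b x" 0] assms by simp
  also have "(LINT y|lborel. shlog a (a * y) * phibox n b (a * y)) = (LINT y|lborel. b * (shlog 1 y * phibox n 1 ((a * b) * y)))"
    unfolding phibox_scale[OF assms(2)] shlog_scale[OF assms(1)] by (simp only: mult_ac)
  also have "\<dots> = b * (LINT y|lborel. shlog 1 y * phibox n 1 ((a * b) * y))"
    by (rule integral_mult_right_zero)
  finally show ?thesis by simp
qed

section \<open>Even functions and the symmetry of the pairing\<close>

definition evenp :: "l2 \<Rightarrow> l2" where
  "evenp x = (1 / 2) *\<^sub>R (x + reflect x)"

lemma bounded_linear_evenp: "bounded_linear evenp"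
  unfolding evenp_def
  by (intro bounded_linear_scaleR_right[THEN bounded_linear_compose] bounded_linear_add bounded_linear_ident bounded_linear_reflect)

lemma reflect_evenp: "reflect (evenp x) = evenp x"
  by (simp add: evenp_def reflect_scaleR reflect_add add.commute)

lemma evenp_even: "reflect x = x \<Longrightarrow> evenp x = x"
  by (simp add: evenp_def scaleR_2[symmetric])

lemma evenp_odd: "reflect x = - x \<Longrightarrow> evenp x = 0"
  by (simp add: evenp_def)

lemma reflect_sgnmul_even: "reflect x = x \<Longrightarrow> reflect (sgnmul x) = - sgnmul x"
  using sgnmul_reflect[of x] by (metis minus_minus)

lemma reflect_sgnmul_odd: "reflect x = - x \<Longrightarrow> reflect (sgnmul x) = sgnmul x"
  using sgnmul_reflect[of x] linear_neg[OF linear_sgnmul, of x] by (metis minus_minus)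

lemma reflect_symbox: "reflect (symbox a) = symbox a"
  unfolding symbox_def by (rule reflect_rcls[OF real_L2_indicator_interval]) (auto simp: indicator_def)

lemma evenp_symbox: "evenp (cmul c (symbox a)) = cmul c (symbox a)" "evenp (cmul c (sgnmul (symbox a))) = 0"
proof -
  show "evenp (cmul c (symbox a)) = cmul c (symbox a)"
    by (rule evenp_even) (simp add: reflect_cmul reflect_symbox)
  show "evenp (cmul c (sgnmul (symbox a))) = 0"
    by (rule evenp_odd) (simp add: reflect_cmul reflect_sgnmul_even reflect_symbox cmul_cmul flip: cmul_minus1)
qed

text \<open>\<open>evenp\<close> fixes the multiples of \<open>symbox a\<close> and kills those of
  \<open>sgnmul (symbox a)\<close>, so only the even half of \<open>total_symbox\<close> has to be
  checked.\<close>

lemma evenp_eqI: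
  fixes f :: "l2 \<Rightarrow> 'b::real_normed_vector"
  assumes f: "bounded_linear f" and g: "bounded_linear g"
    and eq: "\<And>c a. a > 0 \<Longrightarrow> f (cmul c (symbox a)) = g (cmul c (symbox a))"
  shows "f (evenp x) = g (evenp x)"
proof (rule total_eqI[OF total_symbox, where f = "\<lambda>x. f (evenp x)" and g = "\<lambda>x. g (evenp x)"])
  show "bounded_linear (\<lambda>x. f (evenp x))" "bounded_linear (\<lambda>x. g (evenp x))"
    by (intro bounded_linear_compose[OF f] bounded_linear_compose[OF g] bounded_linear_evenp)+
  show "f (evenp s) = g (evenp s)"
    if "s \<in> {cmul c (symbox a) |c a. a > 0} \<union> {cmul c (sgnmul (symbox a)) |c a. a > 0}" for s
    using that eq linear_0[OF bounded_linear.linear[OF f]] linear_0[OF bounded_linear.linear[OF g]] by (auto simp: evenp_symbox)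
qed

context
  fixes n :: nat
  assumes n: "n \<ge> 1"
begin

text \<open>Both sides are real bilinear in \<open>x\<close> and \<open>y\<close>, and the
  generators are inserted in one argument at a time. There the value is
  \<open>Re (c * cnj d)\<close> times a function of \<open>a * b\<close>, symmetric under exchanging
  \<open>(c, a)\<close> with \<open>(d, b)\<close>.\<close>

lemma pairing_symmetric:
  "inner (sgnmul (Hilbert_op (evenp x))) (Phi n (evenp y)) = inner (sgnmul (Hilbert_op (evenp y))) (Phi n (evenp x))"
proof (rule evenp_eqI[where f = "\<lambda>x. inner (sgnmul (Hilbert_op x)) (Phi n (evenp y))" and g = "\<lambda>x. inner (sgnmul (Hilbert_op (evenp y))) (Phi n x)"])
  note bl = bounded_linear_compose[OF bounded_linear_inner_left] bounded_linear_compose[OF bounded_linear_inner_right]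
    bounded_linear_compose[OF bounded_linear_sgnmul] bounded_linear_Hilbert_op bounded_linear_Phi[OF n]
  show "bounded_linear (\<lambda>x. inner (sgnmul (Hilbert_op x)) (Phi n (evenp y)))"
    "bounded_linear (\<lambda>x. inner (sgnmul (Hilbert_op (evenp y))) (Phi n x))" by (intro bl)+
  fix c and a :: real assume a: "a > 0"
  show "inner (sgnmul (Hilbert_op (cmul c (symbox a)))) (Phi n (evenp y)) = inner (sgnmul (Hilbert_op (evenp y))) (Phi n (cmul c (symbox a)))"
  proof (rule evenp_eqI[where f = "\<lambda>y. inner (sgnmul (Hilbert_op (cmul c (symbox a)))) (Phi n y)" and g = "\<lambda>y. inner (sgnmul (Hilbert_op y)) (Phi n (cmul c (symbox a)))"])
    show "bounded_linear (\<lambda>y. inner (sgnmul (Hilbert_op (cmul c (symbox a)))) (Phi n y))"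
      "bounded_linear (\<lambda>y. inner (sgnmul (Hilbert_op y)) (Phi n (cmul c (symbox a))))" by (intro bl)+
    fix d and b :: real assume b: "b > 0"
    have "inner (sgnmul (Hilbert_op (cmul c (symbox a)))) (Phi n (cmul d (symbox b))) = Re (c * cnj d) * (LINT x|lborel. shlog a x * phibox n b x)"
      if "a > 0" for c a d b
      using that by (simp add: Hilbert_op_cmul sgnmul_cmul sgnmul_Hilbert_op_symbox Phi_cmul[OF n] Phi_symbox[OF n] inner_cmul_rcls real_L2_shlog)
    then show "inner (sgnmul (Hilbert_op (cmul c (symbox a)))) (Phi n (cmul d (symbox b))) = inner (sgnmul (Hilbert_op (cmul d (symbox b)))) (Phi n (cmul c (symbox a)))"
      using a b pairing_scale[OF a b] pairing_scale[OF b a] by (simp add: mult_ac)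
  qed
qed

text \<open>The difference \<open>z\<close> of the two sides serves as its own test vector. It is
  even, so the symmetric pairing applies to \<open>x\<close> and \<open>z\<close>; self-adjointness
  of \<open>Phi n\<close> and \<open>sgnmul\<close> and skewness of \<open>Hilbert_op\<close> then
  give \<open>inner z z = 0\<close>.\<close>

lemma Phi_sgnmul_Hilbert_op:
  assumes "reflect x = x"
  shows "Phi n (sgnmul (Hilbert_op x)) = - Hilbert_op (sgnmul (Phi n x))"
proof -
  define z where "z = Phi n (sgnmul (Hilbert_op x)) + Hilbert_op (sgnmul (Phi n x))"
  have rH: "reflect (Hilbert_op x) = - Hilbert_op x" using Hilbert_op_reflect[of x] assms by (metis minus_minus)
  have "reflect (Phi n (sgnmul (Hilbert_op x))) = Phi n (sgnmul (Hilbert_op x))"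
    unfolding Phi_reflect[OF n, symmetric] reflect_sgnmul_odd[OF rH] ..
  moreover have "reflect (Hilbert_op (sgnmul (Phi n x))) = Hilbert_op (sgnmul (Phi n x))"
  proof -
    have "reflect (Phi n x) = Phi n x" using Phi_reflect[OF n, of x] assms by simp
    then have "reflect (sgnmul (Phi n x)) = - sgnmul (Phi n x)" by (rule reflect_sgnmul_even)
    then show ?thesis
      using Hilbert_op_reflect[of "sgnmul (Phi n x)"] linear_neg[OF linear_Hilbert_op] by (metis minus_minus)
  qed
  ultimately have z: "reflect z = z" by (simp add: z_def reflect_add)
  have "inner (sgnmul (Hilbert_op x)) (Phi n z) = inner (sgnmul (Hilbert_op z)) (Phi n x)"
    using pairing_symmetric[of x z] by (simp add: evenp_even assms z)
  also have "\<dots> = inner (Hilbert_op z) (sgnmul (Phi n x))" by (rule inner_sgnmul_left)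
  also have "\<dots> = - inner (Hilbert_op (sgnmul (Phi n x))) z" by (simp add: Hilbert_op_skew[of z] inner_commute)
  finally have "inner (Phi n (sgnmul (Hilbert_op x))) z = - inner (Hilbert_op (sgnmul (Phi n x))) z"
    by (simp add: inner_Phi_left[OF n])
  then have "inner z z = 0" unfolding z_def[symmetric] by (subst (1) z_def) (simp add: inner_add_left)
  then show ?thesis by (simp add: z_def add_eq_0_iff2)
qed

text \<open>For odd \<open>g = \<H> h\<close> the odd part of \<open>\<Phi>\<^sub>n\<close> is \<open>\<i> sgn \<Phi>\<^sub>n (\<H> g)\<close>, where \<open>\<H> g\<close> is even.\<close>

definition Phi_ext :: "l2 \<Rightarrow> l2" where
  "Phi_ext x = Phi n (evenp x) + cmul \<i> (sgnmul (Phi n (Hilbert_op (x - evenp x))))"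

lemma bounded_linear_Phi_ext: "bounded_linear Phi_ext"
  unfolding Phi_ext_def
  by (intro bounded_linear_add bounded_linear_sub bounded_linear_ident bounded_linear_evenp
      bounded_linear_compose[OF bounded_linear_Phi[OF n]] bounded_linear_compose[OF bounded_linear_cmul]
      bounded_linear_compose[OF bounded_linear_sgnmul] bounded_linear_compose[OF bounded_linear_Hilbert_op])

lemmas linear_Phi_ext = bounded_linear.linear[OF bounded_linear_Phi_ext]

lemma Phi_ext_cmul: "Phi_ext (cmul c x) = cmul c (Phi_ext x)"
proof -
  have "evenp (cmul c x) = cmul c (evenp x)"
    by (simp add: evenp_def reflect_cmul cmul_scaleR flip: cmul_add)
  then show ?thesis
    by (simp add: Phi_ext_def cmul_diff[symmetric] Hilbert_op_cmul Phi_cmul[OF n] sgnmul_cmul cmul_cmul mult.commute cmul_add)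
qed

lemma Phi_ext_even: "reflect x = x \<Longrightarrow> Phi_ext x = Phi n x"
  by (simp add: Phi_ext_def evenp_even linear_0[OF linear_Phi[OF n]]
      linear_0[OF linear_Hilbert_op]
      linear_0[OF linear_sgnmul] linear_0[OF linear_cmul])

lemma Phi_ext_odd: "reflect x = - x \<Longrightarrow> Phi_ext x = cmul \<i> (sgnmul (Phi n (Hilbert_op x)))"
  by (simp add: Phi_ext_def evenp_odd linear_0[OF linear_Phi[OF n]])

text \<open>On an odd \<open>y\<close> the two factors \<open>\<i>\<close> give a minus sign. The
  commutation rule, applied to the even vector \<open>Hilbert_op y\<close>, brings two copies of
  \<open>Hilbert_op\<close> and two of \<open>Phi n\<close> together.\<close>

lemma Phi_ext_Phi_ext: "Phi_ext (Phi_ext x) = reflect x"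
proof -
  have e: "Phi_ext (Phi_ext y) = y" if "reflect y = y" for y
    using that Phi_reflect[OF n, of y] by (simp add: Phi_ext_even Phi_Phi[OF n])
  have o: "Phi_ext (Phi_ext y) = - y" if y: "reflect y = - y" for y
  proof -
    have rH: "reflect (Hilbert_op y) = Hilbert_op y"
      using Hilbert_op_reflect[of y] y linear_neg[OF linear_Hilbert_op] by (metis minus_minus)
    have "reflect (Phi n (Hilbert_op y)) = Phi n (Hilbert_op y)" using Phi_reflect[OF n, of "Hilbert_op y"] rH by simp
    then have "reflect (sgnmul (Phi n (Hilbert_op y))) = - sgnmul (Phi n (Hilbert_op y))" by (rule reflect_sgnmul_even)
    then have "reflect (Phi_ext y) = - Phi_ext y"
      by (simp add: Phi_ext_odd y reflect_cmul cmul_cmul flip: cmul_minus1)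
    then have "Phi_ext (Phi_ext y) = cmul \<i> (sgnmul (Phi n (Hilbert_op (cmul \<i> (sgnmul (Phi n (Hilbert_op y)))))))"
      by (simp add: Phi_ext_odd y)
    also have "\<dots> = - sgnmul (Phi n (Hilbert_op (sgnmul (Phi n (Hilbert_op y)))))"
      by (simp add: Hilbert_op_cmul Phi_cmul[OF n] sgnmul_cmul cmul_cmul flip: cmul_minus1)
    also have "Hilbert_op (sgnmul (Phi n (Hilbert_op y))) = - Phi n (sgnmul (Hilbert_op (Hilbert_op y)))"
      using Phi_sgnmul_Hilbert_op[OF rH] by simp
    also have "\<dots> = Phi n (sgnmul y)"
      by (simp add: Hilbert_op_Hilbert_op linear_neg[OF linear_Phi[OF n]]
          linear_neg[OF linear_sgnmul])
    also have "- sgnmul (Phi n (Phi n (sgnmul y))) = - y" by (simp add: Phi_Phi[OF n])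
    finally show ?thesis .
  qed
  have "reflect (x - evenp x) = - (x - evenp x)"
  proof -
    have "reflect (x - evenp x) = reflect x - evenp x"
      using linear_diff[OF linear_reflect] by (simp add: reflect_evenp)
    also have "\<dots> = - (x - evenp x)"
    proof -
      have "evenp x + evenp x = x + reflect x" by (simp add: evenp_def flip: scaleR_2)
      then show ?thesis by (simp add: algebra_simps)
    qed
    finally show ?thesis .
  qed
  note o1 = o[OF this] and e1 = e[OF reflect_evenp[of x]]
  have "Phi_ext (Phi_ext (evenp x + (x - evenp x))) = Phi_ext (Phi_ext (evenp x)) + Phi_ext (Phi_ext (x - evenp x))"
    by (simp only: linear_add[OF bounded_linear.linear[OF bounded_linear_Phi_ext]])
  also have "\<dots> = evenp x - (x - evenp x)" unfolding o1 e1 by simp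
  also have "\<dots> = reflect x"
  proof -
    have "evenp x + evenp x = x + reflect x" by (simp add: evenp_def flip: scaleR_2)
    then show ?thesis by (simp add: algebra_simps)
  qed
  finally show ?thesis by simp
qed

lemma Phi_ext_fourth: "Phi_ext (Phi_ext (Phi_ext (Phi_ext x))) = x"
  by (simp add: Phi_ext_Phi_ext)

end

section \<open>The extension from step functions\<close>

lemma haar_phi_indicator:
  "haar_phi (2 powr real_of_int j * t - real_of_int k) =
    indicator {real_of_int k / 2 powr real_of_int j..(real_of_int k + 1) / 2 powr real_of_int j} t"
proof -
  define p where "p = 2 powr real_of_int j"
  have "p > 0" by (simp add: p_def)
  then show ?thesis
    unfolding p_def[symmetric] by (auto simp: haar_phi_def indicator_def field_simps)
qed

lemma Vj_cases:
  assumes "h \<in> Vj j"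
  obtains K :: "int set" and a l r where "finite K" "\<And>k. l k \<le> r k"
    "h = (\<lambda>t. \<Sum>k\<in>K. a k * complex_of_real (indicator {l k..r k} t))"
proof -
  obtain K a where K: "finite K"
    "h = (\<lambda>t. \<Sum>k\<in>K. (a k :: complex) * complex_of_real (haar_phi (2 powr (real_of_int j) * t - real_of_int k)))"
    using assms unfolding Vj_def by blast
  show ?thesis
    by (rule that[OF K(1), of "\<lambda>k. real_of_int k / 2 powr real_of_int j" "\<lambda>k. (real_of_int k + 1) / 2 powr real_of_int j" a])
      (simp_all add: K(2) haar_phi_indicator divide_right_mono)
qed

lemma borel_measurable_countable_difference:
  fixes f g :: "real \<Rightarrow> complex"
  assumes "f \<in> borel_measurable borel" "countable X" "\<And>x. x \<notin> X \<Longrightarrow> f x = g x"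
  shows "g \<in> borel_measurable borel"
  by (rule measurable_discrete_difference[OF assms(1,2)]) (use assms(3) in auto)

lemma ae_eq_countable_difference:
  assumes "countable X" "\<And>x. x \<notin> X \<Longrightarrow> f x = g x"
  shows "ae_eq f g"
  unfolding ae_eq_def
  by (rule eventually_mono[OF AE_discrete_difference[OF assms(1)]]) (use assms(2) in auto)

text \<open>All pointwise statements about \<open>hilbert\<close> hold off the finite set
  \<open>X\<close> of endpoints. Measurability and membership of \<open>hilbert h\<close> in
  \<open>L2\<close> are inherited from the logarithmic sum \<open>g\<close>, which it equals
  there.\<close>

lemma step_function:
  fixes a :: "'i \<Rightarrow> complex"
  assumes K: "finite K" and le_r: "\<And>k. l k \<le> r k"
  defines "h \<equiv> \<lambda>t. \<Sum>k\<in>K. a k * complex_of_real (indicator {l k..r k} t)"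
  shows "h \<in> L2" "\<exists>A. \<forall>t. \<bar>t\<bar> > A \<longrightarrow> h t = 0"
    "hilbert h \<in> L2" "cls (hilbert h) = Hilbert_op (cls h)"
    "\<exists>X. countable X \<and> (\<forall>t. t \<notin> X \<longrightarrow> hilbert (hilbert h) t = - h t)"
proof -
  note I2 = real_L2_L2[OF real_L2_indicator_interval] and H2 = real_L2_L2[OF real_L2_hlog]
  show h2: "h \<in> L2" unfolding h_def by (intro L2_sum L2_cmult I2)
  show "\<exists>A. \<forall>t. \<bar>t\<bar> > A \<longrightarrow> h t = 0"
  proof (intro exI[of _ "\<Sum>k\<in>K. \<bar>l k\<bar> + \<bar>r k\<bar>"] allI impI)
    fix t assume t: "(\<Sum>k\<in>K. \<bar>l k\<bar> + \<bar>r k\<bar>) < \<bar>t\<bar>"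
    have "indicat_real {l k..r k} t = 0" if "k \<in> K" for k
      using member_le_sum[of k K "\<lambda>k. \<bar>l k\<bar> + \<bar>r k\<bar>"] that K t by (auto simp: indicator_def)
    then show "h t = 0" by (simp add: h_def)
  qed
  define X where "X = l ` K \<union> r ` K"
  have X: "countable X" using K by (auto simp: X_def intro: countable_finite)
  define g where "g t = (\<Sum>k\<in>K. a k * complex_of_real (hlog (l k) (r k) t))" for t
  have hh: "hilbert h x = g x" if "x \<notin> X" for x
    unfolding h_def g_def
    by (intro hilbert_eq has_pv_sum K has_pv_cmult has_pv_indicator le_r) (use that in \<open>auto simp: X_def\<close>)
  have g2: "g \<in> L2" unfolding g_def by (intro L2_sum L2_cmult H2)
  have m: "hilbert h \<in> borel_measurable borel"
    by (rule borel_measurable_countable_difference[OF L2_measurable[OF g2] X]) (simp add: hh)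
  have ae: "ae_eq g (hilbert h)"
    by (rule ae_eq_countable_difference[OF X]) (simp add: hh)
  show hl: "hilbert h \<in> L2" by (rule L2_AE_cong[OF g2 ae]) (use m in simp)
  have "cls h = (\<Sum>k\<in>K. cmul (a k) (interval_cls (l k) (r k)))"
    unfolding h_def by (subst cls_sum) (auto simp: interval_cls_def rcls_def cmul_cls I2 intro!: L2_cmult)
  then have "Hilbert_op (cls h) = (\<Sum>k\<in>K. cmul (a k) (hlog_cls (l k) (r k)))"
    by (simp add: linear_sum[OF linear_Hilbert_op] Hilbert_op_interval_cls le_r)
  also have "\<dots> = cls g"
    unfolding g_def by (subst cls_sum) (auto simp: hlog_cls_def rcls_def cmul_cls H2 intro!: L2_cmult)
  also have "\<dots> = cls (hilbert h)" by (rule cls_eqI[OF g2 hl ae])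
  finally show "cls (hilbert h) = Hilbert_op (cls h)" ..
  have "hilbert (hilbert h) x = - h x" if x: "x \<notin> X" for x
  proof -
    have "has_pv g x (\<Sum>k\<in>K. a k * (- complex_of_real (indicator {l k..r k} x)))"
      unfolding g_def by (intro has_pv_sum K has_pv_cmult has_pv_hlog le_r) (use x in \<open>auto simp: X_def\<close>)
    then have "has_pv (hilbert h) x (\<Sum>k\<in>K. a k * (- complex_of_real (indicator {l k..r k} x)))"
      by (rule has_pv_cong[OF _ X]) (simp add: hh)
    from hilbert_eq[OF this] show ?thesis by (simp add: h_def sum_negf)
  qed
  then show "\<exists>X. countable X \<and> (\<forall>t. t \<notin> X \<longrightarrow> hilbert (hilbert h) t = - h t)" using X by blast
qed

lemma Vj_plus_step:
  assumes "h \<in> Vj_plus j"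
  shows "h \<in> L2" "\<exists>A. \<forall>t. \<bar>t\<bar> > A \<longrightarrow> h t = 0"
    "hilbert h \<in> L2" "cls (hilbert h) = Hilbert_op (cls h)"
    "\<exists>X. countable X \<and> (\<forall>t. t \<notin> X \<longrightarrow> hilbert (hilbert h) t = - h t)"
    "h (- t) = h t"
proof -
  have "h \<in> Vj j" using assms by (simp add: Vj_plus_def)
  then obtain K :: "int set" and a l r where *: "finite K" "\<And>k. l k \<le> r k"
    "h = (\<lambda>t. \<Sum>k\<in>K. a k * complex_of_real (indicator {l k..r k} t))" by (elim Vj_cases) blast
  show "h \<in> L2" "\<exists>A. \<forall>t. \<bar>t\<bar> > A \<longrightarrow> h t = 0"
    "hilbert h \<in> L2" "cls (hilbert h) = Hilbert_op (cls h)"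
    "\<exists>X. countable X \<and> (\<forall>t. t \<notin> X \<longrightarrow> hilbert (hilbert h) t = - h t)"
    unfolding *(3) by (rule step_function[OF *(1,2)])+
  show "h (- t) = h t" using assms by (simp add: Vj_plus_def)
qed

text \<open>The inner \<open>hilbert (hilbert h2)\<close> of \<open>Phi_D\<close> equals
  \<open>- h2\<close> off a countable set, so \<open>Phi_integral\<close> covers both integrals;
  \<open>Hilbert_op_Hilbert_op\<close> produces the same sign in \<open>Phi_ext\<close>.\<close>

lemma Phi_D_cls:
  assumes n: "n \<ge> 1" and h: "h1 \<in> Vj_plus j" "h2 \<in> Vj_plus j"
  shows "(\<lambda>t. h1 t + hilbert h2 t) \<in> L2" "Phi_D n h1 h2 \<in> L2"
    "Phi_ext n (cls (\<lambda>t. h1 t + hilbert h2 t)) = cls (Phi_D n h1 h2)"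
proof -
  note s1 = Vj_plus_step[OF h(1)] and s2 = Vj_plus_step[OF h(2)]
  show "(\<lambda>t. h1 t + hilbert h2 t) \<in> L2" by (intro L2_add s1 s2)
  define Q where "Q h w = (LINT t|lborel. complex_of_real (cn n (w * t)) * h t)" for h w
  obtain A1 where A1: "\<And>t. \<bar>t\<bar> > A1 \<Longrightarrow> h1 t = 0" using s1(2) by blast
  obtain A2 where A2: "\<And>t. \<bar>t\<bar> > A2 \<Longrightarrow> h2 t = 0" using s2(2) by blast
  have Q1: "Q h1 \<in> L2" "Phi n (cls h1) = cls (Q h1)"
    using Phi_integral[OF n s1(1) A1 s1(6)] by (simp_all add: Q_def[abs_def])
  have Q2: "Q h2 \<in> L2" "Phi n (cls h2) = cls (Q h2)"
    using Phi_integral[OF n s2(1) A2 s2(6)] by (simp_all add: Q_def[abs_def])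
  obtain X where X: "countable X" "\<And>t. t \<notin> X \<Longrightarrow> hilbert (hilbert h2) t = - h2 t" using s2(5) by blast
  have "(LINT t|lborel. complex_of_real (cn n (w * t)) * hilbert (hilbert h2) t) = (LINT t|lborel. - (complex_of_real (cn n (w * t)) * h2 t))" for w
    by (rule integral_discrete_difference[OF X(1)]) (auto simp: X(2))
  then have D: "Phi_D n h1 h2 = (\<lambda>w. Q h1 w + \<i> * (complex_of_real (sgn w) * - Q h2 w))"
    by (simp add: Phi_D_def Q_def fun_eq_iff)
  have m: "(\<lambda>w. - Q h2 w) \<in> L2" by (intro L2_minus Q2)
  show "Phi_D n h1 h2 \<in> L2"
    unfolding D by (intro L2_add Q1 L2_cmult L2_sgn m)
  have c: "cls (Phi_D n h1 h2) = Phi n (cls h1) + cmul \<i> (sgnmul (- Phi n (cls h2)))"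
    unfolding D Q1(2) Q2(2) cls_minus[OF Q2(1)] sgnmul_cls[OF m] cmul_cls[OF L2_sgn[OF m]]
    by (rule cls_add[symmetric, OF Q1(1) L2_cmult[OF L2_sgn[OF m]]])
  have r1: "reflect (cls h1) = cls h1" "reflect (cls h2) = cls h2"
    using s1(1,6) s2(1,6) by (simp_all add: reflect_cls)
  have r2: "reflect (Hilbert_op (cls h2)) = - Hilbert_op (cls h2)" using Hilbert_op_reflect[of "cls h2"] r1(2) by (metis minus_minus)
  have "Phi_ext n (cls (\<lambda>t. h1 t + hilbert h2 t)) = Phi_ext n (cls h1) + Phi_ext n (Hilbert_op (cls h2))"
    unfolding s2(4)[symmetric] cls_add[OF s1(1) s2(3), symmetric]
    by (rule linear_add[OF linear_Phi_ext[OF n]])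
  also have "\<dots> = cls (Phi_D n h1 h2)"
    unfolding c Phi_ext_even[OF n r1(1)] Phi_ext_odd[OF n r2] Hilbert_op_Hilbert_op linear_neg[OF linear_Phi[OF n]] ..
  finally show "Phi_ext n (cls (\<lambda>t. h1 t + hilbert h2 t)) = cls (Phi_D n h1 h2)" .
qed

section \<open>Density of the dyadic step functions and uniqueness of the extension\<close>

lemma dyadic_box:
  fixes m :: nat
  obtains h where "h \<in> Vj_plus (int j)" "h \<in> L2" "cls h = cmul c (symbox (real m / 2 ^ j))"
proof -
  \<comment> \<open>The \<open>2 * m\<close> dyadic cells that tile the symmetric interval.\<close>
  define K where "K = {- int m..<int m}"
  define h where "h t = (\<Sum>k\<in>K. c * complex_of_real (haar_phi (2 powr (real_of_int (int j)) * t - real_of_int k)))" for t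
  have even: "h (- t) = h t" for t
  proof -
    \<comment> \<open>Reflection maps cell \<open>k\<close> to cell \<open>- 1 - k\<close>.
      \<open>Vj_plus\<close> asks for evenness at every point, including grid points, where adjacent
      closed cells overlap; equality with the box is only claimed off the grid.\<close>
    have "haar_phi (2 powr (real_of_int (int j)) * - t - real_of_int k) =
      haar_phi (2 powr (real_of_int (int j)) * t - real_of_int (- 1 - k))" for k
      by (auto simp: haar_phi_def indicator_def)
    then have "h (- t) = (\<Sum>k\<in>K. c * complex_of_real (haar_phi (2 powr (real_of_int (int j)) * t - real_of_int (- 1 - k))))"
      by (simp add: h_def)
    also have "\<dots> = h t"
      unfolding h_def
      by (rule sum.reindex_bij_witness[of _ "\<lambda>k. - 1 - k" "\<lambda>k. - 1 - k"]) (auto simp: K_def)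
    finally show ?thesis .
  qed
  have "h \<in> Vj (int j)"
    unfolding Vj_def h_def by (auto simp: K_def intro!: exI[of _ K])
  then have hV: "h \<in> Vj_plus (int j)" using even by (simp add: Vj_plus_def)
  have h2: "h \<in> L2" by (rule Vj_plus_step(1)[OF hV])
  define X where "X = range (\<lambda>k::int. real_of_int k / 2 ^ j)"
  have X: "countable X" by (simp add: X_def)
  have "h t = c * complex_of_real (indicator {- (real m / 2 ^ j)..real m / 2 ^ j} t)" if t: "t \<notin> X" for t
  proof -
    define s where "s = 2 ^ j * t"
    have s: "s \<noteq> real_of_int k" for k
    proof
      assume "s = real_of_int k"
      then have "t = real_of_int k / 2 ^ j" by (simp add: s_def field_simps)
      then show False using t by (simp add: X_def)
    qed
    have hk: "haar_phi (2 powr (real_of_int (int j)) * t - real_of_int k) = (if k = \<lfloor>s\<rfloor> then 1 else 0)" for k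
    proof -
      have "k = \<lfloor>s\<rfloor> \<longleftrightarrow> real_of_int k \<le> s \<and> s \<le> real_of_int k + 1"
        using s[of "k + 1"] s[of k] by (auto simp: floor_eq_iff eq_commute[of k])
      moreover have "2 powr (real_of_int (int j)) * t = s" by (simp add: s_def powr_realpow)
      ultimately show ?thesis by (auto simp: haar_phi_def indicator_def)
    qed
    have "h t = (\<Sum>k\<in>K. if k = \<lfloor>s\<rfloor> then c else 0)"
      unfolding h_def hk by (intro sum.cong) auto
    also have "\<dots> = (if \<lfloor>s\<rfloor> \<in> K then c else 0)" by (simp add: K_def)
    also have "\<lfloor>s\<rfloor> \<in> K \<longleftrightarrow> - real m \<le> s \<and> s \<le> real m"
      using s[of "int m"] by (auto simp: K_def le_floor_iff floor_less_iff)
    also have "\<dots> \<longleftrightarrow> t \<in> {- (real m / 2 ^ j)..real m / 2 ^ j}"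
      by (auto simp: s_def field_simps)
    finally show ?thesis by (simp add: indicator_def)
  qed
  then have "ae_eq h (\<lambda>t. c * complex_of_real (indicator {- (real m / 2 ^ j)..real m / 2 ^ j} t))"
    by (intro ae_eq_countable_difference[OF X])
  then have "cls h = cmul c (symbox (real m / 2 ^ j))"
    by (simp add: symbox_def rcls_def cmul_cls real_L2_L2 real_L2_indicator_interval cls_eq_iff h2 L2_cmult)
  then show ?thesis using that hV h2 by blast
qed

lemma norm_symbox_diff:
  assumes "0 \<le> a" "a \<le> b"
  shows "(norm (symbox b - symbox a))\<^sup>2 = 2 * (b - a)"
proof -
  have i: "inner (symbox p) (symbox q) = 2 * p" if "0 \<le> p" "p \<le> q" for p q
  proof -
    have "inner (symbox p) (symbox q) = (\<bar>q - - p\<bar> + \<bar>- q - p\<bar> - \<bar>- q - - p\<bar> - \<bar>q - p\<bar>) / 2"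
      unfolding symbox_def inner_rcls[OF real_L2_indicator_interval real_L2_indicator_interval]
      using that by (intro indicator_mult_integral) auto
    moreover have "\<bar>q - - p\<bar> = q + p" "\<bar>- q - p\<bar> = q + p" "\<bar>- q - - p\<bar> = q - p" "\<bar>q - p\<bar> = q - p"
      using that by simp_all
    ultimately show ?thesis by simp
  qed
  have "(norm (symbox b - symbox a))\<^sup>2 = inner (symbox b) (symbox b) - 2 * inner (symbox a) (symbox b) + inner (symbox a) (symbox a)"
    by (simp add: power2_norm_eq_inner inner_diff_left inner_diff_right inner_commute)
  also have "\<dots> = 2 * (b - a)" using assms by (simp add: i)
  finally show ?thesis .
qed

lemma dyadic_symbox_tendsto:
  assumes "a > 0"
  shows "(\<lambda>j. symbox (real (nat \<lfloor>2 ^ j * a\<rfloor>) / 2 ^ j)) \<longlonglongrightarrow> symbox a"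
proof -
  define d where "d j = real (nat \<lfloor>2 ^ j * a\<rfloor>) / 2 ^ j" for j :: nat
  have f: "real (nat \<lfloor>2 ^ j * a\<rfloor>) = real_of_int \<lfloor>2 ^ j * a\<rfloor>" for j
    using assms by simp
  have d: "0 \<le> d j" "d j \<le> a" "a - d j \<le> (1/2) ^ j" for j
  proof -
    show "0 \<le> d j" by (simp add: d_def)
    show "d j \<le> a" unfolding d_def f by (simp add: pos_divide_le_eq mult.commute)
    have "2 ^ j * a \<le> real_of_int \<lfloor>2 ^ j * a\<rfloor> + 1" by linarith
    then have "a \<le> (real_of_int \<lfloor>2 ^ j * a\<rfloor> + 1) / 2 ^ j" by (simp add: pos_le_divide_eq mult.commute)
    then show "a - d j \<le> (1/2) ^ j" unfolding d_def f by (simp add: add_divide_distrib power_divide)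
  qed
  have lim: "(\<lambda>j. sqrt (2 * (1/2) ^ j)) \<longlonglongrightarrow> 0"
    using tendsto_real_sqrt[OF tendsto_mult_left[OF LIMSEQ_power_zero, of "1/2" 2]] by simp
  have le: "norm (symbox a - symbox (d j)) \<le> sqrt (2 * (1/2) ^ j)" for j
  proof (rule real_le_rsqrt)
    show "(norm (symbox a - symbox (d j)))\<^sup>2 \<le> 2 * (1/2) ^ j"
      unfolding norm_symbox_diff[OF d(1,2)] using d(3)[of j] by simp
  qed
  have "(\<lambda>j. norm (symbox a - symbox (d j))) \<longlonglongrightarrow> 0"
    by (rule tendsto_sandwich[OF _ _ tendsto_const lim]) (use le in auto)
  then have "(\<lambda>j. norm (symbox (d j) - symbox a)) \<longlonglongrightarrow> 0" by (simp add: norm_minus_commute)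
  then show ?thesis
    unfolding d_def by (simp add: tendsto_norm_zero_iff LIM_zero_iff)
qed

text \<open>The clauses of \<open>is_Phi_ext\<close> let \<open>T\<close> descend to a bounded
  linear operator \<open>S\<close> on \<open>l2\<close>. It agrees with \<open>Phi_ext n\<close> on
  dyadic boxes and on their Hilbert transforms, and boxes of arbitrary width are limits of
  these.\<close>

lemma is_Phi_ext_unique:
  assumes n: "n \<ge> 1" and T: "is_Phi_ext n T" and f: "f \<in> L2"
  shows "cls (T f) = Phi_ext n (cls f)"
proof -
  note T' = T[unfolded is_Phi_ext_def]
  have T1: "T f \<in> L2" if "f \<in> L2" for f using T' that by blast
  have T2: "ae_eq (T f) (T g)" if "f \<in> L2" "g \<in> L2" "ae_eq f g" for f g using T' that by blast
  define S where "S x = cls (T (rep_l2 x))" for x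
  have S: "S (cls f) = cls (T f)" if "f \<in> L2" for f
    unfolding S_def by (intro cls_eqI T1 T2 rep_l2_in_L2 that ae_eq_rep_cls)
  have Sadd: "S (x + y) = S x + S y" for x y
  proof (cases x; cases y)
    fix f g assume fg: "f \<in> L2" "g \<in> L2" "x = cls f" "y = cls g"
    have "ae_eq (T (\<lambda>x. f x + g x)) (\<lambda>x. T f x + T g x)" using T' fg by blast
    then have "cls (T (\<lambda>x. f x + g x)) = cls (\<lambda>x. T f x + T g x)"
      by (intro cls_eqI T1 L2_add fg)
    then show ?thesis using fg by (simp add: cls_add S L2_add T1)
  qed
  have Sc: "S (cmul c x) = cmul c (S x)" for c x
  proof (cases x)
    fix f assume fg: "f \<in> L2" "x = cls f"
    have "ae_eq (T (\<lambda>x. c * f x)) (\<lambda>x. c * T f x)" using T' fg by blast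
    then have "cls (T (\<lambda>x. c * f x)) = cls (\<lambda>x. c * T f x)"
      by (intro cls_eqI T1 L2_cmult fg)
    then show ?thesis using fg by (simp add: cmul_cls S L2_cmult T1)
  qed
  obtain C where C: "\<And>f. f \<in> L2 \<Longrightarrow> L2norm (T f) \<le> C * L2norm f" using T' by blast
  have Sn: "norm (S x) \<le> norm x * C" for x
  proof (cases x)
    fix f assume fg: "f \<in> L2" "x = cls f"
    show ?thesis using C[OF fg(1)] fg by (simp add: S cls_norm T1 mult.commute)
  qed
  have Sbl: "bounded_linear S"
    by (rule bounded_linear_intro[of _ C]) (simp_all add: Sadd Sn Sc flip: cmul_of_real)
  note Tbl = bounded_linear_Phi_ext[OF n]
  have D: "S (cls h1 + Hilbert_op (cls h2)) = Phi_ext n (cls h1 + Hilbert_op (cls h2))" if h: "h1 \<in> Vj_plus j" "h2 \<in> Vj_plus j" for h1 h2 j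
  proof -
    note P = Phi_D_cls[OF n h]
    have "ae_eq (T (\<lambda>t. h1 t + hilbert h2 t)) (Phi_D n h1 h2)" using T' h by blast
    then have "cls (T (\<lambda>t. h1 t + hilbert h2 t)) = cls (Phi_D n h1 h2)"
      by (intro cls_eqI T1 P)
    then have "S (cls (\<lambda>t. h1 t + hilbert h2 t)) = Phi_ext n (cls (\<lambda>t. h1 t + hilbert h2 t))"
      using P by (simp add: S)
    then show ?thesis
      using cls_add[OF Vj_plus_step(1)[OF h(1)] Vj_plus_step(3)[OF h(2)]] Vj_plus_step(4)[OF h(2)] by simp
  qed
  \<comment> \<open>Taking one of \<open>h1\<close> and \<open>h2\<close> to be zero separates the
    two summands in \<open>D\<close>.\<close>
  have z: "(\<lambda>t. 0) \<in> Vj_plus j" for j by (auto simp: Vj_plus_def Vj_def intro!: exI[of _ "{}"])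
  note H0 = linear_0[OF linear_Hilbert_op]
  have dy: "S (cmul c (symbox (real m / 2 ^ j))) = Phi_ext n (cmul c (symbox (real m / 2 ^ j)))"
    "S (Hilbert_op (cmul c (symbox (real m / 2 ^ j)))) = Phi_ext n (Hilbert_op (cmul c (symbox (real m / 2 ^ j))))" for c m and j :: nat
  proof -
    obtain h where h: "h \<in> Vj_plus (int j)" "cls h = cmul c (symbox (real m / 2 ^ j))" by (rule dyadic_box)
    show "S (cmul c (symbox (real m / 2 ^ j))) = Phi_ext n (cmul c (symbox (real m / 2 ^ j)))"
      using D[OF h(1) z] by (simp add: h(2) cls_zero H0)
    show "S (Hilbert_op (cmul c (symbox (real m / 2 ^ j)))) = Phi_ext n (Hilbert_op (cmul c (symbox (real m / 2 ^ j))))"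
      using D[OF z h(1)] by (simp add: h(2) cls_zero)
  qed
  have lim: "F (cmul c (symbox a)) = F' (cmul c (symbox a))"
    if F: "bounded_linear F" "bounded_linear F'"
      and eq: "\<And>m j. F (cmul c (symbox (real m / 2 ^ j))) = F' (cmul c (symbox (real m / 2 ^ j)))"
      and a: "a > 0" for F F' :: "l2 \<Rightarrow> l2" and c a
  proof -
    have "(\<lambda>j. F (cmul c (symbox (real (nat \<lfloor>2 ^ j * a\<rfloor>) / 2 ^ j)))) \<longlonglongrightarrow> F (cmul c (symbox a))"
      by (intro bounded_linear.tendsto[OF F(1)] bounded_linear.tendsto[OF bounded_linear_cmul] dyadic_symbox_tendsto a)
    moreover have "(\<lambda>j. F' (cmul c (symbox (real (nat \<lfloor>2 ^ j * a\<rfloor>) / 2 ^ j)))) \<longlonglongrightarrow> F' (cmul c (symbox a))"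
      by (intro bounded_linear.tendsto[OF F(2)] bounded_linear.tendsto[OF bounded_linear_cmul] dyadic_symbox_tendsto a)
    ultimately show ?thesis unfolding eq by (rule LIMSEQ_unique)
  qed
  have e1: "S (evenp x) = Phi_ext n (evenp x)" for x
    by (rule evenp_eqI[OF Sbl Tbl]) (rule lim[OF Sbl Tbl dy(1)])
  have e2: "S (Hilbert_op (evenp x)) = Phi_ext n (Hilbert_op (evenp x))" for x
  proof (rule evenp_eqI[where f = "\<lambda>x. S (Hilbert_op x)" and g = "\<lambda>x. Phi_ext n (Hilbert_op x)"])
    note bl = bounded_linear_compose[OF Sbl bounded_linear_Hilbert_op] bounded_linear_compose[OF Tbl bounded_linear_Hilbert_op]
    show "bounded_linear (\<lambda>x. S (Hilbert_op x))" "bounded_linear (\<lambda>x. Phi_ext n (Hilbert_op x))" by (rule bl)+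
    show "S (Hilbert_op (cmul c (symbox a))) = Phi_ext n (Hilbert_op (cmul c (symbox a)))" if "a > 0" for c a
      by (rule lim[OF bl dy(2) that])
  qed
  \<comment> \<open>\<open>Hilbert_op\<close> exchanges parities and its square is
    \<open>- 1\<close>, so the odd part of \<open>x\<close> is the transform of the even part of
    \<open>- Hilbert_op x\<close>.\<close>
  have dec: "x = evenp x + Hilbert_op (evenp (- Hilbert_op x))" for x
  proof -
    have lin: "linear Hilbert_op" by (rule linear_Hilbert_op)
    have "Hilbert_op (evenp (- Hilbert_op x)) = (1 / 2) *\<^sub>R (- Hilbert_op (Hilbert_op x) - Hilbert_op (reflect (Hilbert_op x)))"
      using linear_reflect
      by (simp add: evenp_def linear_scale[OF lin] linear_add[OF lin] linear_diff[OF lin] linear_neg[OF lin] linear_neg)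
    also have "\<dots> = (1 / 2) *\<^sub>R (x - reflect x)"
      by (simp add: Hilbert_op_reflect Hilbert_op_Hilbert_op linear_neg[OF linear_reflect])
    finally show ?thesis by (simp add: evenp_def scaleR_2 flip: scaleR_add_right scaleR_add_left)
  qed
  have "S x = Phi_ext n x" for x
    by (subst (1 2) dec[of x]) (simp add: Sadd linear_add[OF bounded_linear.linear[OF Tbl]] e1 e2)
  then show ?thesis using S[OF f] by simp
qed

lemma is_Phi_ext_exists:
  assumes n: "n \<ge> 1"
  shows "is_Phi_ext n (\<lambda>f. rep_l2 (Phi_ext n (cls f)))"
proof -
  note lin = linear_Phi_ext[OF n]
  show ?thesis
    unfolding is_Phi_ext_def
  proof (intro conjI ballI allI impI)
    show "rep_l2 (Phi_ext n (cls f)) \<in> L2" for f by simp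
  next
    fix f g assume f: "f \<in> L2" and g: "g \<in> L2" and "ae_eq f g"
    then have "cls f = cls g" by (intro cls_eqI)
    then show "ae_eq (rep_l2 (Phi_ext n (cls f))) (rep_l2 (Phi_ext n (cls g)))" by (simp only: ae_eq_refl)
  next
    fix f g assume f: "f \<in> L2" and g: "g \<in> L2"
    have "Phi_ext n (cls (\<lambda>x. f x + g x)) = cls (\<lambda>x. rep_l2 (Phi_ext n (cls f)) x + rep_l2 (Phi_ext n (cls g)) x)"
      by (simp only: cls_add[symmetric] f g linear_add[OF lin] rep_l2_in_L2 cls_rep)
    then show "ae_eq (rep_l2 (Phi_ext n (cls (\<lambda>x. f x + g x)))) (\<lambda>x. rep_l2 (Phi_ext n (cls f)) x + rep_l2 (Phi_ext n (cls g)) x)"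
      by (simp only: ae_eq_rep_cls L2_add rep_l2_in_L2)
  next
    fix f c assume f: "f \<in> L2"
    have "Phi_ext n (cls (\<lambda>x. c * f x)) = cls (\<lambda>x. c * rep_l2 (Phi_ext n (cls f)) x)"
      by (simp only: cmul_cls[symmetric] f Phi_ext_cmul[OF n] rep_l2_in_L2 cls_rep)
    then show "ae_eq (rep_l2 (Phi_ext n (cls (\<lambda>x. c * f x)))) (\<lambda>x. c * rep_l2 (Phi_ext n (cls f)) x)"
      by (simp only: ae_eq_rep_cls L2_cmult rep_l2_in_L2)
  next
    obtain C where C: "\<And>x. norm (Phi_ext n x) \<le> norm x * C"
      using bounded_linear.bounded[OF bounded_linear_Phi_ext[OF n]] by blast
    have "L2norm (rep_l2 (Phi_ext n (cls f))) \<le> C * L2norm f" if "f \<in> L2" for f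
      using C[of "cls f"] that by (simp add: mult.commute flip: cls_norm)
    then show "\<exists>C. \<forall>f\<in>L2. L2norm (rep_l2 (Phi_ext n (cls f))) \<le> C * L2norm f" by blast
  next
    fix j h1 h2 assume h: "h1 \<in> Vj_plus j" "h2 \<in> Vj_plus j"
    show "ae_eq (rep_l2 (Phi_ext n (cls (\<lambda>t. h1 t + hilbert h2 t)))) (Phi_D n h1 h2)"
      using Phi_D_cls[OF n h] ae_eq_rep_cls by simp
  qed
qed

text \<open>The existence claim keeps the statement about all \<open>T\<close> from being vacuous.
  The fourth power is computed in \<open>l2\<close>, where every such \<open>T\<close> becomes
  \<open>Phi_ext n\<close>.\<close>

theorem theorem4:
  fixes n :: nat
  assumes "n \<ge> 1"
  shows "(\<exists>T. is_Phi_ext n T) \<and>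
         (\<forall>T. is_Phi_ext n T \<longrightarrow> (\<forall>f\<in>L2. ae_eq (T (T (T (T f)))) f))"
proof (intro conjI allI impI ballI)
  show "\<exists>T. is_Phi_ext n T" using is_Phi_ext_exists[OF assms] by blast
  fix T f assume T: "is_Phi_ext n T" and f: "f \<in> L2"
  have L: "T g \<in> L2" if "g \<in> L2" for g using T that unfolding is_Phi_ext_def by blast
  have "cls (T (T (T (T f)))) = cls f"
    using f by (simp add: is_Phi_ext_unique[OF assms T] L Phi_ext_fourth[OF assms])
  then show "ae_eq (T (T (T (T f)))) f" using f by (simp add: cls_eq_iff L)
qed

end
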